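(* Let $X$ be a second countable Stone space. If $X$ is stable, then $\operatorname{Homeo}(X)$ has the automatic continuity property.
   Context: A second countable Stone space is a compact, totally disconnected, metrizable space. $\operatorname{Homeo}(X)$ carries the compact-open topology. A topological group $G$ has the automatic continuity property if every group homomorphism from $G$ to a separable topological group is continuous. Neighborhoods in $X$ are always clopen. A neighborhood $U$ of $x\in X$ is stable if for every neighborhood $U'\subset U$ of $x$ there is a homeomorphism $U\to U'$ fixing $x$. $X$ is stable if every point of $X$ has a stable neighborhood. *)

theory Defs
  imports "HOL-Analysis.Analysis" "HOL-Algebra.Bij"
begin

definition totally_disconnected_space :: "'a topology \<Rightarrow> bool" where
  "totally_disconnected_space X \<longleftrightarrow> (\<forall>S. connectedin X S \<longrightarrow> (\<exists>a. S \<subseteq> {a}))"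

definition second_countable_Stone_space :: "'a topology \<Rightarrow> bool" where
  "second_countable_Stone_space X \<longleftrightarrow>
     compact_space X \<and> totally_disconnected_space X \<and> metrizable_space X"

definition clopen_nbhd :: "'a topology \<Rightarrow> 'a \<Rightarrow> 'a set \<Rightarrow> bool" where
  "clopen_nbhd X x U \<longleftrightarrow> openin X U \<and> closedin X U \<and> x \<in> U"

definition stable_nbhd :: "'a topology \<Rightarrow> 'a \<Rightarrow> 'a set \<Rightarrow> bool" where
  "stable_nbhd X x U \<longleftrightarrow> clopen_nbhd X x U \<and>
     (\<forall>U'. clopen_nbhd X x U' \<and> U' \<subseteq> U \<longrightarrow>
        (\<exists>f. homeomorphic_map (subtopology X U) (subtopology X U') f \<and> f x = x))"

definition stable_space :: "'a topology \<Rightarrow> bool" where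
  "stable_space X \<longleftrightarrow> (\<forall>x \<in> topspace X. \<exists>U. stable_nbhd X x U)"

(* Maps X -> Y are represented by functions that are extensional on topspace X, so that
   equality of maps is equality in HOL. Taking K = {} in the subbasis shows that the
   underlying set of the topology is the set of all continuous maps. *)
definition compact_open_topology :: "'a topology \<Rightarrow> 'b topology \<Rightarrow> ('a \<Rightarrow> 'b) topology" where
  "compact_open_topology X Y = topology_generated_by
     {{f \<in> extensional (topspace X). continuous_map X Y f \<and> f ` K \<subseteq> U} | K U.
        compactin X K \<and> openin Y U}"

definition Homeo :: "'a topology \<Rightarrow> ('a \<Rightarrow> 'a) monoid" where
  "Homeo X = (BijGroup (topspace X))
     \<lparr>carrier := {f \<in> extensional (topspace X). homeomorphic_map X X f}\<rparr>"

definition Homeo_topology :: "'a topology \<Rightarrow> ('a \<Rightarrow> 'a) topology" where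
  "Homeo_topology X = subtopology (compact_open_topology X X) (carrier (Homeo X))"

(* No separation axiom is imposed. *)
definition topological_group :: "'g monoid \<Rightarrow> 'g topology \<Rightarrow> bool" where
  "topological_group G T \<longleftrightarrow> group G \<and> topspace T = carrier G \<and>
     continuous_map (prod_topology T T) T (\<lambda>(x, y). x \<otimes>\<^bsub>G\<^esub> y) \<and>
     continuous_map T T (\<lambda>x. inv\<^bsub>G\<^esub> x)"

(* HOL cannot quantify over types inside a formula, so the type of the elements of the
   target groups is a parameter. Leaving it as a type variable in a theorem covers all
   separable topological groups. *)
definition automatic_continuity :: "'h itself \<Rightarrow> 'g monoid \<Rightarrow> 'g topology \<Rightarrow> bool" where
  "automatic_continuity (_ :: 'h itself) G T \<longleftrightarrow> topological_group G T \<and>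
     (\<forall>(H :: 'h monoid) S \<phi>. topological_group H S \<and> separable_space S \<and> \<phi> \<in> hom G H
        \<longrightarrow> continuous_map T S \<phi>)"

end

theory Submission
  imports Defs
begin

text \<open>
Let \<open>C\<close> be the Boolean algebra of clopen subsets of \<open>X\<close>. It is countable and separates points, and
by compactness a homeomorphism of \<open>X\<close> is the same as an automorphism of \<open>C\<close>; the homeomorphisms that
preserve each of finitely many clopen sets form a basis of neighbourhoods of the identity. Up to the
last two sections the proof is about such an algebra of sets and mentions no topology.

Let \<open>\<phi>\<close> be a homomorphism from \<open>Homeo X\<close> to a separable group \<open>H\<close>, let \<open>B\<close> be a neighbourhood of
the identity of \<open>H\<close>, and let \<open>W\<close> be the preimage of a symmetric neighbourhood whose 82-fold products
lie in \<open>B\<close>. Separability of \<open>H\<close> gives a colouring of \<open>Homeo X\<close> by natural numbers such that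
\<open>inverse g o h\<close> lies in \<open>W\<close> whenever \<open>g\<close> and \<open>h\<close> have the same colour. It is therefore enough to show
that the 82-fold products of \<open>W\<close> contain a neighbourhood of the identity (a Steinhaus property,
stable_imp_neighbourhood_in_products).

By a Baire category argument some colour is somewhere dense, so that \<open>W\<close> is dense in the group of
homeomorphisms preserving a certain finite set \<open>R\<close> of clopen sets (somewhere_dense). Cover \<open>X\<close> by
stable neighbourhoods \<open>U x\<close> of finitely many points \<open>x\<close>, each contained in or disjoint from every
member of \<open>R\<close>, and choose disjoint smaller neighbourhoods \<open>V x\<close>. Removing the points \<open>x\<close> from the sets
\<open>V x\<close> leaves a locally compact space \<open>Y\<close>, whose ends are these points. Stability says that every
compact part of \<open>Y\<close> has copies arbitrarily close to the ends. A back-and-forth construction then shows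
that any two clopen subsets of \<open>Y\<close> with room for such copies (called full) are homeomorphic
(full_end_iso), and \<open>Y\<close> is a disjoint union of compact open pieces \<open>E 0, E 1, ...\<close> in which every
infinite union of pieces is full (ex_pieces). This makes the homeomorphisms of \<open>Y\<close> behave like the
permutations of the natural numbers, and the known proof of automatic continuity for the symmetric
group on a countable set can be followed. A diagonal argument against the colours, a commutator trick
and an infinite swindle produce an infinite and coinfinite union of pieces all of whose homeomorphisms
lie in the fourth power of \<open>W\<close>. Continuum many almost disjoint sets of pieces cannot all receive
different colours, which moves this union by an element of \<open>W\<close> to a second one that together with it
covers all of \<open>Y\<close> but a compact set \<open>D\<close> (supported_cofinite_in_products).

In the symmetric group the finite rest is harmless, since fixing it is an open condition. Here
homeomorphisms of \<open>D\<close>, of the uncovered part of \<open>X\<close>, and those that move the points \<open>x\<close> must still be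
treated. This is where density of \<open>W\<close> is used: since \<open>U x\<close> lies on one side of every member of \<open>R\<close>,
an element of \<open>W\<close> can push the part of \<open>U x\<close> outside \<open>V x - D\<close> into \<open>V x - D\<close>, and another one can move
every \<open>x\<close> that is movable at all (neighbourhood_in_products).
\<close>

section \<open>Bijections\<close>

text \<open>The inverse of a function on its whole type; the usual notation for it clashes with that for
inverses in groups.\<close>

abbreviation invf :: "('a \<Rightarrow> 'b) \<Rightarrow> 'b \<Rightarrow> 'a" where
  "invf \<equiv> inv_into UNIV"

definition ext_id :: "'a set \<Rightarrow> ('a \<Rightarrow> 'a) \<Rightarrow> 'a \<Rightarrow> 'a" where
  "ext_id A f p = (if p \<in> A then f p else p)"

lemma ext_id_simps [simp]: "p \<in> A \<Longrightarrow> ext_id A f p = f p" "p \<notin> A \<Longrightarrow> ext_id A f p = p"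
  by (auto simp: ext_id_def)

lemma ext_id_comp:
  assumes "bij_betw f A A"
  shows "ext_id A (inv_into A f) (ext_id A f p) = p" "ext_id A f (ext_id A (inv_into A f) p) = p"
  using assms by (auto simp: ext_id_def bij_betw_def inv_into_into f_inv_into_f)

lemma bij_ext_id:
  assumes "bij_betw f A A"
  shows "bij (ext_id A f)" "invf (ext_id A f) = ext_id A (inv_into A f)"
proof -
  show "bij (ext_id A f)"
    by (rule o_bij[where g = "ext_id A (inv_into A f)"]) (auto simp: fun_eq_iff ext_id_comp[OF assms])
  show "invf (ext_id A f) = ext_id A (inv_into A f)"
    by (rule inv_unique_comp) (auto simp: fun_eq_iff ext_id_comp[OF assms])
qed

definition swap_map :: "'a set \<Rightarrow> 'a set \<Rightarrow> ('a \<Rightarrow> 'a) \<Rightarrow> 'a \<Rightarrow> 'a" where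
  "swap_map A B f p = (if p \<in> A then f p else inv_into A f p)"

lemma bij_inv_cancel: "bij f \<Longrightarrow> f (invf f p) = p" "bij f \<Longrightarrow> invf f (f p) = p"
  by (simp_all add: bij_is_inj bij_is_surj surj_f_inv_f)

section \<open>Clopen algebras and their automorphisms\<close>

text \<open>The clopen subsets of a second countable Stone space with point set \<open>S\<close>; every countable Boolean
algebra of sets that separates points and is compact arises in this way.\<close>

locale clopen_algebra =
  fixes S :: "'a set" and C :: "'a set set"
  assumes countable_C: "countable C"
    and C_subset: "A \<in> C \<Longrightarrow> A \<subseteq> S"
    and S_in_C: "S \<in> C"
    and C_Un: "A \<in> C \<Longrightarrow> B \<in> C \<Longrightarrow> A \<union> B \<in> C"
    and C_Compl: "A \<in> C \<Longrightarrow> S - A \<in> C"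
    and separation: "p \<in> S \<Longrightarrow> q \<in> S \<Longrightarrow> p \<noteq> q \<Longrightarrow> \<exists>A\<in>C. p \<in> A \<and> q \<notin> A"
    and compactness: "\<U> \<subseteq> C \<Longrightarrow> \<Union>\<U> = S \<Longrightarrow> \<exists>\<V>. finite \<V> \<and> \<V> \<subseteq> \<U> \<and> \<Union>\<V> = S"
begin

lemma C_empty: "{} \<in> C"
  using C_Compl[OF S_in_C] by simp

lemma C_Int: assumes "A \<in> C" "B \<in> C" shows "A \<inter> B \<in> C"
proof -
  have "A \<inter> B = S - ((S - A) \<union> (S - B))" using assms C_subset by blast
  then show ?thesis using assms by (simp only: C_Compl C_Un)
qed

lemma C_Diff: assumes "A \<in> C" "B \<in> C" shows "A - B \<in> C"
proof -
  have "A - B = A \<inter> (S - B)" using assms C_subset by blast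
  then show ?thesis using assms by (simp only: C_Compl C_Int)
qed

lemma C_UN: "finite I \<Longrightarrow> (\<And>i. i \<in> I \<Longrightarrow> A i \<in> C) \<Longrightarrow> (\<Union>i\<in>I. A i) \<in> C"
  by (induction I rule: finite_induct) (auto simp: C_empty C_Un)

lemma C_INT: "finite I \<Longrightarrow> B \<in> C \<Longrightarrow> (\<And>i. i \<in> I \<Longrightarrow> A i \<in> C) \<Longrightarrow> B \<inter> (\<Inter>i\<in>I. A i) \<in> C"
proof (induction I rule: finite_induct)
  case (insert i I)
  have "B \<inter> (\<Inter>i\<in>insert i I. A i) = (B \<inter> (\<Inter>i\<in>I. A i)) \<inter> A i" by auto
  then show ?case using insert by (simp only: C_Int insertI1 insertI2)
qed simp

lemma finite_disjointification:
  assumes "finite I" "\<And>i. i \<in> I \<Longrightarrow> U i \<in> C" "A \<in> C" "A \<subseteq> (\<Union>i\<in>I. U i)"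
  shows "\<exists>D. (\<forall>i\<in>I. D i \<in> C \<and> D i \<subseteq> U i) \<and> disjoint_family_on D I \<and> (\<Union>i\<in>I. D i) = A"
  using assms
proof (induction I arbitrary: A rule: finite_induct)
  case empty then show ?case by (auto simp: disjoint_family_on_def)
next
  case (insert i I)
  have "A - U i \<in> C" "A - U i \<subseteq> (\<Union>i\<in>I. U i)" using insert.prems C_Diff by auto
  then obtain D where D: "\<forall>j\<in>I. D j \<in> C \<and> D j \<subseteq> U j" "disjoint_family_on D I" "(\<Union>i\<in>I. D i) = A - U i"
    using insert.IH insert.prems by (metis insertCI)
  have Di: "D j \<inter> U i = {}" if "j \<in> I" for j using D(3) that by auto
  define D' where "D' j = (if j = i then A \<inter> U i else D j)" for j
  have "disjoint_family_on D' (insert i I)"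
    using Di D(2) insert.hyps unfolding disjoint_family_on_def D'_def
    by (auto split: if_splits)
  moreover have "(\<Union>j\<in>insert i I. D' j) = A"
  proof -
    have "(\<Union>j\<in>insert i I. D' j) = (A \<inter> U i) \<union> (\<Union>j\<in>I. D j)"
      using insert.hyps by (auto simp: D'_def)
    then show ?thesis using D(3) by auto
  qed
  moreover have "\<forall>j\<in>insert i I. D' j \<in> C \<and> D' j \<subseteq> U j"
    using D(1) insert.prems by (auto simp: D'_def intro: C_Int)
  ultimately show ?case by blast
qed

text \<open>For clopen sets \<open>A\<close> and \<open>B\<close> these are the homeomorphisms from \<open>A\<close> to \<open>B\<close>. The sets may also be
just open: their subsets that belong to \<open>C\<close> are then the compact open ones, and the maps are the
homeomorphisms between these locally compact spaces.\<close>

definition clopen_iso :: "'a set \<Rightarrow> 'a set \<Rightarrow> ('a \<Rightarrow> 'a) \<Rightarrow> bool" where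
  "clopen_iso A B f \<longleftrightarrow> bij_betw f A B \<and> (\<forall>T\<subseteq>A. f ` T \<in> C \<longleftrightarrow> T \<in> C)"

lemma clopen_isoD:
  assumes "clopen_iso A B f"
  shows "bij_betw f A B" "f ` A = B" "inj_on f A" "T \<subseteq> A \<Longrightarrow> f ` T \<in> C \<longleftrightarrow> T \<in> C"
  using assms by (auto simp: clopen_iso_def bij_betw_def)

lemma clopen_iso_cong:
  assumes "\<And>p. p \<in> A \<Longrightarrow> f p = g p"
  shows "clopen_iso A B f \<longleftrightarrow> clopen_iso A B g"
proof -
  have "T \<subseteq> A \<Longrightarrow> f ` T = g ` T" for T using assms by (meson image_cong subsetD)
  then show ?thesis using assms bij_betw_cong[of A f g B] by (auto simp: clopen_iso_def)
qed

lemma clopen_iso_comp: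
  assumes "clopen_iso A B f" "clopen_iso B D g"
  shows "clopen_iso A D (g \<circ> f)"
proof -
  have "(g \<circ> f) ` T \<in> C \<longleftrightarrow> T \<in> C" if "T \<subseteq> A" for T
  proof -
    have "f ` T \<subseteq> B" using clopen_isoD(2)[OF assms(1)] that by auto
    then have "g ` f ` T \<in> C \<longleftrightarrow> T \<in> C"
      using clopen_isoD(4)[OF assms(1) that] clopen_isoD(4)[OF assms(2), of "f ` T"] by simp
    then show ?thesis by (simp add: image_image)
  qed
  then show ?thesis
    using bij_betw_trans[OF clopen_isoD(1)[OF assms(1)] clopen_isoD(1)[OF assms(2)]]
    unfolding clopen_iso_def by blast
qed

lemma clopen_iso_inv:
  assumes "clopen_iso A B f"
  shows "clopen_iso B A (inv_into A f)"
proof -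
  have "inv_into A f ` T \<in> C \<longleftrightarrow> T \<in> C" if "T \<subseteq> B" for T
  proof -
    have "f ` (inv_into A f ` T) = T" using clopen_isoD(2)[OF assms] that
      by (simp only: image_inv_into_cancel)
    moreover have "inv_into A f ` T \<subseteq> A" using clopen_isoD(2)[OF assms] that
      by (auto intro: inv_into_into)
    ultimately show ?thesis using clopen_isoD(4)[OF assms, of "inv_into A f ` T"] by simp
  qed
  then show ?thesis using assms bij_betw_inv_into unfolding clopen_iso_def by blast
qed

lemma clopen_iso_restrict:
  assumes "clopen_iso A B f" "T \<subseteq> A"
  shows "clopen_iso T (f ` T) f"
  using assms by (auto simp: clopen_iso_def bij_betw_def intro: inj_on_subset)

text \<open>The families of pieces along which maps may be glued: a compact open subset of the union meets
only finitely many members, each in a clopen set.\<close>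

definition loc_fin :: "'i set \<Rightarrow> ('i \<Rightarrow> 'a set) \<Rightarrow> bool" where
  "loc_fin I A \<longleftrightarrow> (\<forall>T\<in>C. T \<subseteq> (\<Union>i\<in>I. A i) \<longrightarrow> finite {i\<in>I. T \<inter> A i \<noteq> {}} \<and> (\<forall>i\<in>I. T \<inter> A i \<in> C))"

lemma loc_fin_finite: "finite I \<Longrightarrow> (\<And>i. i \<in> I \<Longrightarrow> A i \<in> C) \<Longrightarrow> loc_fin I A"
  by (auto simp: loc_fin_def C_Int)

lemma clopen_iso_UN:
  assumes iso: "\<And>i. i \<in> I \<Longrightarrow> clopen_iso (A i) (B i) f"
    and disj: "disjoint_family_on B I"
    and lf: "loc_fin I A" "loc_fin I B"
  shows "clopen_iso (\<Union>i\<in>I. A i) (\<Union>i\<in>I. B i) f"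
  unfolding clopen_iso_def
proof (intro conjI allI impI)
  show bij: "bij_betw f (\<Union>i\<in>I. A i) (\<Union>i\<in>I. B i)"
    by (rule bij_betw_UNION_disjoint[OF disj]) (use iso clopen_isoD(1) in blast)
  have fA: "f ` A i = B i" if "i \<in> I" for i using iso that clopen_isoD(2) by blast
  fix T assume T: "T \<subseteq> (\<Union>i\<in>I. A i)"
  show "f ` T \<in> C \<longleftrightarrow> T \<in> C"
  proof
    assume TC: "T \<in> C"
    then have fin: "finite {i\<in>I. T \<inter> A i \<noteq> {}}" and "\<forall>i\<in>I. T \<inter> A i \<in> C"
      using lf(1) T by (auto simp: loc_fin_def)
    then have "f ` (T \<inter> A i) \<in> C" if "i \<in> I" for i
      using clopen_isoD(4)[OF iso[OF that], of "T \<inter> A i"] that by auto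
    then have "(\<Union>i\<in>{i\<in>I. T \<inter> A i \<noteq> {}}. f ` (T \<inter> A i)) \<in> C"
      by (intro C_UN fin) auto
    also have "(\<Union>i\<in>{i\<in>I. T \<inter> A i \<noteq> {}}. f ` (T \<inter> A i)) = f ` T" using T by fastforce
    finally show "f ` T \<in> C" .
  next
    assume TC: "f ` T \<in> C"
    have "f ` T \<subseteq> (\<Union>i\<in>I. B i)" using T fA by blast
    then have fin: "finite {i\<in>I. f ` T \<inter> B i \<noteq> {}}" and fB: "\<forall>i\<in>I. f ` T \<inter> B i \<in> C"
      using lf(2) TC by (auto simp: loc_fin_def)
    have eq: "f ` (T \<inter> A i) = f ` T \<inter> B i" if "i \<in> I" for i
    proof -
      have "f ` (T \<inter> A i) = f ` T \<inter> f ` A i"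
        using bij T that by (intro inj_on_image_Int[of f "\<Union>i\<in>I. A i"]) (auto simp: bij_betw_def)
      then show ?thesis using fA that by simp
    qed
    have "T \<inter> A i \<in> C" if "i \<in> I" for i
      using clopen_isoD(4)[OF iso[OF that], of "T \<inter> A i"] that fB eq by auto
    then have "(\<Union>i\<in>{i\<in>I. f ` T \<inter> B i \<noteq> {}}. T \<inter> A i) \<in> C"
      by (intro C_UN fin) auto
    also have "(\<Union>i\<in>{i\<in>I. f ` T \<inter> B i \<noteq> {}}. T \<inter> A i) = T" using T fA by fastforce
    finally show "T \<in> C" .
  qed
qed

lemma clopen_iso_glue:
  assumes iso: "\<And>i. i \<in> I \<Longrightarrow> clopen_iso (A i) (B i) (f i)"
    and disj: "disjoint_family_on A I" "disjoint_family_on B I"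
    and lf: "loc_fin I A" "loc_fin I B"
  shows "\<exists>h. clopen_iso (\<Union>i\<in>I. A i) (\<Union>i\<in>I. B i) h \<and> (\<forall>i\<in>I. \<forall>p\<in>A i. h p = f i p)"
proof -
  define h where "h p = f (SOME i. i \<in> I \<and> p \<in> A i) p" for p
  have h: "h p = f i p" if "i \<in> I" "p \<in> A i" for i p
  proof -
    have "(SOME i. i \<in> I \<and> p \<in> A i) = i"
      using that disj(1) by (intro some_equality) (auto simp: disjoint_family_on_def)
    then show ?thesis by (simp add: h_def)
  qed
  have "clopen_iso (\<Union>i\<in>I. A i) (\<Union>i\<in>I. B i) h"
  proof (rule clopen_iso_UN[OF _ disj(2) lf])
    fix i assume "i \<in> I"
    then show "clopen_iso (A i) (B i) h" using iso h clopen_iso_cong[of "A i" h "f i"] by blast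
  qed
  with h show ?thesis by blast
qed

text \<open>The homeomorphism group, represented by bijections of the whole type that move only points of \<open>S\<close>,
so that the group operations are composition and inversion of functions.\<close>

definition Aut :: "('a \<Rightarrow> 'a) set" where
  "Aut = {g. bij g \<and> (\<forall>p. p \<notin> S \<longrightarrow> g p = p) \<and> (\<forall>T. g ` T \<in> C \<longleftrightarrow> T \<in> C)}"

lemma AutD:
  assumes "g \<in> Aut"
  shows "bij g" "p \<notin> S \<Longrightarrow> g p = p" "g ` T \<in> C \<longleftrightarrow> T \<in> C"
  using assms by (auto simp: Aut_def)

lemma AutI:
  assumes "bij g" "\<And>p. p \<notin> S \<Longrightarrow> g p = p" "\<And>T. T \<in> C \<Longrightarrow> g ` T \<in> C" "\<And>T. T \<in> C \<Longrightarrow> invf g ` T \<in> C"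
  shows "g \<in> Aut"
proof -
  have "T \<in> C" if "g ` T \<in> C" for T
    using assms(4)[OF that] assms(1) by (simp add: bij_is_inj image_inv_f_f)
  then show ?thesis unfolding Aut_def mem_Collect_eq using assms(1-3) by blast
qed

lemma Aut_id: "id \<in> Aut" by (auto simp: Aut_def)

lemma Aut_comp: "g \<in> Aut \<Longrightarrow> h \<in> Aut \<Longrightarrow> g \<circ> h \<in> Aut"
  unfolding Aut_def mem_Collect_eq by (metis bij_comp comp_apply image_comp)

lemma Aut_inv: assumes "g \<in> Aut" shows "invf g \<in> Aut"
proof (rule AutI)
  show "bij (invf g)" using AutD(1)[OF assms] by (rule bij_imp_bij_inv)
  show "invf g p = p" if "p \<notin> S" for p
    using AutD(1,2)[OF assms] that by (metis bij_inv_cancel(2))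
  show "invf g ` T \<in> C" if "T \<in> C" for T
    using AutD(3)[OF assms, of "invf g ` T"] AutD(1)[OF assms] that
    by (simp add: image_f_inv_f bij_is_surj)
  show "invf (invf g) ` T \<in> C" if "T \<in> C" for T
    using AutD(3)[OF assms] AutD(1)[OF assms] that by (simp add: inv_inv_eq)
qed

lemma Aut_S: "g \<in> Aut \<Longrightarrow> g p \<in> S \<longleftrightarrow> p \<in> S"
  by (metis AutD(1,2) bij_inv_cancel(2))

lemma Aut_image_S: assumes "g \<in> Aut" shows "g ` S = S"
proof
  show "g ` S \<subseteq> S" using Aut_S[OF assms] by auto
  show "S \<subseteq> g ` S"
  proof
    fix p assume "p \<in> S"
    then have "invf g p \<in> S" using Aut_S[OF Aut_inv[OF assms]] by simp
    then show "p \<in> g ` S" using AutD(1)[OF assms] by (metis bij_inv_cancel(1) imageI)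
  qed
qed

lemma Aut_clopen_iso: "g \<in> Aut \<Longrightarrow> clopen_iso A (g ` A) g"
  using AutD(1,3)[of g] by (auto simp: clopen_iso_def bij_betw_def bij_def intro: inj_on_subset)

lemma ext_id_Aut:
  assumes A: "A \<in> C" and f: "clopen_iso A A f"
  shows "ext_id A f \<in> Aut"
proof -
  have *: "ext_id A h ` T \<in> C" if h: "clopen_iso A A h" and "T \<in> C" for h T
  proof -
    have "ext_id A h ` T = (T - A) \<union> h ` (T \<inter> A)" by (auto simp: ext_id_def)
    moreover have "h ` (T \<inter> A) \<in> C" using clopen_isoD(4)[OF h, of "T \<inter> A"] that A C_Int by auto
    ultimately show ?thesis using that A by (simp add: C_Diff C_Un)
  qed
  show ?thesis
  proof (rule AutI)
    show "bij (ext_id A f)" using bij_ext_id(1) clopen_isoD(1)[OF f] .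
    show "ext_id A f p = p" if "p \<notin> S" for p using that C_subset[OF A] by (auto simp: ext_id_def)
    show "ext_id A f ` T \<in> C" if "T \<in> C" for T using *[OF f that] .
    show "invf (ext_id A f) ` T \<in> C" if "T \<in> C" for T
      using *[OF clopen_iso_inv[OF f] that] bij_ext_id(2)[OF clopen_isoD(1)[OF f]] by simp
  qed
qed

lemma clopen_iso_swap_map:
  assumes f: "clopen_iso A B f" and disj: "A \<inter> B = {}"
    and reg: "\<And>T. T \<in> C \<Longrightarrow> T \<subseteq> A \<union> B \<Longrightarrow> T \<inter> A \<in> C \<and> T \<inter> B \<in> C"
  shows "clopen_iso (A \<union> B) (A \<union> B) (swap_map A B f)"
proof -
  let ?A = "\<lambda>i. if i then A else B" and ?B = "\<lambda>i. if i then B else A"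
  have "clopen_iso (\<Union>i\<in>UNIV. ?A i) (\<Union>i\<in>UNIV. ?B i) (swap_map A B f)"
  proof (rule clopen_iso_UN)
    fix i :: bool
    have "clopen_iso A B (swap_map A B f)"
      using f by (subst clopen_iso_cong[where g = f]) (auto simp: swap_map_def)
    moreover have "clopen_iso B A (swap_map A B f)"
      using clopen_iso_inv[OF f] disj
      by (subst clopen_iso_cong[where g = "inv_into A f"]) (auto simp: swap_map_def)
    ultimately show "clopen_iso (?A i) (?B i) (swap_map A B f)" by auto
    show "disjoint_family_on ?B UNIV" using disj by (auto simp: disjoint_family_on_def)
    show "loc_fin UNIV ?A" "loc_fin UNIV ?B" using reg
      by (auto simp: loc_fin_def UNIV_bool Un_commute)
  qed
  then show ?thesis by (simp add: UNIV_bool Un_commute)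
qed

text \<open>Every automorphism of the algebra comes from a bijection of the points: by compactness the images of
the members containing \<open>p\<close> have a common point, by separation only one, and this is the image of \<open>p\<close>.\<close>

lemma Stone_duality:
  assumes sub: "\<And>A. A \<in> C \<Longrightarrow> \<Phi> A \<in> C" and surj: "\<And>B. B \<in> C \<Longrightarrow> \<exists>A\<in>C. \<Phi> A = B"
    and Int: "\<And>A B. A \<in> C \<Longrightarrow> B \<in> C \<Longrightarrow> \<Phi> (A \<inter> B) = \<Phi> A \<inter> \<Phi> B"
    and compl: "\<And>A. A \<in> C \<Longrightarrow> \<Phi> (S - A) = S - \<Phi> A"
    and ne: "\<And>A. A \<in> C \<Longrightarrow> \<Phi> A = {} \<longleftrightarrow> A = {}"
  shows "\<exists>g\<in>Aut. \<forall>A\<in>C. g ` A = \<Phi> A"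
proof -
  have PhiS: "\<Phi> S = S" using compl[OF C_empty] ne[OF C_empty] by simp
  have fin: "\<Phi> (S \<inter> \<Inter>\<V>) = S \<inter> (\<Inter>A\<in>\<V>. \<Phi> A)" if "finite \<V>" "\<V> \<subseteq> C" for \<V>
    using that
  proof (induction \<V> rule: finite_induct)
    case empty then show ?case using PhiS by simp
  next
    case (insert A \<V>)
    have "S \<inter> \<Inter>(insert A \<V>) = A \<inter> (S \<inter> \<Inter>\<V>)" by auto
    moreover have "S \<inter> \<Inter>\<V> \<in> C"
      using C_INT[OF insert.hyps(1) S_in_C, of "\<lambda>A. A"] insert.prems by auto
    ultimately show ?case using insert Int[of A "S \<inter> \<Inter>\<V>"] by auto
  qed
  have ex: "\<exists>q\<in>S. \<forall>A\<in>C. p \<in> A \<longrightarrow> q \<in> \<Phi> A" if p: "p \<in> S" for p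
  proof (rule ccontr)
    assume neg: "\<not> ?thesis"
    let ?\<U> = "{S - \<Phi> A | A. A \<in> C \<and> p \<in> A}"
    have "?\<U> \<subseteq> C" using sub C_Compl by auto
    moreover have "\<Union>?\<U> = S" using neg by blast
    ultimately obtain \<V> where V: "finite \<V>" "\<V> \<subseteq> ?\<U>" "\<Union>\<V> = S" using compactness by meson
    have "\<V> \<subseteq> (\<lambda>A. S - \<Phi> A) ` {A\<in>C. p \<in> A}" using V(2) by blast
    then obtain \<W> where W: "finite \<W>" "\<W> \<subseteq> {A\<in>C. p \<in> A}" "\<V> = (\<lambda>A. S - \<Phi> A) ` \<W>"
      using finite_subset_image[OF V(1)] by meson
    have "S \<inter> (\<Inter>A\<in>\<W>. \<Phi> A) = {}" using V(3) W(3) by auto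
    then have "\<Phi> (S \<inter> \<Inter>\<W>) = {}" using fin[OF W(1)] W(2) by auto
    moreover have "S \<inter> \<Inter>\<W> \<in> C" using C_INT[OF W(1) S_in_C, of "\<lambda>A. A"] W(2) by auto
    ultimately show False using ne p W(2) by blast
  qed
  have ex': "\<exists>q\<in>S. \<forall>A\<in>C. p \<in> A \<longleftrightarrow> q \<in> \<Phi> A" if p: "p \<in> S" for p
    using ex[OF p] p compl C_Compl by (metis DiffD2 DiffI)
  define g where "g p = (if p \<in> S then (SOME q. q \<in> S \<and> (\<forall>A\<in>C. p \<in> A \<longleftrightarrow> q \<in> \<Phi> A)) else p)" for p
  have g: "g p \<in> S \<and> (\<forall>A\<in>C. p \<in> A \<longleftrightarrow> g p \<in> \<Phi> A)" if p: "p \<in> S" for p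
    unfolding g_def if_P[OF p] by (rule someI_ex[OF ex'[OF p, unfolded Bex_def]])
  have inj: "p = q" if "p \<in> S" "q \<in> S" "g p = g q" for p q
    using separation[of p q] g that by metis
  have surj': "\<exists>p\<in>S. g p = q" if q: "q \<in> S" for q
  proof -
    have "\<exists>p\<in>S. \<forall>A\<in>C. q \<in> \<Phi> A \<longrightarrow> p \<in> A"
    proof (rule ccontr)
      assume neg: "\<not> ?thesis"
      let ?\<U> = "{S - A | A. A \<in> C \<and> q \<in> \<Phi> A}"
      have "?\<U> \<subseteq> C" using C_Compl by auto
      moreover have "\<Union>?\<U> = S" using neg by blast
      ultimately obtain \<V> where V: "finite \<V>" "\<V> \<subseteq> ?\<U>" "\<Union>\<V> = S" using compactness by meson
      have "\<V> \<subseteq> (\<lambda>A. S - A) ` {A\<in>C. q \<in> \<Phi> A}" using V(2) by blast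
      then obtain \<W> where W: "finite \<W>" "\<W> \<subseteq> {A\<in>C. q \<in> \<Phi> A}" "\<V> = (\<lambda>A. S - A) ` \<W>"
        using finite_subset_image[OF V(1)] by meson
      have "S \<inter> \<Inter>\<W> = {}" using V(3) W(3) by auto
      then have "\<Phi> (S \<inter> \<Inter>\<W>) = {}" using ne[OF C_empty] by simp
      then have "S \<inter> (\<Inter>A\<in>\<W>. \<Phi> A) = {}" using fin[OF W(1)] W(2) by auto
      then show False using q W(2) by auto
    qed
    then obtain p where p: "p \<in> S" "\<forall>A\<in>C. q \<in> \<Phi> A \<longrightarrow> p \<in> A" by blast
    have "g p = q"
    proof (rule ccontr)
      assume "g p \<noteq> q"
      then obtain B where B: "B \<in> C" "q \<in> B" "g p \<notin> B" using separation[of q "g p"] q g[OF p(1)] by blast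
      then obtain A where "A \<in> C" "\<Phi> A = B" using surj by blast
      then show False using B p g[OF p(1)] by blast
    qed
    then show ?thesis using p by blast
  qed
  have bij: "bij g"
  proof (rule bijI)
    show "inj g" using inj g by (intro injI) (metis g_def)
    show "surj g" using surj' by (metis g_def surjI surj_def)
  qed
  have im: "g ` A = \<Phi> A" if A: "A \<in> C" for A
  proof
    show "g ` A \<subseteq> \<Phi> A" using g C_subset A by blast
    show "\<Phi> A \<subseteq> g ` A" using surj' g C_subset[OF sub[OF A]] A by blast
  qed
  have "g \<in> Aut"
  proof (rule AutI)
    show "g p = p" if "p \<notin> S" for p using that by (simp add: g_def)
    show "g ` T \<in> C" if "T \<in> C" for T using im sub that by simp
    show "invf g ` T \<in> C" if T: "T \<in> C" for T
    proof -
      obtain A where "A \<in> C" "\<Phi> A = T" using surj T by blast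
      then show ?thesis using im bij by (metis bij_is_inj image_inv_f_f)
    qed
  qed (rule bij)
  with im show ?thesis by blast
qed

end

section \<open>A dense product set\<close>

text \<open>The set \<open>W\<close> stands for the preimage of a symmetric neighbourhood of the identity under a homomorphism to
a separable group, and the colouring \<open>c\<close> with countably many colours comes from a countable dense set in
that group.\<close>

locale coloured_group = clopen_algebra +
  fixes W :: "('a \<Rightarrow> 'a) set" and c :: "('a \<Rightarrow> 'a) \<Rightarrow> nat"
  assumes W_Aut: "W \<subseteq> Aut"
    and W_inv: "w \<in> W \<Longrightarrow> invf w \<in> W"
    and same_colour: "g \<in> Aut \<Longrightarrow> h \<in> Aut \<Longrightarrow> c g = c h \<Longrightarrow> invf g \<circ> h \<in> W"
begin

primrec products :: "nat \<Rightarrow> ('a \<Rightarrow> 'a) set" where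
  "products 0 = {id}"
| "products (Suc n) = {w \<circ> v | w v. w \<in> W \<and> v \<in> products n}"

lemma products_comp: "g \<in> products m \<Longrightarrow> h \<in> products n \<Longrightarrow> g \<circ> h \<in> products (m + n)"
proof (induction m arbitrary: g)
  case (Suc m)
  then obtain w v where "g = w \<circ> v" "w \<in> W" "v \<in> products m" by auto
  moreover from this have "v \<circ> h \<in> products (m + n)" using Suc by blast
  moreover have "g \<circ> h = w \<circ> (v \<circ> h)" using calculation by (simp add: comp_assoc)
  ultimately show ?case unfolding add_Suc products.simps by blast
qed simp

lemma products_1: "w \<in> W \<Longrightarrow> w \<in> products 1"
  by (auto intro: exI[of _ w])

lemma products_Aut: "products n \<subseteq> Aut"
  by (induction n) (use W_Aut Aut_comp Aut_id in auto)

text \<open>Baire category by hand. If no colour is somewhere dense, one can choose automorphisms \<open>f n\<close> and finite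
sets \<open>R n\<close> such that \<open>f (Suc n)\<close> agrees with \<open>f n\<close> on \<open>R n\<close> and nothing that agrees with \<open>f (Suc n)\<close>
on \<open>R (Suc n)\<close> has colour \<open>n\<close>. The limit has no colour. It exists by Stone duality, provided that
every clopen set occurs in some \<open>R n\<close> and also as an image of a member of some \<open>R n\<close>.\<close>

lemma somewhere_dense_colour:
  "\<exists>i f R. f \<in> Aut \<and> finite R \<and> R \<subseteq> C \<and>
     (\<forall>h\<in>Aut. (\<forall>r\<in>R. h ` r = f ` r) \<longrightarrow>
        (\<forall>R'. finite R' \<and> R' \<subseteq> C \<longrightarrow> (\<exists>h'\<in>Aut. (\<forall>r\<in>R'. h' ` r = h ` r) \<and> c h' = i)))"
proof (rule ccontr)
  assume neg: "\<not> ?thesis"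
  define agree where "agree R g h \<longleftrightarrow> (\<forall>r\<in>R. g ` r = h ` r)" for R :: "'a set set" and g h :: "'a \<Rightarrow> 'a"
  define avoids where "avoids R g i \<longleftrightarrow> (\<forall>h\<in>Aut. agree R h g \<longrightarrow> c h \<noteq> i)" for R g i
  have step: "\<exists>h R'. h \<in> Aut \<and> agree R h f \<and> finite R' \<and> R' \<subseteq> C \<and> avoids R' h i"
    if "f \<in> Aut" "finite R" "R \<subseteq> C" for f R i
  proof (rule ccontr)
    assume "\<not> ?thesis"
    then have "\<forall>h\<in>Aut. agree R h f \<longrightarrow>
        (\<forall>R'. finite R' \<and> R' \<subseteq> C \<longrightarrow> (\<exists>h'\<in>Aut. agree R' h' h \<and> c h' = i))"
      unfolding avoids_def by blast
    with that neg show False unfolding agree_def by blast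
  qed
  define e where "e = from_nat_into C"
  have e: "e n \<in> C" for n unfolding e_def by (rule from_nat_into) (use S_in_C in auto)
  have e_surj: "\<exists>n. e n = A" if "A \<in> C" for A
    unfolding e_def using from_nat_into_surj[OF countable_C that] .
  define P where "P fR \<longleftrightarrow> fst fR \<in> Aut \<and> finite (snd fR) \<and> snd fR \<subseteq> C" for fR :: "('a \<Rightarrow> 'a) \<times> 'a set set"
  define Q where "Q n fR fR' \<longleftrightarrow> snd fR \<subseteq> snd fR' \<and> agree (snd fR) (fst fR') (fst fR) \<and>
      e n \<in> snd fR' \<and> (\<exists>r\<in>snd fR'. fst fR' ` r = e n) \<and>
      avoids (snd fR') (fst fR') n"
    for n :: nat and fR fR' :: "('a \<Rightarrow> 'a) \<times> 'a set set"
  have "\<exists>F. \<forall>n. P (F n) \<and> Q n (F n) (F (Suc n))"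
  proof (rule dependent_nat_choice)
    show "\<exists>x. P x" using Aut_id by (intro exI[of _ "(id, {})"]) (auto simp: P_def)
  next
    fix fR n assume "P fR"
    then have "fst fR \<in> Aut" "finite (snd fR)" "snd fR \<subseteq> C" by (auto simp: P_def)
    from step[OF this, of n] obtain h R' where h: "h \<in> Aut" "agree (snd fR) h (fst fR)"
      "finite R'" "R' \<subseteq> C" "avoids R' h n" by (elim exE conjE)
    have inv_e: "invf h ` e n \<in> C" "h ` invf h ` e n = e n"
      using AutD(3)[OF Aut_inv[OF h(1)]] e AutD(1)[OF h(1)] by (auto simp: image_f_inv_f bij_is_surj)
    \<comment> \<open>The last two sets make the limit defined at, and onto, the clopen set \<open>e n\<close>.\<close>
    define R'' where "R'' = snd fR \<union> R' \<union> {e n, invf h ` e n}"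
    have "P (h, R'')" using h \<open>P fR\<close> inv_e e by (auto simp: P_def R''_def)
    moreover have "Q n fR (h, R'')"
      unfolding Q_def fst_conv snd_conv
    proof (intro conjI)
      show "\<exists>r\<in>R''. h ` r = e n" using inv_e(2) by (intro bexI[of _ "invf h ` e n"]) (auto simp: R''_def)
      have "agree R'' h' h \<Longrightarrow> agree R' h' h" for h' by (simp add: agree_def R''_def)
      then show "avoids R'' h n" using h(5) by (simp add: avoids_def)
    qed (use h in \<open>auto simp: R''_def\<close>)
    ultimately show "\<exists>y. P y \<and> Q n fR y" by blast
  qed
  then obtain F where F': "\<forall>n. P (F n) \<and> Q n (F n) (F (Suc n))" by (elim exE)
  then have F: "P (F n)" "Q n (F n) (F (Suc n))" for n by auto
  define f R where "f n = fst (F n)" and "R n = snd (F n)" for n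
  have fAut: "f n \<in> Aut" and RC: "R n \<subseteq> C" for n using F(1) by (auto simp: P_def f_def R_def)
  have R_mono: "m \<le> n \<Longrightarrow> R m \<subseteq> R n" for m n
  proof (rule lift_Suc_mono_le[of R])
    show "R n \<subseteq> R (Suc n)" for n using F(2)[of n] by (simp add: Q_def R_def)
  qed
  have f_stable: "m \<le> n \<Longrightarrow> r \<in> R m \<Longrightarrow> f n ` r = f m ` r" for m n r
  proof (induction n rule: dec_induct)
    case (step n)
    then have "r \<in> R n" using R_mono by blast
    then show ?case using step F(2)[of n] by (auto simp: Q_def R_def f_def agree_def)
  qed simp
  have in_R: "\<exists>n. A \<in> R n" if "A \<in> C" for A
    using e_surj[OF that] F(2) unfolding Q_def R_def by metis
  define \<Phi> where "\<Phi> A = f (LEAST n. A \<in> R n) ` A" for A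
  have Phi: "\<Phi> A = f n ` A" if "A \<in> R n" for A n
    unfolding \<Phi>_def using f_stable[of "LEAST n. A \<in> R n" n A] that
    by (metis (mono_tags, lifting) LeastI Least_le)
  have common: "\<exists>n. \<A> \<subseteq> R n" if "finite \<A>" "\<A> \<subseteq> C" for \<A>
    using that
  proof (induction rule: finite_induct)
    case (insert A \<A>)
    then obtain m n where "\<A> \<subseteq> R m" "A \<in> R n" using in_R by (metis insert_subset)
    then show ?case using R_mono[of m "max m n"] R_mono[of n "max m n"] by (intro exI[of _ "max m n"]) auto
  qed auto
  have "\<exists>g\<in>Aut. \<forall>A\<in>C. g ` A = \<Phi> A"
  proof (rule Stone_duality)
    fix A assume A: "A \<in> C"
    obtain n where n: "{A, S - A} \<subseteq> R n" using common[of "{A, S - A}"] A C_Compl by auto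
    show "\<Phi> A \<in> C" using Phi[of A n] n A AutD(3)[OF fAut] by auto
    show "\<Phi> A = {} \<longleftrightarrow> A = {}" using Phi[of A n] n by auto
    have "f n ` (S - A) = f n ` S - f n ` A"
      using AutD(1)[OF fAut] by (simp add: image_set_diff bij_is_inj)
    then show "\<Phi> (S - A) = S - \<Phi> A" using Phi[of A n] Phi[of "S - A" n] n Aut_image_S[OF fAut] by auto
  next
    fix B assume "B \<in> C"
    then obtain n where n: "e n = B" using e_surj by blast
    then obtain r where "r \<in> R (Suc n)" "f (Suc n) ` r = B" using F(2)[of n] unfolding Q_def R_def f_def by blast
    then show "\<exists>A\<in>C. \<Phi> A = B" using Phi RC by blast
  next
    fix A B assume AB: "A \<in> C" "B \<in> C"
    obtain n where n: "{A, B, A \<inter> B} \<subseteq> R n" using common[of "{A, B, A \<inter> B}"] AB C_Int by auto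
    have "f n ` (A \<inter> B) = f n ` A \<inter> f n ` B" using AutD(1)[OF fAut] by (simp add: image_Int bij_is_inj)
    then show "\<Phi> (A \<inter> B) = \<Phi> A \<inter> \<Phi> B" using Phi n by auto
  qed
  then obtain g where g: "g \<in> Aut" "\<forall>A\<in>C. g ` A = \<Phi> A" by blast
  have "agree (R (Suc n)) g (f (Suc n))" for n
    unfolding agree_def using g(2) Phi RC by (metis subsetD)
  then have "c g \<noteq> n" for n
    using F(2)[of n] g(1) unfolding Q_def f_def R_def avoids_def by blast
  then show False by blast
qed

text \<open>Dividing by one element of the dense colour moves the density to the identity.\<close>

lemma somewhere_dense:
  "\<exists>R. finite R \<and> R \<subseteq> C \<and>
     (\<forall>h\<in>Aut. (\<forall>r\<in>R. h ` r = r) \<longrightarrow>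
        (\<forall>R'. finite R' \<and> R' \<subseteq> C \<longrightarrow> (\<exists>w\<in>W. \<forall>r\<in>R'. w ` r = h ` r)))"
proof -
  obtain i f R where f: "f \<in> Aut" "finite R" "R \<subseteq> C" and
    dense': "\<forall>h\<in>Aut. (\<forall>r\<in>R. h ` r = f ` r) \<longrightarrow>
        (\<forall>R'. finite R' \<and> R' \<subseteq> C \<longrightarrow> (\<exists>h'\<in>Aut. (\<forall>r\<in>R'. h' ` r = h ` r) \<and> c h' = i))"
    using somewhere_dense_colour by (elim exE conjE)
  have dense: "\<exists>h'\<in>Aut. (\<forall>r\<in>R'. h' ` r = h ` r) \<and> c h' = i"
    if "h \<in> Aut" "\<forall>r\<in>R. h ` r = f ` r" "finite R'" "R' \<subseteq> C" for h R'
    using dense' that by simp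
  obtain f' where f': "f' \<in> Aut" "\<forall>r\<in>R. f' ` r = f ` r" "c f' = i"
    using dense[OF f(1) _ f(2,3)] by auto
  have "\<exists>w\<in>W. \<forall>r\<in>R'. w ` r = h ` r" if h: "h \<in> Aut" "\<forall>r\<in>R. h ` r = r" and R': "finite R'" "R' \<subseteq> C" for h R'
  proof -
    have "\<forall>r\<in>R. (f' \<circ> h) ` r = f ` r"
    proof
      fix r assume "r \<in> R"
      then show "(f' \<circ> h) ` r = f ` r" using h(2) f'(2) by (metis image_comp)
    qed
    then obtain h' where h': "h' \<in> Aut" "\<forall>r\<in>R'. h' ` r = (f' \<circ> h) ` r" "c h' = i"
      using dense[OF Aut_comp[OF f'(1) h(1)] _ R'] by blast
    have "invf f' \<circ> h' \<in> W" using same_colour f' h' by simp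
    moreover have "(invf f' \<circ> h') ` r = h ` r" if "r \<in> R'" for r
    proof -
      have "(invf f' \<circ> h') ` r = invf f' ` h' ` r" by (simp only: image_comp)
      also have "\<dots> = invf f' ` f' ` h ` r" using h'(2) that by (simp only: image_comp)
      also have "\<dots> = h ` r" using AutD(1)[OF f'(1)] by (simp add: bij_is_inj image_inv_f_f)
      finally show ?thesis .
    qed
    ultimately show ?thesis by blast
  qed
  then show ?thesis using f(2,3) by (intro exI[of _ R] conjI ballI impI allI) simp_all
qed

end

section \<open>Stable points as ends of a locally compact space\<close>

context clopen_algebra begin

definition stable :: "'a \<Rightarrow> 'a set \<Rightarrow> bool" where
  "stable x U \<longleftrightarrow> U \<in> C \<and> x \<in> U \<and>
     (\<forall>U'\<in>C. x \<in> U' \<and> U' \<subseteq> U \<longrightarrow> (\<exists>f. clopen_iso U U' f \<and> f x = x))"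

lemma stable_subset:
  assumes U: "stable x U" and U': "U' \<in> C" "x \<in> U'" "U' \<subseteq> U"
  shows "stable x U'"
  unfolding stable_def
proof (intro conjI ballI impI)
  obtain f where f: "clopen_iso U U' f" "f x = x" using assms by (auto simp: stable_def)
  fix U'' assume "U'' \<in> C" "x \<in> U'' \<and> U'' \<subseteq> U'"
  then obtain g where g: "clopen_iso U U'' g" "g x = x" using U U'(3) unfolding stable_def by blast
  have "inv_into U f x = x" using f U by (metis clopen_isoD(3) inv_into_f_f stable_def)
  then show "\<exists>h. clopen_iso U' U'' h \<and> h x = x"
    using clopen_iso_comp[OF clopen_iso_inv[OF f(1)] g(1)] g(2) by (intro exI[of _ "g \<circ> inv_into U f"]) simp
qed (use U' in auto)

end

text \<open>Finitely many points with disjoint stable neighbourhoods. Several points have to be treated at once,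
because the number of factors used in the end must not depend on how many there are.\<close>

locale ends = clopen_algebra +
  fixes F :: "'a set" and V :: "'a \<Rightarrow> 'a set"
  assumes finite_F: "finite F"
    and V_disjoint: "x \<in> F \<Longrightarrow> y \<in> F \<Longrightarrow> x \<noteq> y \<Longrightarrow> V x \<inter> V y = {}"
    and V_stable: "x \<in> F \<Longrightarrow> stable x (V x)"
begin

text \<open>A locally compact space; the points of \<open>F\<close> are its ends. For an isolated point \<open>x\<close> of \<open>F\<close> stability
forces \<open>V x = {x}\<close>, so such a point contributes nothing.\<close>

definition Y :: "'a set" where "Y = (\<Union>x\<in>F. V x) - F"

definition compact_open :: "'a set \<Rightarrow> bool" where "compact_open B \<longleftrightarrow> B \<in> C \<and> B \<subseteq> Y"

definition clopen_Y :: "'a set \<Rightarrow> bool" where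
  "clopen_Y A \<longleftrightarrow> A \<subseteq> Y \<and> (\<forall>B. compact_open B \<longrightarrow> A \<inter> B \<in> C)"

text \<open>Homeomorphisms that keep every \<open>V x\<close>. Because of this restriction those between suitable subsets of \<open>Y\<close>
extend continuously to the ends.\<close>

definition end_iso :: "'a set \<Rightarrow> 'a set \<Rightarrow> ('a \<Rightarrow> 'a) \<Rightarrow> bool" where
  "end_iso A B f \<longleftrightarrow> clopen_iso A B f \<and> (\<forall>p\<in>A. \<forall>x\<in>F. p \<in> V x \<longleftrightarrow> f p \<in> V x)"

text \<open>The set \<open>D\<close> is an obstacle to be avoided. Since \<open>D\<close> may be any compact open set, \<open>B\<close> has copies in
\<open>A\<close> that are arbitrarily close to the ends.\<close>

definition full :: "'a set \<Rightarrow> bool" where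
  "full A \<longleftrightarrow> clopen_Y A \<and> (\<forall>B D. compact_open B \<longrightarrow> compact_open D \<longrightarrow> (\<exists>e. end_iso B (e ` B) e \<and> e ` B \<subseteq> A - D))"

lemma V_C: "x \<in> F \<Longrightarrow> V x \<in> C" and x_in_V: "x \<in> F \<Longrightarrow> x \<in> V x"
  using V_stable by (auto simp: stable_def)

lemma V_F: "x \<in> F \<Longrightarrow> y \<in> F \<Longrightarrow> y \<in> V x \<longleftrightarrow> y = x"
  using V_disjoint x_in_V by blast

lemma YD: "p \<in> Y \<Longrightarrow> p \<notin> F" "p \<in> Y \<Longrightarrow> \<exists>x\<in>F. p \<in> V x"
  by (auto simp: Y_def)

lemma compact_open_empty: "compact_open {}" by (simp add: compact_open_def C_empty)
lemma compact_open_Un: "compact_open A \<Longrightarrow> compact_open B \<Longrightarrow> compact_open (A \<union> B)" by (simp add: compact_open_def C_Un)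
lemma compact_open_UN: "finite I \<Longrightarrow> (\<And>i. i \<in> I \<Longrightarrow> compact_open (A i)) \<Longrightarrow> compact_open (\<Union>i\<in>I. A i)"
  by (auto simp: compact_open_def intro!: C_UN)
lemma compact_open_Diff: "compact_open A \<Longrightarrow> compact_open B \<Longrightarrow> compact_open (A - B)" by (auto simp: compact_open_def C_Diff)
lemma Y_point_compact_open:
  assumes "p \<in> Y" shows "\<exists>B. compact_open B \<and> p \<in> B"
proof -
  obtain x where x: "x \<in> F" "p \<in> V x" "p \<noteq> x" using YD assms by metis
  have "x \<in> S" "p \<in> S" using x x_in_V V_C C_subset by blast+
  then obtain D where D: "D \<in> C" "p \<in> D" "x \<notin> D" using separation[of p x] x by blast
  have "V x \<inter> D \<subseteq> Y" using x D V_F by (auto simp: Y_def)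
  then have "compact_open (V x \<inter> D)" using D V_C x by (auto simp: compact_open_def C_Int)
  then show ?thesis using x D by blast
qed

lemma clopen_Y_Y: "clopen_Y Y"
  by (auto simp: clopen_Y_def compact_open_def Int_absorb1)
lemma clopen_Y_compact_open: "compact_open A \<Longrightarrow> clopen_Y A" by (auto simp: clopen_Y_def compact_open_def C_Int)
lemma clopen_Y_Un: "clopen_Y A \<Longrightarrow> clopen_Y B \<Longrightarrow> clopen_Y (A \<union> B)"
  by (auto simp: clopen_Y_def Int_Un_distrib2 C_Un)
lemma clopen_Y_Int: assumes "clopen_Y A" "clopen_Y B" shows "clopen_Y (A \<inter> B)"
  unfolding clopen_Y_def
proof (intro conjI allI impI)
  show "A \<inter> B \<subseteq> Y" using assms by (auto simp: clopen_Y_def)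
  fix T assume T: "compact_open T"
  have "A \<inter> B \<inter> T = (A \<inter> T) \<inter> (B \<inter> T)" by auto
  then show "A \<inter> B \<inter> T \<in> C" using assms T by (auto simp: clopen_Y_def C_Int)
qed
lemma clopen_Y_Diff: assumes "clopen_Y A" "clopen_Y B" shows "clopen_Y (A - B)"
  unfolding clopen_Y_def
proof (intro conjI allI impI)
  show "A - B \<subseteq> Y" using assms by (auto simp: clopen_Y_def)
  fix T assume T: "compact_open T"
  have "(A - B) \<inter> T = A \<inter> T - B \<inter> T" by auto
  then show "(A - B) \<inter> T \<in> C" using assms T by (auto simp: clopen_Y_def C_Diff)
qed
lemma clopen_Y_sub: "clopen_Y A \<Longrightarrow> A \<subseteq> Y" by (simp add: clopen_Y_def)
lemma clopen_Y_Int_compact_open: assumes "clopen_Y A" "compact_open T" shows "compact_open (A \<inter> T)"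
  using assms by (auto simp: clopen_Y_def compact_open_def)
lemma clopen_Y_Int_C: "clopen_Y A \<Longrightarrow> T \<in> C \<Longrightarrow> T \<subseteq> Y \<Longrightarrow> T \<inter> A \<in> C"
  by (metis Int_commute compact_open_def clopen_Y_def)

lemma end_isoD:
  assumes "end_iso A B f"
  shows "clopen_iso A B f" "f ` A = B" "inj_on f A" "bij_betw f A B"
    "p \<in> A \<Longrightarrow> x \<in> F \<Longrightarrow> f p \<in> V x \<longleftrightarrow> p \<in> V x"
  using assms clopen_isoD[of A B f] by (auto simp: end_iso_def)

lemma end_iso_inv: assumes "end_iso A B f" shows "end_iso B A (inv_into A f)"
proof -
  have "inv_into A f p \<in> A" "f (inv_into A f p) = p" if "p \<in> B" for p
    using end_isoD(2)[OF assms] that by (auto intro: inv_into_into f_inv_into_f)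
  then show ?thesis using clopen_iso_inv[OF end_isoD(1)[OF assms]] end_isoD(5)[OF assms]
    unfolding end_iso_def by metis
qed

lemma end_iso_restrict: assumes "end_iso A B f" "T \<subseteq> A" shows "end_iso T (f ` T) f"
  using assms clopen_iso_restrict[of A B f T] by (auto simp: end_iso_def)

lemma end_iso_compact_open: assumes "end_iso A B f" "B \<subseteq> Y" "T \<subseteq> A" "compact_open T" shows "compact_open (f ` T)"
  using clopen_isoD(4)[OF end_isoD(1)[OF assms(1)] assms(3)] end_isoD(2)[OF assms(1)] assms
  by (auto simp: compact_open_def)

lemma end_iso_glue:
  assumes iso: "\<And>i. i \<in> I \<Longrightarrow> end_iso (A i) (B i) (f i)"
    and disj: "disjoint_family_on A I" "disjoint_family_on B I"
    and lf: "loc_fin I A" "loc_fin I B"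
  shows "\<exists>h. end_iso (\<Union>i\<in>I. A i) (\<Union>i\<in>I. B i) h \<and> (\<forall>i\<in>I. \<forall>p\<in>A i. h p = f i p)"
proof -
  obtain h where h: "clopen_iso (\<Union>i\<in>I. A i) (\<Union>i\<in>I. B i) h" "\<forall>i\<in>I. \<forall>p\<in>A i. h p = f i p"
    using clopen_iso_glue[OF end_isoD(1)[OF iso] disj lf] by blast
  have "p \<in> V x \<longleftrightarrow> h p \<in> V x" if "i \<in> I" "p \<in> A i" "x \<in> F" for p i x
    using h(2) end_isoD(5)[OF iso[OF that(1)] that(2,3)] that by simp
  then show ?thesis using h unfolding end_iso_def by blast
qed

lemma end_iso_Un:
  assumes "end_iso A B f" "end_iso A' B' g" "A \<inter> A' = {}" "B \<inter> B' = {}"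
    and clopen_Y: "clopen_Y A" "clopen_Y A'" "clopen_Y B" "clopen_Y B'"
  shows "\<exists>h. end_iso (A \<union> A') (B \<union> B') h \<and> (\<forall>p\<in>A. h p = f p) \<and> (\<forall>p\<in>A'. h p = g p)"
proof -
  let ?A = "\<lambda>i. if i then A else A'" and ?B = "\<lambda>i. if i then B else B'"
  have lf: "loc_fin UNIV (\<lambda>i. if i then P else Q)" if "clopen_Y P" "clopen_Y Q" for P Q
    unfolding loc_fin_def
  proof (intro ballI impI conjI)
    fix T and i :: bool assume T: "T \<in> C" "T \<subseteq> (\<Union>i\<in>UNIV. if i then P else Q)"
    have "T \<subseteq> P \<union> Q" using T(2) by (auto split: if_splits)
    then have "T \<subseteq> Y" using that clopen_Y_sub by blast
    then show "T \<inter> (if i then P else Q) \<in> C" using that T(1) clopen_Y_Int_C by simp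
  qed simp
  have "\<exists>h. end_iso (\<Union>i\<in>UNIV. ?A i) (\<Union>i\<in>UNIV. ?B i) h \<and> (\<forall>i\<in>UNIV. \<forall>p\<in>?A i. h p = (if i then f else g) p)"
    by (rule end_iso_glue) (use assms lf in \<open>auto simp: disjoint_family_on_def\<close>)
  then show ?thesis by (simp add: UNIV_bool Un_commute) blast
qed

lemma full_clopen_Y: "full A \<Longrightarrow> clopen_Y A" by (simp add: full_def)

lemma full_embed:
  assumes "full A" "compact_open B" "compact_open D"
  obtains e where "end_iso B (e ` B) e" "e ` B \<subseteq> A - D"
  using assms unfolding full_def by blast

lemma full_mono: "full A \<Longrightarrow> A \<subseteq> A' \<Longrightarrow> clopen_Y A' \<Longrightarrow> full A'"
  unfolding full_def by (meson Diff_mono order_refl order_trans)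

text \<open>A homeomorphism from \<open>V x\<close> onto \<open>V x - D\<close> that fixes \<open>x\<close>, given by stability, moves every compact
subset of \<open>V x\<close> that misses \<open>x\<close> off the obstacle \<open>D\<close>.\<close>

lemma full_Y: "full Y"
  unfolding full_def
proof (intro conjI allI impI clopen_Y_Y)
  fix B D assume B: "compact_open B" and D: "compact_open D"
  have "\<exists>f. clopen_iso (V x) (V x - D) f \<and> f x = x" if "x \<in> F" for x
  proof -
    have "x \<in> V x - D" "V x - D \<in> C" using that x_in_V D YD V_C by (auto simp: compact_open_def C_Diff)
    then show ?thesis using V_stable[OF that] unfolding stable_def by blast
  qed
  then obtain f where f: "\<And>x. x \<in> F \<Longrightarrow> clopen_iso (V x) (V x - D) (f x)" "\<And>x. x \<in> F \<Longrightarrow> f x x = x"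
    by metis
  have "\<exists>h. clopen_iso (\<Union>x\<in>F. V x) (\<Union>x\<in>F. V x - D) h \<and> (\<forall>x\<in>F. \<forall>p\<in>V x. h p = f x p)"
  proof (rule clopen_iso_glue[OF f(1)])
    show "disjoint_family_on V F" "disjoint_family_on (\<lambda>x. V x - D) F"
      using V_disjoint by (auto simp: disjoint_family_on_def)
    show "loc_fin F V" "loc_fin F (\<lambda>x. V x - D)"
      using D by (auto intro!: loc_fin_finite finite_F V_C C_Diff simp: compact_open_def)
  qed
  then obtain h where h: "clopen_iso (\<Union>x\<in>F. V x) (\<Union>x\<in>F. V x - D) h" "\<And>x p. x \<in> F \<Longrightarrow> p \<in> V x \<Longrightarrow> h p = f x p"
    by blast
  have hV: "h p \<in> V x - D" if "x \<in> F" "p \<in> V x" for x p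
    using h(2)[OF that] clopen_isoD(2)[OF f(1)[OF that(1)]] that by auto
  have hY: "h p \<in> Y - D" if p: "p \<in> B" for p
  proof -
    obtain x where x: "x \<in> F" "p \<in> V x" "p \<notin> F" using p B YD by (meson compact_open_def subsetD)
    have "h p \<notin> F"
    proof
      assume "h p \<in> F"
      then have "h p = x" using hV[OF x(1,2)] V_F x(1) by blast
      moreover have "h x = x" using h(2)[OF x(1) x_in_V] f(2) x by simp
      ultimately have "p = x"
        using clopen_isoD(3)[OF h(1)] x x_in_V by (metis UN_I inj_onD)
      then show False using x by simp
    qed
    then show ?thesis using hV[OF x(1,2)] x by (auto simp: Y_def)
  qed
  have BV: "B \<subseteq> (\<Union>x\<in>F. V x)" using B by (auto simp: compact_open_def Y_def)
  have "p \<in> V x \<longleftrightarrow> h p \<in> V x" if "p \<in> B" "x \<in> F" for p x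
  proof -
    obtain y where y: "y \<in> F" "p \<in> V y" using BV \<open>p \<in> B\<close> by blast
    then show ?thesis using hV[OF y] V_disjoint[OF \<open>x \<in> F\<close> y(1)] by blast
  qed
  then have "end_iso B (h ` B) h"
    using clopen_iso_restrict[OF h(1) BV] by (auto simp: end_iso_def)
  then show "\<exists>e. end_iso B (e ` B) e \<and> e ` B \<subseteq> Y - D" using hY by blast
qed

lemma exhaustion:
  obtains Q :: "nat \<Rightarrow> 'a set" where "\<And>n. compact_open (Q n)" "\<And>m n. m \<le> n \<Longrightarrow> Q m \<subseteq> Q n"
    "\<And>B. compact_open B \<Longrightarrow> \<exists>n. B \<subseteq> Q n"
proof
  have cnt: "countable {B. compact_open B}" by (rule countable_subset[OF _ countable_C]) (auto simp: compact_open_def)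
  have ne: "{B. compact_open B} \<noteq> {}" using compact_open_empty by blast
  define e where "e = from_nat_into {B. compact_open B}"
  define Q where "Q n = (\<Union>i\<le>n. e i)" for n
  have e: "compact_open (e n)" for n using from_nat_into[OF ne] by (auto simp: e_def)
  show "compact_open (Q n)" for n unfolding Q_def using e by (intro compact_open_UN) auto
  show "m \<le> n \<Longrightarrow> Q m \<subseteq> Q n" for m n unfolding Q_def by (intro UN_mono) auto
  show "\<exists>n. B \<subseteq> Q n" if "compact_open B" for B
  proof -
    have "\<exists>n. e n = B" using from_nat_into_surj[OF cnt, of B] that by (simp add: e_def)
    then obtain n where "e n = B" by blast
    then show ?thesis by (auto simp: Q_def)
  qed
qed

section \<open>Back and forth between full sets\<close>

text \<open>The forth step. The new part of the domain is embedded in \<open>A'\<close> off the current image, which is possible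
since \<open>A'\<close> is full.\<close>

lemma full_step:
  assumes iso: "end_iso B (f ` B) f" and B: "compact_open B" "B \<subseteq> A" "f ` B \<subseteq> A'"
    and A: "clopen_Y A" "full A'" and Q: "compact_open Q"
  shows "\<exists>B1 f1. end_iso B1 (f1 ` B1) f1 \<and> compact_open B1 \<and> B \<subseteq> B1 \<and> B1 \<subseteq> A \<and> f1 ` B1 \<subseteq> A' \<and> A \<inter> Q \<subseteq> B1 \<and>
    (\<forall>p\<in>B. f1 p = f p)"
proof -
  have A': "A' \<subseteq> Y" using full_clopen_Y clopen_Y_sub A(2) by blast
  have fB: "compact_open (f ` B)" by (rule end_iso_compact_open[OF iso]) (use B A' in auto)
  define R where "R = A \<inter> Q - B"
  have R: "compact_open R" unfolding R_def by (intro compact_open_Diff clopen_Y_Int_compact_open A Q B)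
  obtain e where e: "end_iso R (e ` R) e" "e ` R \<subseteq> A' - f ` B" using full_embed[OF A(2) R fB] .
  have eR: "compact_open (e ` R)" by (rule end_iso_compact_open[OF e(1)]) (use e A' R in auto)
  have "\<exists>h. end_iso (B \<union> R) (f ` B \<union> e ` R) h \<and> (\<forall>p\<in>B. h p = f p) \<and> (\<forall>p\<in>R. h p = e p)"
  proof (rule end_iso_Un[OF iso e(1)])
    show "B \<inter> R = {}" "f ` B \<inter> e ` R = {}" using e(2) by (auto simp: R_def)
  qed (intro clopen_Y_compact_open B fB eR R)+
  then obtain h where h: "end_iso (B \<union> R) (f ` B \<union> e ` R) h" "\<forall>p\<in>B. h p = f p" by blast
  have "h ` (B \<union> R) = f ` B \<union> e ` R" using end_isoD(2)[OF h(1)] .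
  then show ?thesis using h e B compact_open_Un[OF B(1) R]
    by (intro exI[of _ "B \<union> R"] exI[of _ h]) (auto simp: R_def)
qed

text \<open>The back step is the forth step for the inverse map.\<close>

lemma full_step_back:
  assumes iso: "end_iso B (f ` B) f" and B: "compact_open B" "B \<subseteq> A" "f ` B \<subseteq> A'"
    and A: "full A" "clopen_Y A'" and Q: "compact_open Q"
  shows "\<exists>B1 f1. end_iso B1 (f1 ` B1) f1 \<and> compact_open B1 \<and> B \<subseteq> B1 \<and> B1 \<subseteq> A \<and> f1 ` B1 \<subseteq> A' \<and> A' \<inter> Q \<subseteq> f1 ` B1 \<and>
    (\<forall>p\<in>B. f1 p = f p)"
proof -
  let ?g = "inv_into B f"
  have A': "A' \<subseteq> Y" and AY: "A \<subseteq> Y" using full_clopen_Y clopen_Y_sub A by blast+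
  have fB: "compact_open (f ` B)" by (rule end_iso_compact_open[OF iso]) (use B A' in auto)
  have gB: "?g ` f ` B = B" using end_isoD(2)[OF end_iso_inv[OF iso]] .
  obtain D g where g: "end_iso D (g ` D) g" "compact_open D" "f ` B \<subseteq> D" "D \<subseteq> A'" "g ` D \<subseteq> A" "A' \<inter> Q \<subseteq> D"
    "\<forall>p\<in>f ` B. g p = ?g p"
    using full_step[of "f ` B" ?g A' A Q] end_iso_inv[OF iso] fB gB B A Q by auto
  let ?h = "inv_into D g"
  have h: "end_iso (g ` D) D ?h" using end_iso_inv[OF g(1)] .
  have "B \<subseteq> g ` D" using gB g(3,7) by (metis image_cong image_mono)
  moreover have "?h p = f p" if p: "p \<in> B" for p
  proof -
    have "g (f p) = p" using g(7) p end_isoD(3)[OF iso] by simp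
    then show ?thesis using g(3) p end_isoD(3)[OF g(1)] by (metis imageI inv_into_f_f subsetD)
  qed
  moreover have "?h ` (g ` D) = D" using end_isoD(2)[OF h] .
  moreover have "compact_open (g ` D)" by (rule end_iso_compact_open[OF g(1)]) (use g AY in auto)
  ultimately show ?thesis using h g by (intro exI[of _ "g ` D"] exI[of _ ?h]) simp
qed

text \<open>Alternate the two steps along an exhaustion of \<open>Y\<close> by compact open sets. Every compact open subset of
\<open>A\<close> or \<open>A'\<close> is dealt with at a finite stage, so the union of the partial maps is a homeomorphism.\<close>

theorem full_end_iso:
  assumes A: "full A" and A': "full A'"
  shows "\<exists>f. end_iso A A' f"
proof -
  obtain Q :: "nat \<Rightarrow> 'a set" where Q: "\<And>n. compact_open (Q n)" "\<And>m n. m \<le> n \<Longrightarrow> Q m \<subseteq> Q n"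
    "\<And>B. compact_open B \<Longrightarrow> \<exists>n. B \<subseteq> Q n" using exhaustion by blast
  have AY: "A \<subseteq> Y" "A' \<subseteq> Y" using full_clopen_Y clopen_Y_sub A A' by blast+
  define P where "P Bf \<longleftrightarrow> end_iso (fst Bf) (snd Bf ` fst Bf) (snd Bf) \<and> compact_open (fst Bf) \<and> fst Bf \<subseteq> A \<and>
    snd Bf ` fst Bf \<subseteq> A'" for Bf :: "'a set \<times> ('a \<Rightarrow> 'a)"
  define N where "N n Bf Bf' \<longleftrightarrow> fst Bf \<subseteq> fst Bf' \<and> A \<inter> Q n \<subseteq> fst Bf' \<and> A' \<inter> Q n \<subseteq> snd Bf' ` fst Bf' \<and>
    (\<forall>p\<in>fst Bf. snd Bf' p = snd Bf p)" for n and Bf Bf' :: "'a set \<times> ('a \<Rightarrow> 'a)"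
  have "\<exists>G. \<forall>n. P (G n) \<and> N n (G n) (G (Suc n))"
  proof (rule dependent_nat_choice)
    show "\<exists>x. P x"
      by (intro exI[of _ "({}, \<lambda>p. p)"]) (auto simp: P_def compact_open_empty end_iso_def clopen_iso_def bij_betw_def)
  next
    fix Bf n assume "P Bf"
    then have P: "end_iso (fst Bf) (snd Bf ` fst Bf) (snd Bf)" "compact_open (fst Bf)" "fst Bf \<subseteq> A" "snd Bf ` fst Bf \<subseteq> A'"
      by (auto simp: P_def)
    obtain B1 f1 where 1: "end_iso B1 (f1 ` B1) f1" "compact_open B1" "fst Bf \<subseteq> B1" "B1 \<subseteq> A" "f1 ` B1 \<subseteq> A'"
      "A \<inter> Q n \<subseteq> B1" "\<forall>p\<in>fst Bf. f1 p = snd Bf p"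
      using full_step[OF P full_clopen_Y[OF A] A' Q(1)[of n]] by blast
    obtain B2 f2 where 2: "end_iso B2 (f2 ` B2) f2" "compact_open B2" "B1 \<subseteq> B2" "B2 \<subseteq> A" "f2 ` B2 \<subseteq> A'"
      "A' \<inter> Q n \<subseteq> f2 ` B2" "\<forall>p\<in>B1. f2 p = f1 p"
      using full_step_back[OF 1(1,2,4,5) A full_clopen_Y[OF A'] Q(1)[of n]] by blast
    have "P (B2, f2)" using 2 by (simp add: P_def)
    moreover have "N n Bf (B2, f2)" unfolding N_def using 1 2 by auto
    ultimately show "\<exists>y. P y \<and> N n Bf y" by blast
  qed
  then obtain G where G: "\<forall>n. P (G n) \<and> N n (G n) (G (Suc n))" by (elim exE)
  define B f where "B n = fst (G n)" and "f n = snd (G n)" for n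
  have f: "end_iso (B n) (f n ` B n) (f n)" "compact_open (B n)" "B n \<subseteq> A" "f n ` B n \<subseteq> A'"
    and st: "B n \<subseteq> B (Suc n)" "A \<inter> Q n \<subseteq> B (Suc n)" "A' \<inter> Q n \<subseteq> f (Suc n) ` B (Suc n)"
      "p \<in> B n \<Longrightarrow> f (Suc n) p = f n p" for n p
    using G by (auto simp: P_def N_def B_def f_def)
  have B_mono: "m \<le> n \<Longrightarrow> B m \<subseteq> B n" for m n by (rule lift_Suc_mono_le[of B]) (rule st)
  have f_st: "m \<le> n \<Longrightarrow> p \<in> B m \<Longrightarrow> f n p = f m p" for m n p
  proof (induction n rule: dec_induct)
    case (step n)
    then show ?case using st(4)[of p n] B_mono[of m n] by auto
  qed simp
  define h where "h p = f (LEAST n. p \<in> B n) p" for p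
  have h: "h p = f n p" if "p \<in> B n" for n p
    unfolding h_def using f_st[of "LEAST n. p \<in> B n" n p] that
    by (metis (mono_tags, lifting) LeastI Least_le)
  have hB: "h ` T = f n ` T" if "T \<subseteq> B n" for T n using h that by (intro image_cong) auto
  have covA: "\<exists>n. T \<subseteq> B n" if "compact_open T" "T \<subseteq> A" for T
  proof -
    obtain n where "T \<subseteq> Q n" using Q(3) \<open>compact_open T\<close> by blast
    then show ?thesis using st(2)[of n] that by blast
  qed
  have covA': "\<exists>n. T \<subseteq> h ` B n" if "compact_open T" "T \<subseteq> A'" for T
  proof -
    obtain n where "T \<subseteq> Q n" using Q(3) \<open>compact_open T\<close> by blast
    then have "T \<subseteq> f (Suc n) ` B (Suc n)" using st(3)[of n] that by blast
    then show ?thesis using hB[of "B (Suc n)" "Suc n"] by (intro exI[of _ "Suc n"]) simp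
  qed
  have pts: "\<exists>T. compact_open T \<and> p \<in> T \<and> T \<subseteq> E" if "p \<in> E" "clopen_Y E" for p E
  proof -
    have "p \<in> Y" using that clopen_Y_sub by blast
    then obtain T where "compact_open T" "p \<in> T" using Y_point_compact_open by blast
    then show ?thesis using clopen_Y_Int_compact_open[OF that(2)] that(1) by blast
  qed
  have AU: "\<exists>n. p \<in> B n" if "p \<in> A" for p
    using pts[OF that full_clopen_Y[OF A]] covA by blast
  have bij: "bij_betw h A A'"
    unfolding bij_betw_def
  proof
    show "inj_on h A"
    proof (rule inj_onI)
      fix p q assume "p \<in> A" "q \<in> A" "h p = h q"
      then obtain m n where "p \<in> B m" "q \<in> B n" using AU by blast
      then have pq: "p \<in> B (max m n)" "q \<in> B (max m n)"
        using B_mono[of m "max m n"] B_mono[of n "max m n"] by auto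
      then show "p = q" using \<open>h p = h q\<close> h end_isoD(3)[OF f(1)] by (metis inj_onD)
    qed
    show "h ` A = A'"
    proof
      show "h ` A \<subseteq> A'"
      proof
        fix q assume "q \<in> h ` A"
        then obtain p where p: "p \<in> A" "q = h p" by blast
        then obtain n where "p \<in> B n" using AU by blast
        then show "q \<in> A'" using f(4)[of n] p h by auto
      qed
      show "A' \<subseteq> h ` A"
      proof
        fix q assume "q \<in> A'"
        then obtain n where "q \<in> h ` B n" using pts[of q A'] full_clopen_Y[OF A'] covA' by blast
        then show "q \<in> h ` A" using f(3)[of n] by blast
      qed
    qed
  qed
  have "h ` T \<in> C \<longleftrightarrow> T \<in> C" if T: "T \<subseteq> A" for T
  proof -
    have "h ` T \<in> C \<longleftrightarrow> T \<in> C" if "T \<subseteq> B n" for n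
      using hB[OF that] clopen_isoD(4)[OF end_isoD(1)[OF f(1)] that] by simp
    moreover have "\<exists>n. T \<subseteq> B n" if "T \<in> C"
      using covA[of T] T that AY by (auto simp: compact_open_def)
    moreover have "\<exists>n. T \<subseteq> B n" if "h ` T \<in> C"
    proof -
      have "h ` T \<subseteq> A'" using T bij by (auto simp: bij_betw_def)
      then have "compact_open (h ` T)" using that AY by (auto simp: compact_open_def)
      then obtain n where n: "h ` T \<subseteq> h ` B n" using covA'[of "h ` T"] \<open>h ` T \<subseteq> A'\<close> by blast
      then have "T \<subseteq> B n" using inj_on_image_subset_iff[of h A T "B n"] bij T f(3) by (auto simp: bij_betw_def)
      then show ?thesis ..
    qed
    ultimately show ?thesis by blast
  qed
  moreover have "p \<in> V x \<longleftrightarrow> h p \<in> V x" if "p \<in> A" "x \<in> F" for p x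
  proof -
    obtain n where "p \<in> B n" using AU \<open>p \<in> A\<close> by blast
    then show ?thesis using h end_isoD(5)[OF f(1)] that by metis
  qed
  ultimately have "end_iso A A' h" using bij by (auto simp: end_iso_def clopen_iso_def)
  then show ?thesis by blast
qed

end

section \<open>Homeomorphisms supported away from the ends\<close>

context ends begin

text \<open>For \<open>A\<close> contained in \<open>Y\<close>: the homeomorphisms that fix the ends, preserve every \<open>V x\<close> and move only
points of \<open>A\<close>.\<close>

definition supported :: "'a set \<Rightarrow> ('a \<Rightarrow> 'a) set" where
  "supported A = {g \<in> Aut. (\<forall>p. p \<notin> A \<longrightarrow> g p = p) \<and> (\<forall>p. \<forall>x\<in>F. g p \<in> V x \<longleftrightarrow> p \<in> V x)}"

lemma supportedD:
  assumes "g \<in> supported A"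
  shows "g \<in> Aut" "bij g" "p \<notin> A \<Longrightarrow> g p = p" "x \<in> F \<Longrightarrow> g p \<in> V x \<longleftrightarrow> p \<in> V x"
  using assms AutD(1) by (auto simp: supported_def)

lemma supported_id: "id \<in> supported A" by (simp add: supported_def Aut_id)

lemma supported_mono: "A \<subseteq> B \<Longrightarrow> supported A \<subseteq> supported B" by (auto simp: supported_def)

lemma supported_comp: "g \<in> supported A \<Longrightarrow> h \<in> supported A \<Longrightarrow> g \<circ> h \<in> supported A"
  by (simp add: supported_def Aut_comp)

lemma supported_inv: assumes "g \<in> supported A" shows "invf g \<in> supported A"
proof -
  have "invf g p = p" if "p \<notin> A" for p using supportedD(2,3)[OF assms] that by (metis bij_inv_cancel(2))
  moreover have "invf g p \<in> V x \<longleftrightarrow> p \<in> V x" if "x \<in> F" for p x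
    using supportedD(2,4)[OF assms] that by (metis bij_inv_cancel(1))
  ultimately show ?thesis using Aut_inv[OF supportedD(1)[OF assms]] by (simp add: supported_def)
qed

lemma supported_funpow: "g \<in> supported A \<Longrightarrow> g ^^ n \<in> supported A"
  by (induction n) (auto intro: supported_comp supported_id[unfolded id_def] simp: id_def)

lemma supported_image: assumes "g \<in> supported A" "A \<subseteq> B" shows "g ` B = B"
proof -
  have sub: "h ` B \<subseteq> B" if "h \<in> supported A" for h
  proof
    fix q assume "q \<in> h ` B"
    then obtain p where p: "p \<in> B" "q = h p" by blast
    show "q \<in> B"
    proof (rule ccontr)
      assume "q \<notin> B"
      then have "h q = q" using supportedD(3)[OF that] assms(2) by blast
      then have "p = q" using p supportedD(2)[OF that] by (metis bij_inv_cancel(2))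
      then show False using p \<open>q \<notin> B\<close> by simp
    qed
  qed
  have "invf g ` B \<subseteq> B" using sub supported_inv assms by blast
  then have "g ` invf g ` B \<subseteq> g ` B" by blast
  then have "B \<subseteq> g ` B" using supportedD(2)[OF assms(1)] by (simp add: image_f_inv_f bij_is_surj)
  then show ?thesis using sub[OF assms(1)] by blast
qed

lemma supported_in: "g \<in> supported A \<Longrightarrow> A \<subseteq> B \<Longrightarrow> g p \<in> B \<longleftrightarrow> p \<in> B"
  using supported_image[of g A B] supportedD(2)[of g A] by (metis bij_inv_cancel(2) image_iff)

lemma supported_end_iso: assumes "g \<in> supported A" shows "end_iso B (g ` B) g"
  using Aut_clopen_iso[OF supportedD(1)[OF assms]] supportedD(4)[OF assms] by (simp add: end_iso_def)

lemma supported_conj: assumes "t \<in> supported B" "g \<in> supported A" shows "t \<circ> g \<circ> invf t \<in> supported (t ` A)"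
proof -
  have "(t \<circ> g \<circ> invf t) p = p" if "p \<notin> t ` A" for p
  proof -
    have "invf t p \<notin> A" using that supportedD(2)[OF assms(1)] by (metis bij_inv_cancel(1) imageI)
    then have "g (invf t p) = invf t p" using supportedD(3)[OF assms(2)] by simp
    then show ?thesis using bij_inv_cancel(1)[OF supportedD(2)[OF assms(1)]] by simp
  qed
  moreover have "t \<circ> g \<circ> invf t \<in> Aut" using supportedD(1) assms by (intro Aut_comp Aut_inv) auto
  moreover have "(t \<circ> g \<circ> invf t) p \<in> V x \<longleftrightarrow> p \<in> V x" if "x \<in> F" for p x
    using supportedD(4)[OF assms(1) that] supportedD(4)[OF assms(2) that] supportedD(4)[OF supported_inv[OF assms(1)] that] by simp
  ultimately show ?thesis by (simp add: supported_def)
qed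

lemma supported_compact_open: assumes "g \<in> supported A" "A \<subseteq> Y" "compact_open T" shows "compact_open (g ` T)"
  unfolding compact_open_def
proof
  show "g ` T \<in> C" using AutD(3)[OF supportedD(1)[OF assms(1)]] assms(3) by (simp add: compact_open_def)
  show "g ` T \<subseteq> Y" using assms(3) supported_image[OF assms(1,2)] by (auto simp: compact_open_def)
qed

lemma supported_clopen_Y: assumes "g \<in> supported A" "A \<subseteq> Y" "clopen_Y B" shows "clopen_Y (g ` B)"
  unfolding clopen_Y_def
proof (intro conjI allI impI)
  show "g ` B \<subseteq> Y" using supported_image[OF assms(1,2)] clopen_Y_sub[OF assms(3)] by blast
  fix T assume T: "compact_open T"
  have "g ` B \<inter> T = g ` (B \<inter> invf g ` T)"
    using supportedD(2)[OF assms(1)] by (simp add: image_Int bij_is_inj image_f_inv_f bij_is_surj)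
  moreover have "B \<inter> invf g ` T \<in> C"
    using assms(3) supported_compact_open[OF supported_inv[OF assms(1)] assms(2) T] by (simp add: clopen_Y_def)
  ultimately show "g ` B \<inter> T \<in> C" using AutD(3)[OF supportedD(1)[OF assms(1)]] by simp
qed

text \<open>A clopen set \<open>T\<close> containing the end \<open>x\<close> has compact complement in \<open>V x\<close>, and the map preserves \<open>V x\<close>. So
continuity at the ends follows from continuity on \<open>Y\<close>.\<close>

lemma ext_id_supported:
  assumes A: "clopen_Y A" and f: "end_iso A A f"
  shows "ext_id A f \<in> supported A"
proof -
  have AY: "A \<subseteq> Y" using A clopen_Y_sub by blast
  have V: "ext_id A h p \<in> V x \<longleftrightarrow> p \<in> V x" if "end_iso A A h" "x \<in> F" for h p x
    using end_isoD(5)[OF that(1) _ that(2)] by (simp add: ext_id_def)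
  have bij: "bij (ext_id A h)" if "end_iso A A h" for h using bij_ext_id(1)[OF end_isoD(4)[OF that]] .
  have cp: "ext_id A h ` T \<in> C" if h: "end_iso A A h" and T: "compact_open T" for h T
  proof -
    have "ext_id A h ` T = (T - A \<inter> T) \<union> h ` (A \<inter> T)" by (auto simp: ext_id_def)
    moreover have "A \<inter> T \<in> C" using A T by (simp add: clopen_Y_def)
    moreover have "h ` (A \<inter> T) \<in> C" using clopen_isoD(4)[OF end_isoD(1)[OF h], of "A \<inter> T"] calculation by auto
    ultimately show ?thesis using T by (simp add: C_Un C_Diff compact_open_def)
  qed
  have VF: "V x - F = V x - {x}" if "x \<in> F" for x using V_F that by blast
  have main: "ext_id A h ` T \<in> C" if h: "end_iso A A h" and T: "T \<in> C" for h T
  proof -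
    let ?e = "ext_id A h"
    have piece: "?e ` (T \<inter> V x) \<in> C" if x: "x \<in> F" for x
    proof (cases "x \<in> T")
      case False
      then have "compact_open (T \<inter> V x)" using T V_C x V_F unfolding compact_open_def Y_def by (auto intro: C_Int)
      then show ?thesis using cp[OF h] by blast
    next
      case True
      then have c: "compact_open (V x - T)" using T V_C x V_F unfolding compact_open_def Y_def by (auto intro: C_Diff)
      have eV: "?e ` V x = V x"
      proof
        show "?e ` V x \<subseteq> V x" using V[OF h x] by blast
        show "V x \<subseteq> ?e ` V x"
        proof
          fix q assume "q \<in> V x"
          then have "invf ?e q \<in> V x" using V[OF h x] bij_inv_cancel(1)[OF bij[OF h]] by metis
          then show "q \<in> ?e ` V x" using bij_inv_cancel(1)[OF bij[OF h]] by (metis imageI)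
        qed
      qed
      have "?e ` (T \<inter> V x) = ?e ` (V x - (V x - T))" by (rule arg_cong[where f = "image ?e"]) blast
      also have "\<dots> = V x - ?e ` (V x - T)" using bij[OF h] eV by (simp add: image_set_diff bij_is_inj)
      finally show ?thesis using cp[OF h c] V_C[OF x] by (simp add: C_Diff)
    qed
    have "?e ` (T - (\<Union>x\<in>F. V x)) = T - (\<Union>x\<in>F. V x)"
      using AY by (force simp: Y_def)
    moreover have "T - (\<Union>x\<in>F. V x) \<in> C" using T finite_F V_C by (intro C_Diff C_UN) auto
    moreover have "?e ` T = ?e ` (T - (\<Union>x\<in>F. V x)) \<union> (\<Union>x\<in>F. ?e ` (T \<inter> V x))" by blast
    moreover have "(\<Union>x\<in>F. ?e ` (T \<inter> V x)) \<in> C" using finite_F piece by (intro C_UN) auto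
    ultimately show ?thesis by (simp add: C_Un)
  qed
  have "ext_id A f \<in> Aut"
  proof (rule AutI)
    show "bij (ext_id A f)" using bij[OF f] .
    show "ext_id A f p = p" if "p \<notin> S" for p
    proof -
      have "Y \<subseteq> S" using V_C C_subset by (auto simp: Y_def)
      then show ?thesis using AY that by (auto simp: ext_id_def)
    qed
    show "ext_id A f ` T \<in> C" if "T \<in> C" for T using main[OF f that] .
    show "invf (ext_id A f) ` T \<in> C" if "T \<in> C" for T
      using main[OF end_iso_inv[OF f] that] bij_ext_id(2)[OF end_isoD(4)[OF f]] by simp
  qed
  then show ?thesis using V[OF f] by (auto simp: supported_def)
qed

text \<open>A homeomorphism between subsets extends as soon as their complements are full, because then the
complements are homeomorphic.\<close>

lemma extend_end_iso:
  assumes A: "clopen_Y A" and L: "clopen_Y L" "L \<subseteq> A" and L': "clopen_Y L'" "L' \<subseteq> A" and f: "end_iso L L' f"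
    and full: "full (A - L)" "full (A - L')"
  shows "\<exists>k\<in>supported A. \<forall>p\<in>L. k p = f p"
proof -
  obtain g where g: "end_iso (A - L) (A - L') g" using full_end_iso[OF full] by blast
  have "\<exists>h. end_iso (L \<union> (A - L)) (L' \<union> (A - L')) h \<and> (\<forall>p\<in>L. h p = f p) \<and> (\<forall>p\<in>A - L. h p = g p)"
    by (rule end_iso_Un[OF f g]) (use L L' full full_clopen_Y in auto)
  moreover have "L \<union> (A - L) = A" "L' \<union> (A - L') = A" using L L' by auto
  ultimately obtain h where h: "end_iso A A h" "\<forall>p\<in>L. h p = f p" by auto
  show ?thesis using ext_id_supported[OF A h(1)] h(2) L by (intro bexI[of _ "ext_id A h"]) auto
qed

lemma swap_supported:
  assumes "end_iso A B f" "A \<inter> B = {}" "clopen_Y A" "clopen_Y B"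
  shows "ext_id (A \<union> B) (swap_map A B f) \<in> supported (A \<union> B)"
proof (rule ext_id_supported)
  show "clopen_Y (A \<union> B)" using assms by (simp add: clopen_Y_Un)
  have "clopen_iso (A \<union> B) (A \<union> B) (swap_map A B f)"
  proof (rule clopen_iso_swap_map[OF end_isoD(1)[OF assms(1)] assms(2)])
    fix T assume T: "T \<in> C" "T \<subseteq> A \<union> B"
    then have "T \<subseteq> Y" using assms clopen_Y_sub by blast
    then show "T \<inter> A \<in> C \<and> T \<inter> B \<in> C" using T assms clopen_Y_Int_C by auto
  qed
  moreover have "p \<in> V x \<longleftrightarrow> swap_map A B f p \<in> V x" if "p \<in> A \<union> B" "x \<in> F" for p x
    using that end_isoD(5)[OF assms(1)] end_isoD(5)[OF end_iso_inv[OF assms(1)]] by (auto simp: swap_map_def)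
  ultimately show "end_iso (A \<union> B) (A \<union> B) (swap_map A B f)" by (simp add: end_iso_def)
qed

section \<open>Cutting the space into pieces\<close>

text \<open>Exhaust \<open>Y\<close> by compact open sets \<open>G n\<close> such that the \<open>n\<close>-th difference contains a copy of \<open>Q n\<close>, where
\<open>Q\<close> is some exhaustion. Given \<open>B\<close> and \<open>D\<close>, all but finitely many pieces miss \<open>D\<close> and contain a copy of
\<open>B\<close>, hence some piece of any infinite family does.\<close>

lemma ex_pieces:
  "\<exists>E :: nat \<Rightarrow> 'a set. (\<forall>i. compact_open (E i)) \<and> disjoint_family E \<and> (\<Union>i. E i) = Y \<and>
     (\<forall>B. compact_open B \<longrightarrow> finite {i. B \<inter> E i \<noteq> {}}) \<and>
     (\<forall>l. infinite l \<longrightarrow> (\<forall>B D. compact_open B \<longrightarrow> compact_open D \<longrightarrow> (\<exists>e. end_iso B (e ` B) e \<and> e ` B \<subseteq> (\<Union>i\<in>l. E i) - D)))"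
proof -
  obtain Q :: "nat \<Rightarrow> 'a set" where Q: "\<And>n. compact_open (Q n)" "\<And>m n. m \<le> n \<Longrightarrow> Q m \<subseteq> Q n"
    "\<And>B. compact_open B \<Longrightarrow> \<exists>n. B \<subseteq> Q n" using exhaustion by blast
  define N where "N n B B' \<longleftrightarrow> B \<subseteq> B' \<and> Q n \<subseteq> B' \<and> (\<exists>e. end_iso (Q n) (e ` Q n) e \<and> e ` Q n \<subseteq> B' - B)"
    for n B B'
  have "\<exists>G. \<forall>n. compact_open (G n) \<and> N n (G n) (G (Suc n))"
  proof (rule dependent_nat_choice)
    show "\<exists>x. compact_open x" using compact_open_empty by blast
  next
    fix B n assume B: "compact_open B"
    obtain e where e: "end_iso (Q n) (e ` Q n) e" "e ` Q n \<subseteq> Y - B" using full_embed[OF full_Y Q(1) B] .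
    have "compact_open (e ` Q n)" by (rule end_iso_compact_open[OF e(1)]) (use e Q(1) in auto)
    then have "compact_open (B \<union> Q n \<union> e ` Q n)" using B Q(1) by (intro compact_open_Un)
    moreover have "N n B (B \<union> Q n \<union> e ` Q n)" unfolding N_def using e by blast
    ultimately show "\<exists>y. compact_open y \<and> N n B y" by blast
  qed
  then obtain G where G: "\<forall>n. compact_open (G n) \<and> N n (G n) (G (Suc n))" by (elim exE)
  then have G': "compact_open (G n)" "G n \<subseteq> G (Suc n)" "Q n \<subseteq> G (Suc n)"
      "\<exists>e. end_iso (Q n) (e ` Q n) e \<and> e ` Q n \<subseteq> G (Suc n) - G n" for n
    by (simp_all add: N_def)
  have G_mono: "m \<le> n \<Longrightarrow> G m \<subseteq> G n" for m n
    by (rule lift_Suc_mono_le[of G]) (rule G')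
  \<comment> \<open>The first piece is all of \<open>G 1\<close>, because \<open>G 0\<close> is arbitrary.\<close>
  define E where "E n = (if n = 0 then G 1 else G (Suc n) - G n)" for n
  have E_sub: "G (Suc n) - G n \<subseteq> E n" "E n \<subseteq> G (Suc n)" for n by (auto simp: E_def)
  have E_out: "E i \<inter> G n = {}" if "n \<le> i" "0 < n" for i n
    using that G_mono[of n i] by (auto simp: E_def)
  have cov: "\<exists>n. B \<subseteq> G (Suc n)" if B: "compact_open B" for B
  proof -
    obtain n where "B \<subseteq> Q n" using Q(3)[OF B] by blast
    moreover have "Q n \<subseteq> G (Suc n)" by (rule G')
    ultimately show ?thesis by blast
  qed
  have EG: "(\<Union>i\<le>n. E i) = G (Suc n)" for n
  proof (induction n)
    case 0 then show ?case by (simp add: E_def)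
  next
    case (Suc n)
    have "(\<Union>i\<le>Suc n. E i) = G (Suc n) \<union> E (Suc n)" using Suc by (simp add: atMost_Suc Un_commute)
    then show ?case using G_mono[of "Suc n" "Suc (Suc n)"] by (auto simp: E_def)
  qed
  have 1: "compact_open (E i)" for i using G'(1) by (simp add: E_def compact_open_Diff)
  have 2: "disjoint_family E"
    unfolding disjoint_family_on_def
  proof (intro ballI impI)
    fix m n :: nat assume "m \<noteq> n"
    have "E i \<inter> E j = {}" if "i < j" for i j using E_sub(2)[of i] E_out[of "Suc i" j] that by auto
    then show "E m \<inter> E n = {}" using \<open>m \<noteq> n\<close> by (metis Int_commute nat_neq_iff)
  qed
  have 4: "finite {i. B \<inter> E i \<noteq> {}}" if B: "compact_open B" for B
  proof -
    obtain n where "B \<subseteq> G (Suc n)" using cov[OF B] by blast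
    then have "{i. B \<inter> E i \<noteq> {}} \<subseteq> {..n}" using E_out[of "Suc n"] by (force simp: not_less_eq_eq)
    then show ?thesis using finite_subset by blast
  qed
  have 3: "(\<Union>i. E i) = Y"
  proof
    show "(\<Union>i. E i) \<subseteq> Y" using 1 by (auto simp: compact_open_def)
    show "Y \<subseteq> (\<Union>i. E i)"
    proof
      fix p assume "p \<in> Y"
      then obtain n where "p \<in> G (Suc n)" using Y_point_compact_open cov by blast
      then show "p \<in> (\<Union>i. E i)" using EG[of n] by blast
    qed
  qed
  have 5: "\<exists>e. end_iso B (e ` B) e \<and> e ` B \<subseteq> (\<Union>i\<in>l. E i) - D"
    if l: "infinite l" and B: "compact_open B" and D: "compact_open D" for l B D
  proof -
    obtain m where m: "B \<subseteq> Q m" using Q(3)[OF B] by blast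
    obtain n where n: "D \<subseteq> G (Suc n)" using cov[OF D] by blast
    obtain i where i: "i \<in> l" "i > max m n" using l by (meson infinite_nat_iff_unbounded)
    obtain e where e: "end_iso (Q i) (e ` Q i) e" "e ` Q i \<subseteq> G (Suc i) - G i"
      using G'(4)[of i] by blast
    have "B \<subseteq> Q i" using m Q(2)[of m i] i by auto
    then have "end_iso B (e ` B) e" "e ` B \<subseteq> E i" using end_iso_restrict[OF e(1)] e(2) E_sub(1)[of i] by blast+
    moreover have "E i \<inter> D = {}" using n E_out[of "Suc n" i] i by auto
    ultimately show ?thesis using i(1) by blast
  qed
  show ?thesis using 1 2 3 4 5 by (intro exI[of _ E] conjI allI impI) simp_all
qed

end

locale pieces = ends S C F V for S :: "'a set" and C and F and V +
  fixes E :: "nat \<Rightarrow> 'a set"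
  assumes E_compact_open: "compact_open (E i)" and E_disjoint: "disjoint_family E" and E_Union: "(\<Union>i. E i) = Y"
    and E_loc_fin: "compact_open B \<Longrightarrow> finite {i. B \<inter> E i \<noteq> {}}"
    and E_embed: "infinite l \<Longrightarrow> compact_open B \<Longrightarrow> compact_open D \<Longrightarrow>
       \<exists>e. end_iso B (e ` B) e \<and> e ` B \<subseteq> (\<Union>i\<in>l. E i) - D"
begin

definition M :: "nat set \<Rightarrow> 'a set" where "M l = (\<Union>i\<in>l. E i)"

lemma M_UNIV: "M UNIV = Y" using E_Union by (simp add: M_def)
lemma M_Un: "M (l \<union> m) = M l \<union> M m" by (auto simp: M_def)
lemma M_mono: "l \<subseteq> m \<Longrightarrow> M l \<subseteq> M m" by (auto simp: M_def)
lemma M_UN: "M (\<Union>i\<in>I. l i) = (\<Union>i\<in>I. M (l i))" by (auto simp: M_def)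

lemma E_inj: "p \<in> E i \<Longrightarrow> p \<in> E j \<Longrightarrow> i = j"
  using E_disjoint by (auto simp: disjoint_family_on_def)

lemma M_Int: "M (l \<inter> m) = M l \<inter> M m"
  using E_inj by (auto simp: M_def)

lemma M_Diff: "M (l - m) = M l - M m"
  using E_inj by (auto simp: M_def)

lemma M_disjoint: "l \<inter> m = {} \<Longrightarrow> M l \<inter> M m = {}"
  using M_Int[of l m] by (simp add: M_def)

lemma M_Compl: "M (- l) = Y - M l"
  using M_Diff[of UNIV l] by (simp add: M_UNIV Compl_eq_Diff_UNIV)

lemma M_Y: "M l \<subseteq> Y" using M_mono[of l UNIV] by (simp add: M_UNIV)

lemma clopen_Y_M: "clopen_Y (M l)"
  unfolding clopen_Y_def
proof (intro conjI allI impI M_Y)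
  fix T assume T: "compact_open T"
  have "(\<Union>i\<in>{i. T \<inter> E i \<noteq> {}} \<inter> l. T \<inter> E i) \<in> C"
    using E_loc_fin[OF T] T E_compact_open by (intro C_UN) (auto simp: compact_open_def C_Int)
  moreover have "M l \<inter> T = (\<Union>i\<in>{i. T \<inter> E i \<noteq> {}} \<inter> l. T \<inter> E i)" by (auto simp: M_def)
  ultimately show "M l \<inter> T \<in> C" by simp
qed

lemma full_M: "infinite l \<Longrightarrow> full (M l)"
  unfolding full_def using clopen_Y_M E_embed by (simp add: M_def)

lemma compact_open_M: "finite l \<Longrightarrow> compact_open (M l)"
  unfolding M_def by (intro compact_open_UN E_compact_open)

lemma loc_fin_M:
  assumes "disjoint_family P"
  shows "loc_fin UNIV (\<lambda>i :: nat. M (P i))"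
  unfolding loc_fin_def
proof (intro ballI impI conjI)
  fix T assume T: "T \<in> C" "T \<subseteq> (\<Union>i. M (P i))"
  then have TY: "compact_open T" using M_Y by (fastforce simp: compact_open_def)
  have "\<exists>i. i \<in> P j \<and> T \<inter> E i \<noteq> {}" if "T \<inter> M (P j) \<noteq> {}" for j using that by (auto simp: M_def)
  then obtain k where k: "\<And>j. T \<inter> M (P j) \<noteq> {} \<Longrightarrow> k j \<in> P j \<and> T \<inter> E (k j) \<noteq> {}" by metis
  have "inj_on k {j \<in> UNIV. T \<inter> M (P j) \<noteq> {}}"
  proof (rule inj_onI)
    fix i j assume "i \<in> {j \<in> UNIV. T \<inter> M (P j) \<noteq> {}}" "j \<in> {j \<in> UNIV. T \<inter> M (P j) \<noteq> {}}" "k i = k j"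
    then have "k i \<in> P i \<inter> P j" using k[of i] k[of j] by simp
    then show "i = j" using assms by (auto simp: disjoint_family_on_def)
  qed
  moreover have "k ` {j \<in> UNIV. T \<inter> M (P j) \<noteq> {}} \<subseteq> {i. T \<inter> E i \<noteq> {}}" using k by blast
  ultimately show "finite {j \<in> UNIV. T \<inter> M (P j) \<noteq> {}}"
    using E_loc_fin[OF TY] by (rule inj_on_finite)
  show "T \<inter> M (P i) \<in> C" for i using clopen_Y_Int_C[OF clopen_Y_M] TY by (simp add: compact_open_def)
qed

lemma disjoint_M: "disjoint_family P \<Longrightarrow> disjoint_family (\<lambda>i :: nat. M (P i))"
  using M_disjoint by (simp add: disjoint_family_on_def)

lemma end_iso_M_glue:
  assumes "\<And>i. end_iso (M (P i)) (M (P' i)) (f i)" "disjoint_family P" "disjoint_family P'"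
  shows "\<exists>h. end_iso (M (\<Union>i :: nat. P i)) (M (\<Union>i. P' i)) h \<and> (\<forall>i. \<forall>p\<in>M (P i). h p = f i p)"
proof -
  have "\<exists>h. end_iso (\<Union>i\<in>UNIV. M (P i)) (\<Union>i\<in>UNIV. M (P' i)) h \<and> (\<forall>i\<in>UNIV. \<forall>p\<in>M (P i). h p = f i p)"
    by (rule end_iso_glue) (use assms disjoint_M loc_fin_M in auto)
  then show ?thesis by (simp add: M_UN)
qed

text \<open>Infinitely many homeomorphisms with supports in disjoint unions of pieces always combine to one, even
if the supports do not shrink: a compact set meets finitely many pieces only.\<close>

lemma supported_M_glue:
  assumes "\<And>i. f i \<in> supported (M (P i))" "disjoint_family P"
  shows "\<exists>h \<in> supported (M (\<Union>i :: nat. P i)). \<forall>i. \<forall>p\<in>M (P i). h p = f i p"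
proof -
  have "end_iso (M (P i)) (M (P i)) (f i)" for i
    using supported_end_iso[OF assms(1)[of i], of "M (P i)"] supported_image[OF assms(1)[of i] order_refl] by simp
  then obtain h where h: "end_iso (M (\<Union>i. P i)) (M (\<Union>i. P i)) h" "\<forall>i. \<forall>p\<in>M (P i). h p = f i p"
    using end_iso_M_glue[OF _ assms(2,2)] by blast
  have "ext_id (M (\<Union>i. P i)) h p = f i p" if "p \<in> M (P i)" for i p
  proof -
    have "p \<in> M (\<Union>i. P i)" using that M_mono[of "P i" "\<Union>i. P i"] by blast
    then show ?thesis using h(2) that by simp
  qed
  then show ?thesis using ext_id_supported[OF clopen_Y_M h(1)] by blast
qed

end

section \<open>Infinite sets of natural numbers\<close>

lemma infinite_nat_partition:
  assumes "infinite (A :: nat set)"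
  obtains P :: "nat \<Rightarrow> nat set" where "disjoint_family P" "\<And>i. infinite (P i)" "(\<Union>i. P i) = A"
proof
  define P where "P i = (\<lambda>j. enumerate A (prod_encode (i, j))) ` UNIV" for i
  have inj: "inj (enumerate A)" using bij_enumerate[OF assms] by (simp add: bij_betw_def)
  show "disjoint_family P"
    by (auto simp: disjoint_family_on_def P_def dest!: injD[OF inj] simp: prod_encode_eq)
  show "infinite (P i)" for i
    unfolding P_def by (rule range_inj_infinite) (auto intro!: injI dest!: injD[OF inj] simp: prod_encode_eq)
  have A: "A = range (enumerate A)" using bij_enumerate[OF assms] by (simp add: bij_betw_def)
  have "enumerate A n \<in> (\<Union>i. P i)" for n
  proof -
    obtain i j where "n = prod_encode (i, j)" by (metis prod_decode_inverse surj_pair)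
    then show ?thesis by (auto simp: P_def)
  qed
  then have "range (enumerate A) \<subseteq> (\<Union>i. P i)" by blast
  moreover have "(\<Union>i. P i) \<subseteq> range (enumerate A)" by (auto simp: P_def)
  ultimately show "(\<Union>i. P i) = A" using A by simp
qed

text \<open>The codes of the initial segments of the characteristic sequence of \<open>s\<close>: two different sequences share
only finitely many initial segments. Only even numbers are used, so that the complement of the union
of two members remains infinite.\<close>

lemma almost_disjoint_family:
  "\<exists>B :: nat set \<Rightarrow> nat set. (\<forall>s. infinite (B s)) \<and> (\<forall>s t. s \<noteq> t \<longrightarrow> finite (B s \<inter> B t)) \<and>
     (\<forall>s t. infinite (- (B s \<union> B t)))"
proof -
  define B where "B s = (\<lambda>n. 2 * to_nat (map (\<lambda>i. i \<in> s) [0..<n])) ` UNIV" for s :: "nat set"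
  have inj: "m = n \<and> map (\<lambda>i. i \<in> s) [0..<m] = map (\<lambda>i. i \<in> t) [0..<n]"
    if "2 * to_nat (map (\<lambda>i. i \<in> s) [0..<m]) = 2 * to_nat (map (\<lambda>i. i \<in> t) [0..<n])" for s t :: "nat set" and m n
  proof -
    have eq: "map (\<lambda>i. i \<in> s) [0..<m] = map (\<lambda>i. i \<in> t) [0..<n]" using that by simp
    then show ?thesis using map_eq_imp_length_eq[OF eq] by simp
  qed
  have "infinite (B s)" for s
    unfolding B_def using inj by (intro range_inj_infinite injI) blast
  moreover have "finite (B s \<inter> B t)" if ne: "s \<noteq> t" for s t
  proof -
    obtain k where k: "(k \<in> s) \<noteq> (k \<in> t)" using ne by blast
    have "B s \<inter> B t \<subseteq> (\<lambda>n. 2 * to_nat (map (\<lambda>i. i \<in> s) [0..<n])) ` {..k}"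
    proof
      fix q assume "q \<in> B s \<inter> B t"
      then obtain m n where q: "q = 2 * to_nat (map (\<lambda>i. i \<in> s) [0..<m])"
        "q = 2 * to_nat (map (\<lambda>i. i \<in> t) [0..<n])" unfolding B_def by blast
      then have "m = n" and eq: "map (\<lambda>i. i \<in> s) [0..<m] = map (\<lambda>i. i \<in> t) [0..<n]"
        using inj[of s m t n] by auto
      have "m \<le> k"
      proof (rule ccontr)
        assume "\<not> m \<le> k"
        then have "map (\<lambda>i. i \<in> s) [0..<m] ! k = map (\<lambda>i. i \<in> t) [0..<n] ! k" "k < m" using eq by auto
        then show False using k \<open>m = n\<close> by simp
      qed
      then show "q \<in> (\<lambda>n. 2 * to_nat (map (\<lambda>i. i \<in> s) [0..<n])) ` {..k}" using q(1) by blast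
    qed
    then show ?thesis using finite_subset by blast
  qed
  moreover have "infinite (- (B s \<union> B t))" for s t
  proof -
    have "range (\<lambda>n. 2 * n + 1) \<subseteq> - (B s \<union> B t)"
    proof
      fix q assume "q \<in> range (\<lambda>n :: nat. 2 * n + 1)"
      then have "odd q" by auto
      then show "q \<in> - (B s \<union> B t)" by (auto simp: B_def)
    qed
    moreover have "infinite (range (\<lambda>n :: nat. 2 * n + 1))" by (rule range_inj_infinite) (auto intro: injI)
    ultimately show ?thesis using finite_subset by blast
  qed
  ultimately show ?thesis by (intro exI[of _ B]) blast
qed

text \<open>In a locally finite graph an infinite independent set is found greedily: take each new vertex larger
than all neighbours of the earlier ones.\<close>

lemma sparse_subsequence:
  fixes R :: "nat \<Rightarrow> nat \<Rightarrow> bool"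
  assumes "\<And>i. finite {j. R i j}" "\<And>i. finite {j. R j i}" "infinite l"
  obtains r :: "nat \<Rightarrow> nat" where "strict_mono r" "range r \<subseteq> l" "\<And>m n. m \<noteq> n \<Longrightarrow> \<not> R (r m) (r n)"
proof -
  define N where "N i = (\<Union>j\<le>i. {k. R j k} \<union> {k. R k j})" for i
  have fin: "finite (N i)" for i unfolding N_def using assms by auto
  have "\<exists>r. \<forall>n. r n \<in> l \<and> (r n < r (Suc n) \<and> (\<forall>q\<in>N (r n). q < r (Suc n)))"
  proof (rule dependent_nat_choice)
    show "\<exists>x. x \<in> l" using assms(3) infinite_imp_nonempty by blast
  next
    fix x n :: nat
    have "finite (insert x (N x))" using fin by simp
    then obtain b where b: "\<forall>q\<in>insert x (N x). q \<le> b" using finite_nat_set_iff_bounded_le by blast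
    obtain y where y: "y \<in> l" "b < y" using assms(3) by (meson infinite_nat_iff_unbounded)
    have "x < y" "\<forall>q\<in>N x. q < y" using b y(2) by auto
    then show "\<exists>y. y \<in> l \<and> (x < y \<and> (\<forall>q\<in>N x. q < y))" using y(1) by blast
  qed
  then obtain r where r': "\<forall>n. r n \<in> l \<and> (r n < r (Suc n) \<and> (\<forall>q\<in>N (r n). q < r (Suc n)))" by (elim exE)
  then have r: "r n \<in> l" "r n < r (Suc n)" "\<forall>q\<in>N (r n). q < r (Suc n)" for n by auto
  have mono: "strict_mono r" using r(2) by (simp add: strict_mono_Suc_iff)
  have "r n \<notin> N (r m)" if mn: "m < n" for m n
  proof -
    obtain k where k: "n = Suc k" "m \<le> k" using mn by (metis less_Suc_eq_le not0_implies_Suc not_less0)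
    have "r m \<le> r k" using mono k(2) by (simp add: strict_mono_less_eq)
    then have "N (r m) \<subseteq> N (r k)" unfolding N_def by (intro UN_mono) auto
    then show ?thesis using r(3)[of k] k(1) by blast
  qed
  moreover have "q \<in> N i" if "R i q \<or> R q i" for i q using that by (auto simp: N_def)
  ultimately have "\<not> R (r m) (r n)" if "m \<noteq> n" for m n
    using that by (metis nat_neq_iff)
  then show thesis using that mono r(1) by blast
qed

section \<open>Factorisation over two overlapping halves\<close>

context pieces begin

text \<open>Suppose that \<open>k\<close> in \<open>supported (M b)\<close> and \<open>k'\<close> in \<open>supported (M a)\<close> can be found such that
\<open>h = k' o k o g\<close> is the identity on a full set \<open>M l0\<close> inside \<open>M (a \<inter> b)\<close>. A homeomorphism of \<open>M b\<close> that
spreads \<open>M l0\<close> over \<open>M l0 \<union> M (b - a)\<close> then conjugates \<open>h\<close> into \<open>supported (M a)\<close>, which gives the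
factorisation of \<open>g\<close>.

To find \<open>k\<close> and \<open>k'\<close>, choose \<open>l0\<close> so sparse that \<open>g\<close> maps \<open>M l0\<close> off two further full sets \<open>M l1\<close> and
\<open>M l2\<close> inside \<open>M (a \<inter> b)\<close>. First use \<open>M l1\<close> to push into \<open>M a\<close> the part of the image that lies in
\<open>M (b - a)\<close>, then move the image back to \<open>M l0\<close> inside \<open>M a\<close>; the set \<open>M l2\<close> is kept free so that the
complements in the last step are full.\<close>

lemma factor_through_two_halves:
  assumes ab: "infinite (a \<inter> b)" and g: "g \<in> supported (M (a \<union> b))"
  obtains k1 k2 t m where "k1 \<in> supported (M b)" "k2 \<in> supported (M a)" "t \<in> supported (M b)" "m \<in> supported (M a)"
    "g = k1 \<circ> k2 \<circ> t \<circ> m \<circ> invf t"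
proof -
  have gY: "g \<in> supported Y" using g supported_mono[OF M_Y] by blast
  have fin1: "finite {j. g ` E i \<inter> E j \<noteq> {}}" for i
    by (rule E_loc_fin) (rule supported_compact_open[OF gY order_refl E_compact_open])
  have "g ` E j \<inter> E i \<noteq> {} \<longleftrightarrow> invf g ` E i \<inter> E j \<noteq> {}" for i j
    using supportedD(2)[OF g] by (auto simp: bij_inv_cancel)
  then have fin2: "finite {j. g ` E j \<inter> E i \<noteq> {}}" for i
    using E_loc_fin[OF supported_compact_open[OF supported_inv[OF gY] order_refl E_compact_open]] by simp
  obtain r :: "nat \<Rightarrow> nat" where r: "strict_mono r" "range r \<subseteq> a \<inter> b"
    "\<And>m n. m \<noteq> n \<Longrightarrow> g ` E (r m) \<inter> E (r n) = {}"
    using sparse_subsequence[of "\<lambda>i j. g ` E i \<inter> E j \<noteq> {}", OF fin1 fin2 ab] by metis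
  define l0 l1 l2 where "l0 = range (\<lambda>n. r (3 * n))" and "l1 = range (\<lambda>n. r (3 * n + 1))"
    and "l2 = range (\<lambda>n. r (3 * n + 2))"
  have inj: "inj r" using r(1) by (rule strict_mono_imp_inj_on)
  have inf: "infinite l0" "infinite l1" "infinite l2"
    unfolding l0_def l1_def l2_def by (auto intro!: range_inj_infinite injI dest!: injD[OF inj])
  have disj: "l0 \<inter> l1 = {}" "l0 \<inter> l2 = {}" "l1 \<inter> l2 = {}"
    unfolding l0_def l1_def l2_def by (auto dest!: injD[OF inj]; presburger)+
  have sub: "l0 \<subseteq> a \<inter> b" "l1 \<subseteq> a \<inter> b" "l2 \<subseteq> a \<inter> b" using r(2) unfolding l0_def l1_def l2_def by auto
  have no_edge: "g ` M l0 \<inter> M l1 = {}" "g ` M l0 \<inter> M l2 = {}"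
  proof -
    have "g ` E (r (3 * m)) \<inter> E (r (3 * n + 1)) = {}" "g ` E (r (3 * m)) \<inter> E (r (3 * n + 2)) = {}" for m n
      by (rule r(3), presburger)+
    then show "g ` M l0 \<inter> M l1 = {}" "g ` M l0 \<inter> M l2 = {}"
      unfolding M_def l0_def l1_def l2_def by blast+
  qed
  have gL: "g ` M l0 \<subseteq> M a \<union> M (b - a)"
  proof -
    have "g ` M l0 \<subseteq> g ` M (a \<union> b)" using sub M_mono[of l0 "a \<union> b"] by blast
    also have "\<dots> = M (a \<union> b)" by (rule supported_image[OF g order_refl])
    also have "\<dots> = M a \<union> M (b - a)" using M_Un[of a "b - a"] by simp
    finally show ?thesis .
  qed
  have M0: "M l0 \<subseteq> M a" "M l0 \<subseteq> M b" "M l1 \<subseteq> M a" "M l1 \<subseteq> M b" "M l2 \<subseteq> M a" "M l2 \<subseteq> M b"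
    using sub by (auto intro!: M_mono)
  have Mdisj: "M l0 \<inter> M l1 = {}" "M l0 \<inter> M l2 = {}" "M l1 \<inter> M l2 = {}" "M a \<inter> M (b - a) = {}"
    using disj by (auto intro!: M_disjoint)
  \<comment> \<open>The part of the image of \<open>M l0\<close> outside \<open>M a\<close> is absorbed by \<open>M l1\<close>.\<close>
  define R where "R = g ` M l0 \<inter> M (b - a)"
  have regR: "clopen_Y R" unfolding R_def by (intro clopen_Y_Int clopen_Y_M supported_clopen_Y[OF gY order_refl])
  have "full (R \<union> M l1)" by (rule full_mono[OF full_M[OF inf(2)]]) (auto intro: clopen_Y_Un regR clopen_Y_M)
  then obtain \<theta> where th: "end_iso (R \<union> M l1) (M l1) \<theta>" using full_end_iso full_M[OF inf(2)] by blast
  define R' where "R' = \<theta> ` R"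
  have thR: "end_iso R R' \<theta>" using end_iso_restrict[OF th, of R] by (simp add: R'_def)
  have R'1: "R' \<subseteq> M l1" using end_isoD(2)[OF th] by (auto simp: R'_def)
  have RR': "R \<inter> R' = {}" using R'1 M0 Mdisj(4) by (auto simp: R_def)
  have regR': "clopen_Y R'"
    unfolding clopen_Y_def
  proof (intro conjI allI impI)
    show "R' \<subseteq> Y" using R'1 M_Y by blast
    fix T assume T: "compact_open T"
    have "compact_open (M l1 \<inter> T)" using clopen_Y_Int_compact_open[OF clopen_Y_M T] .
    then have "compact_open (inv_into (R \<union> M l1) \<theta> ` (M l1 \<inter> T))"
      by (rule end_iso_compact_open[OF end_iso_inv[OF th], rotated 2]) (use regR clopen_Y_sub M_Y in auto)
    then have "compact_open (R \<inter> inv_into (R \<union> M l1) \<theta> ` (M l1 \<inter> T))" by (rule clopen_Y_Int_compact_open[OF regR])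
    then have "\<theta> ` (R \<inter> inv_into (R \<union> M l1) \<theta> ` (M l1 \<inter> T)) \<in> C"
      using clopen_isoD(4)[OF end_isoD(1)[OF thR], of "R \<inter> inv_into (R \<union> M l1) \<theta> ` (M l1 \<inter> T)"]
      by (auto simp: compact_open_def)
    moreover have "\<theta> ` (R \<inter> inv_into (R \<union> M l1) \<theta> ` (M l1 \<inter> T)) = R' \<inter> T"
    proof
      show "\<theta> ` (R \<inter> inv_into (R \<union> M l1) \<theta> ` (M l1 \<inter> T)) \<subseteq> R' \<inter> T"
        using end_isoD(2)[OF th] by (auto simp: R'_def f_inv_into_f)
      show "R' \<inter> T \<subseteq> \<theta> ` (R \<inter> inv_into (R \<union> M l1) \<theta> ` (M l1 \<inter> T))"
      proof
        fix q assume q: "q \<in> R' \<inter> T"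
        then obtain p where p: "p \<in> R" "q = \<theta> p" by (auto simp: R'_def)
        have "inv_into (R \<union> M l1) \<theta> q = p" using p end_isoD(3)[OF th] by simp
        then show "q \<in> \<theta> ` (R \<inter> inv_into (R \<union> M l1) \<theta> ` (M l1 \<inter> T))"
          using p q R'1 by (metis (no_types, lifting) Int_iff imageI subsetD)
      qed
    qed
    ultimately show "R' \<inter> T \<in> C" by simp
  qed
  define s where "s = ext_id (R \<union> R') (swap_map R R' \<theta>)"
  have sRR: "s \<in> supported (R \<union> R')" unfolding s_def by (rule swap_supported[OF thR RR' regR regR'])
  have "R \<union> R' \<subseteq> M b" using R'1 M0 M_mono[of "b - a" b] by (auto simp: R_def)
  then have sb: "s \<in> supported (M b)" using sRR supported_mono by blast
  have sR: "s p \<in> R'" if "p \<in> R" for p using that by (auto simp: s_def swap_map_def R'_def)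
  have sg: "s (g p) \<in> M a - M l2" if p: "p \<in> M l0" for p
  proof (cases "g p \<in> R")
    case True then show ?thesis using sR[OF True] R'1 M0 Mdisj by blast
  next
    case False
    then have "g p \<in> M a" using gL p by (auto simp: R_def)
    moreover have "g p \<notin> R'" "g p \<notin> M l2" using no_edge p R'1 by auto
    ultimately show ?thesis using supportedD(3)[OF sRR] False by auto
  qed
  have sgK: "s \<circ> g \<in> supported Y" using supported_mono[OF M_Y] sb gY by (intro supported_comp) auto
  \<comment> \<open>Bring the image back to \<open>M l0\<close> inside \<open>M a\<close>.\<close>
  define L where "L = (s \<circ> g) ` M l0"
  have iso1: "end_iso (M l0) L (s \<circ> g)" using supported_end_iso[OF sgK] by (simp add: L_def)
  have regL: "clopen_Y L" unfolding L_def by (intro supported_clopen_Y[OF sgK order_refl] clopen_Y_M)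
  have La: "L \<subseteq> M a" "L \<inter> M l2 = {}" using sg by (auto simp: L_def)
  have "\<exists>k\<in>supported (M a). \<forall>p\<in>L. k p = inv_into (M l0) (s \<circ> g) p"
  proof (rule extend_end_iso[OF clopen_Y_M regL La(1) clopen_Y_M M0(1) end_iso_inv[OF iso1]])
    show "full (M a - L)" by (rule full_mono[OF full_M[OF inf(3)]]) (use M0 La in \<open>auto intro: clopen_Y_Diff clopen_Y_M regL\<close>)
    show "full (M a - M l0)" by (rule full_mono[OF full_M[OF inf(3)]]) (use M0 Mdisj in \<open>auto intro: clopen_Y_Diff clopen_Y_M\<close>)
  qed
  then obtain k where k: "k \<in> supported (M a)" "\<forall>p\<in>L. k p = inv_into (M l0) (s \<circ> g) p" by blast
  define h where "h = k \<circ> (s \<circ> g)"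
  have h_fix: "h p = p" if "p \<in> M l0" for p
    using k(2) that end_isoD(3)[OF iso1] by (simp add: h_def L_def inv_into_f_f del: comp_apply) (simp add: comp_def)
  have hT: "h \<in> supported (M (a \<union> b) - M l0)"
  proof -
    have "h \<in> supported (M (a \<union> b))" unfolding h_def
      using k(1) sb g supported_mono[OF M_mono[of a "a \<union> b"]] supported_mono[OF M_mono[of b "a \<union> b"]] by (intro supported_comp) auto
    then show ?thesis using h_fix unfolding supported_def by auto
  qed
  have Mba: "M (b - a) \<subseteq> M b" by (intro M_mono) auto
  \<comment> \<open>Spread \<open>M l0\<close> over everything in \<open>M b\<close> that lies outside \<open>M a\<close>.\<close>
  have full_int: "full (M l0 \<union> M (b - a))"
    by (rule full_mono[OF full_M[OF inf(1)]]) (auto intro: clopen_Y_Un clopen_Y_M)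
  obtain q where q: "end_iso (M l0) (M l0 \<union> M (b - a)) q"
    using full_end_iso[OF full_M[OF inf(1)] full_int] by blast
  have "\<exists>t\<in>supported (M b). \<forall>p\<in>M l0. t p = q p"
  proof (rule extend_end_iso[OF clopen_Y_M clopen_Y_M M0(2) full_clopen_Y[OF full_int] _ q])
    show "M l0 \<union> M (b - a) \<subseteq> M b" using M0 Mba by blast
    show "full (M b - M l0)" by (rule full_mono[OF full_M[OF inf(3)]]) (use M0 Mdisj in \<open>auto intro: clopen_Y_Diff clopen_Y_M\<close>)
    show "full (M b - (M l0 \<union> M (b - a)))"
      by (rule full_mono[OF full_M[OF inf(3)]])
        (use M0 Mdisj in \<open>auto intro: clopen_Y_Diff clopen_Y_Un clopen_Y_M\<close>)
  qed
  then obtain t where t: "t \<in> supported (M b)" "\<forall>p\<in>M l0. t p = q p" by blast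
  have tl0: "t ` M l0 = M l0 \<union> M (b - a)" using t(2) end_isoD(2)[OF q] by (metis image_cong)
  have bt: "bij t" "bij s" "bij k" using supportedD(2) t(1) sb k(1) by auto
  have "t \<circ> h \<circ> invf t \<in> supported (t ` (M (a \<union> b) - M l0))" by (rule supported_conj[OF t(1) hT])
  moreover have "t ` (M (a \<union> b) - M l0) \<subseteq> M a"
  proof -
    have "t ` (M (a \<union> b) - M l0) = t ` M (a \<union> b) - t ` M l0" using bt by (simp add: image_set_diff bij_is_inj)
    also have "t ` M (a \<union> b) = M (a \<union> b)" by (rule supported_image[OF t(1)], rule M_mono) auto
    finally show ?thesis using tl0 M_Un[of a "b - a"] by auto
  qed
  ultimately have m: "t \<circ> h \<circ> invf t \<in> supported (M a)" using supported_mono by blast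
  have "g = invf s \<circ> invf k \<circ> invf t \<circ> (t \<circ> h \<circ> invf t) \<circ> invf (invf t)"
    using bt by (simp add: fun_eq_iff h_def inv_inv_eq bij_inv_cancel)
  then show thesis using that[OF supported_inv[OF sb] supported_inv[OF k(1)] supported_inv[OF t(1)] m] by blast
qed

end

section \<open>Groups of supported homeomorphisms inside products\<close>

locale coloured_pieces = coloured_group S C W c + pieces S C F V E
  for S :: "'a set" and C W c F V E
begin

text \<open>Otherwise choose for every \<open>i\<close> a homeomorphism of \<open>M (P i)\<close> that no element of colour \<open>i\<close> extends. They
have a common extension, and its colour gives a contradiction. Having found \<open>i\<close>, divide an extension
of \<open>h\<close> by an extension of the identity that has the same colour.\<close>

lemma colour_diagonal:
  assumes P: "disjoint_family (P :: nat \<Rightarrow> nat set)" "(\<Union>i. P i) \<subseteq> l"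
  shows "\<exists>i. \<forall>h\<in>supported (M (P i)). \<exists>w\<in>W \<inter> supported (M l). \<forall>p\<in>M (P i). w p = h p"
proof -
  define ok where "ok i h \<longleftrightarrow> (\<exists>k\<in>supported (M l). c k = i \<and> (\<forall>p\<in>M (P i). k p = h p))" for i h
  have "\<exists>i. \<forall>h\<in>supported (M (P i)). ok i h"
  proof (rule ccontr)
    assume "\<not> ?thesis"
    then have "\<forall>i. \<exists>h. h \<in> supported (M (P i)) \<and> \<not> ok i h" by blast
    from choice[OF this] obtain h where h: "\<forall>i. h i \<in> supported (M (P i)) \<and> \<not> ok i (h i)" by (elim exE)
    then obtain k where k: "k \<in> supported (M (\<Union>i. P i))" "\<forall>i. \<forall>p\<in>M (P i). k p = h i p"
      using supported_M_glue[of h P] P(1) by blast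
    have "k \<in> supported (M l)" using k(1) supported_mono[OF M_mono[OF P(2)]] by blast
    then have "ok (c k) (h (c k))" unfolding ok_def using k(2) by blast
    then show False using h by blast
  qed
  then obtain i where i: "\<exists>k\<in>supported (M l). c k = i \<and> (\<forall>p\<in>M (P i). k p = h p)" if "h \<in> supported (M (P i))" for h
    unfolding ok_def by blast
  obtain k0 where k0: "k0 \<in> supported (M l)" "c k0 = i" "\<forall>p\<in>M (P i). k0 p = id p" using i[OF supported_id] by blast
  have "\<exists>w\<in>W \<inter> supported (M l). \<forall>p\<in>M (P i). w p = h p" if h: "h \<in> supported (M (P i))" for h
  proof -
    obtain k where k: "k \<in> supported (M l)" "c k = i" "\<forall>p\<in>M (P i). k p = h p" using i[OF h] by blast
    have "invf k0 \<circ> k \<in> W" using same_colour[OF supportedD(1)[OF k0(1)] supportedD(1)[OF k(1)]] k0 k by simp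
    moreover have "invf k0 \<circ> k \<in> supported (M l)" by (intro supported_comp supported_inv k0 k)
    moreover have "(invf k0 \<circ> k) p = h p" if p: "p \<in> M (P i)" for p
    proof -
      have "h p \<in> M (P i)" using supported_in[OF h order_refl] p by simp
      then have "k0 (h p) = h p" using k0(3) by simp
      then have "invf k0 (h p) = h p" using supportedD(2)[OF k0(1)] by (metis bij_inv_cancel(2))
      then show ?thesis using k(3) p by simp
    qed
    ultimately show ?thesis by blast
  qed
  then show ?thesis by blast
qed

text \<open>Apply colour_diagonal twice, obtaining nested sets \<open>P' j\<close> and \<open>P i\<close>. Let \<open>u\<close> in \<open>W\<close> extend \<open>a\<close> and be
supported in \<open>M (P i)\<close>, and let \<open>v\<close> in \<open>W\<close> extend \<open>b\<close> and be the identity on the rest of \<open>M (P i)\<close>. Then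
\<open>u\<close> and \<open>v\<close> interact on \<open>M (P' j)\<close> only, so that their commutator is that of \<open>a\<close> and \<open>b\<close>.\<close>

lemma commutators_in_products:
  "\<exists>l. infinite l \<and> (\<forall>a\<in>supported (M l). \<forall>b\<in>supported (M l). a \<circ> b \<circ> invf a \<circ> invf b \<in> products 4)"
proof -
  obtain P :: "nat \<Rightarrow> nat set" where P: "disjoint_family P" "\<And>i. infinite (P i)" "(\<Union>i. P i) = UNIV"
    using infinite_nat_partition[OF infinite_UNIV_nat] by metis
  obtain i where i: "\<forall>h\<in>supported (M (P i)). \<exists>w\<in>W \<inter> supported (M UNIV). \<forall>p\<in>M (P i). w p = h p"
    using colour_diagonal[of P UNIV] P by auto
  obtain P' :: "nat \<Rightarrow> nat set" where P': "disjoint_family P'" "\<And>j. infinite (P' j)" "(\<Union>j. P' j) = P i"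
    using infinite_nat_partition[OF P(2)] by metis
  obtain j where j: "\<forall>h\<in>supported (M (P' j)). \<exists>w\<in>W \<inter> supported (M (P i)). \<forall>p\<in>M (P' j). w p = h p"
    using colour_diagonal[of P' "P i"] P' by auto
  have sub: "M (P' j) \<subseteq> M (P i)" using P'(3) by (intro M_mono) auto
  have "a \<circ> b \<circ> invf a \<circ> invf b \<in> products 4" if a: "a \<in> supported (M (P' j))" and b: "b \<in> supported (M (P' j))" for a b
  proof -
    let ?T = "M (P' j)"
    obtain u where u: "u \<in> W" "u \<in> supported (M (P i))" "\<And>p. p \<in> ?T \<Longrightarrow> u p = a p" using j a by blast
    have "b \<in> supported (M (P i))" using b supported_mono[OF sub] by blast
    then obtain v where v: "v \<in> W" "v \<in> supported (M UNIV)" "\<And>p. p \<in> M (P i) \<Longrightarrow> v p = b p" using i by blast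
    have bij: "bij u" "bij v" "bij a" "bij b" using supportedD(2) u v a b by blast+
    have uT: "u ` ?T = ?T" using u(3) supported_image[OF a order_refl] by (metis image_cong)
    have vS: "v ` M (P i) = M (P i)"
      using v(3) supported_image[OF b sub] by (metis image_cong)
    let ?k = "a \<circ> b \<circ> invf a \<circ> invf b"
    have kT: "?k \<in> supported ?T" using a b by (intro supported_comp supported_inv)
    have "u (v p) = ?k (v (u p))" for p
    proof -
      consider "p \<in> ?T" | "p \<in> M (P i)" "p \<notin> ?T" | "p \<notin> M (P i)" using sub by blast
      then show ?thesis
      proof cases
        case 1
        then have "a p \<in> ?T" "b p \<in> ?T" using supported_in[OF a order_refl] supported_in[OF b order_refl] by auto
        then show ?thesis using 1 u(3) v(3) sub bij by (simp add: bij_inv_cancel subset_iff)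
      next
        case 2
        have "u p \<in> M (P i)" using supported_in[OF u(2) order_refl] 2 by simp
        moreover have "u p \<notin> ?T" using uT 2 bij(1) by (metis bij_inv_cancel(2) image_iff)
        moreover have "b p = p" "b (u p) = u p" using supportedD(3)[OF b] 2 calculation by auto
        ultimately show ?thesis using v(3) 2 supportedD(3)[OF kT] by auto
      next
        case 3
        have "v p \<notin> M (P i)" using vS 3 bij(2) by (metis bij_inv_cancel(2) image_iff)
        then have "?k (v p) = v p" using supportedD(3)[OF kT] sub by blast
        moreover have "u (v p) = v p" "u p = p" using supportedD(3)[OF u(2)] 3 \<open>v p \<notin> M (P i)\<close> by auto
        ultimately show ?thesis by (simp only:)
      qed
    qed
    then have "u \<circ> v \<circ> invf u \<circ> invf v = ?k \<circ> (v \<circ> u) \<circ> invf u \<circ> invf v" by (simp add: fun_eq_iff)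
    also have "\<dots> = ?k" using bij by (simp add: fun_eq_iff bij_inv_cancel)
    finally have eq: "?k = u \<circ> v \<circ> invf u \<circ> invf v" by simp
    have "u \<circ> v \<circ> invf u \<circ> invf v \<in> products (1 + 1 + 1 + 1)"
      by (intro products_comp products_1 u v W_inv)
    then show ?thesis unfolding eq by (simp add: numeral_eq_Suc del: products.simps)
  qed
  then show ?thesis using P'(2) by blast
qed

end

context pieces begin

text \<open>Partition \<open>l\<close> into infinite sets \<open>P i\<close>. Let \<open>t\<close> map \<open>M (P i)\<close> to \<open>M (P (Suc i))\<close> for \<open>i > 0\<close> and \<open>M (P 0)\<close> to
\<open>M (P 0 \<union> P 1)\<close>, which exists since all these sets are full, and let \<open>a\<close> act on the \<open>M (P (Suc n))\<close> as the
conjugate of \<open>g\<close> by the \<open>n\<close>-th power of \<open>t\<close>. Conjugating \<open>a\<close> by \<open>t\<close> removes the first of these copies of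
\<open>g\<close>, so \<open>g\<close> is the commutator of \<open>a\<close> and \<open>t\<close>.\<close>

lemma commutator_swindle:
  assumes "infinite l"
  obtains l' where "l' \<subseteq> l" "infinite l'" "infinite (- l')"
    "\<And>g. g \<in> supported (M l') \<Longrightarrow> \<exists>a\<in>supported (M l). \<exists>b\<in>supported (M l). g = a \<circ> b \<circ> invf a \<circ> invf b"
proof -
  obtain P :: "nat \<Rightarrow> nat set" where P: "disjoint_family P" "\<And>i. infinite (P i)" "(\<Union>i. P i) = l"
    using infinite_nat_partition[OF assms] by metis
  have Pd: "i \<noteq> j \<Longrightarrow> P i \<inter> P j = {}" for i j using P(1) by (auto simp: disjoint_family_on_def)
  define P' where "P' i = (if i = 0 then P 0 \<union> P 1 else P (Suc i))" for i
  have P': "disjoint_family P'" "(\<Union>i. P' i) = l"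
  proof -
    have "P' i \<inter> P' j = {}" if "i < j" for i j
      using that Pd[of 0 "Suc j"] Pd[of 1 "Suc j"] Pd[of "Suc i" "Suc j"] by (auto simp: P'_def)
    then show "disjoint_family P'"
      unfolding disjoint_family_on_def by (metis Int_commute nat_neq_iff)
    have "P' i \<subseteq> l" for i using P(3) by (auto simp: P'_def)
    moreover have "P i \<subseteq> (\<Union>j. P' j)" for i
    proof -
      consider "i = 0" | "i = 1" | j where "i = Suc (Suc j)" by (metis One_nat_def not0_implies_Suc)
      then show ?thesis
      proof cases
        case 3 then have "P i = P' (Suc j)" by (simp add: P'_def)
        then show ?thesis by blast
      qed (auto simp: P'_def intro!: exI[of _ "0 :: nat"])
    qed
    ultimately show "(\<Union>i. P' i) = l" using P(3) by blast
  qed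
  have "\<exists>f. end_iso (M (P i)) (M (P' i)) f" for i
    by (rule full_end_iso) (use P(2) in \<open>auto intro!: full_M simp: P'_def\<close>)
  then obtain f where f: "\<And>i. end_iso (M (P i)) (M (P' i)) (f i)" by metis
  obtain t0 where t0: "end_iso (M l) (M l) t0" "\<forall>i. \<forall>p\<in>M (P i). t0 p = f i p"
    using end_iso_M_glue[OF f P(1) P'(1)] P(3) P'(2) by auto
  define t where "t = ext_id (M l) t0"
  have Pl: "M (P i) \<subseteq> M l" for i using P(3) by (intro M_mono) auto
  have tK: "t \<in> supported (M l)" unfolding t_def by (rule ext_id_supported[OF clopen_Y_M t0(1)])
  have tP: "t ` M (P i) = M (P' i)" for i
  proof -
    have "t p = f i p" if "p \<in> M (P i)" for p using that t0(2) Pl[of i] by (auto simp: t_def)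
    then have "t ` M (P i) = f i ` M (P i)" by (rule image_cong[OF refl])
    then show ?thesis using end_isoD(2)[OF f] by simp
  qed
  have bt: "bij t" using supportedD(2)[OF tK] .
  have tn: "(t ^^ n) ` M (P 1) = M (P (Suc n))" for n
  proof (induction n)
    case (Suc n)
    have "(t ^^ Suc n) ` M (P 1) = t ` (t ^^ n) ` M (P 1)" by (simp add: image_comp)
    then show ?case using Suc tP[of "Suc n"] by (simp add: P'_def)
  qed simp
  show thesis
  proof (rule that[of "P 1"])
    show "P 1 \<subseteq> l" "infinite (P 1)" using P by auto
    show "infinite (- P 1)" using P(2)[of 0] Pd[of 0 1] by (meson finite_subset disjoint_eq_subset_Compl zero_neq_one)
    fix g assume g: "g \<in> supported (M (P 1))"
    define h where "h i = (if i = 0 then id else (t ^^ (i - 1)) \<circ> g \<circ> invf (t ^^ (i - 1)))" for i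
    have "h i \<in> supported (M (P i))" for i
    proof (cases i)
      case 0 then show ?thesis by (simp add: h_def supported_id)
    next
      case (Suc n)
      then show ?thesis using supported_conj[OF supported_funpow[OF tK] g, of n] tn[of n] by (simp add: h_def)
    qed
    then obtain a where a: "a \<in> supported (M l)" "\<forall>i. \<forall>p\<in>M (P i). a p = h i p"
      using supported_M_glue[of h P] P by auto
    have eq: "a (t p) = g (t (a p))" for p
    proof (cases "p \<in> M l")
      case False
      then have "p \<notin> M (P 1)" using Pl by blast
      then show ?thesis using supportedD(3)[OF a(1) False] supportedD(3)[OF tK False] supportedD(3)[OF g] by simp
    next
      case True
      then obtain i where i: "p \<in> M (P i)" using P(3) M_UN[of P UNIV] by auto
      show ?thesis
      proof (cases i)
        case 0
        have "t p \<in> M (P 0) \<union> M (P 1)" using tP[of 0] i 0 by (auto simp: P'_def M_Un)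
        moreover have "g q = q" if "q \<in> M (P 0)" for q
          using supportedD(3)[OF g] that M_disjoint[OF Pd[of 0 1]] by auto
        moreover have "a p = p" using a(2) i 0 by (simp add: h_def)
        ultimately show ?thesis using a(2) by (auto simp: h_def)
      next
        case (Suc n)
        have "t p \<in> M (P (Suc (Suc n)))" using tP[of i] i Suc by (auto simp: P'_def)
        then have "a (t p) = ((t ^^ Suc n) \<circ> g \<circ> invf (t ^^ Suc n)) (t p)" using a(2) by (simp add: h_def del: funpow.simps)
        also have "invf (t ^^ Suc n) (t p) = invf (t ^^ n) p"
        proof -
          have "bij (t ^^ n)" using bt by (rule bij_betw_funpow)
          then have "invf (t ^^ Suc n) = invf (t ^^ n) \<circ> invf t"
            using bt o_inv_distrib[of t "t ^^ n"] by (simp add: o_inv_distrib)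
          then show ?thesis using bt by (simp add: bij_inv_cancel)
        qed
        then have "((t ^^ Suc n) \<circ> g \<circ> invf (t ^^ Suc n)) (t p) = t (((t ^^ n) \<circ> g \<circ> invf (t ^^ n)) p)" by simp
        also have "((t ^^ n) \<circ> g \<circ> invf (t ^^ n)) p = a p" using a(2) i Suc by (simp add: h_def)
        finally have 1: "a (t p) = t (a p)" .
        have "t (a p) \<in> M (P (Suc (Suc n)))" using 1 \<open>t p \<in> M (P (Suc (Suc n)))\<close> a(2)
          \<open>\<And>i. h i \<in> supported (M (P i))\<close> supported_in[OF _ order_refl] by metis
        then have "g (t (a p)) = t (a p)"
          using supportedD(3)[OF g] M_disjoint[OF Pd[of "Suc (Suc n)" 1]] by auto
        then show ?thesis using 1 by simp
      qed
    qed
    have ba: "bij a" using supportedD(2)[OF a(1)] .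
    have "g = a \<circ> t \<circ> invf a \<circ> invf t"
    proof
      fix p
      have "(a \<circ> t \<circ> invf a \<circ> invf t) p = g (t (a (invf a (invf t p))))" using eq by simp
      then show "g p = (a \<circ> t \<circ> invf a \<circ> invf t) p" using ba bt by (simp add: bij_inv_cancel)
    qed
    then show "\<exists>a\<in>supported (M l). \<exists>b\<in>supported (M l). g = a \<circ> b \<circ> invf a \<circ> invf b" using a(1) tK by blast
  qed
qed

end

context coloured_pieces begin

text \<open>Let \<open>M r\<close> be a set whose homeomorphisms lie in \<open>products 4\<close>. For every member \<open>B s\<close> of an almost disjoint
family let \<open>t s\<close> move \<open>M r\<close> to the complement of \<open>M (B s)\<close>. Two of the uncountably many \<open>t s\<close> have the same
colour, so their quotient \<open>u\<close> lies in \<open>W\<close>. After conjugation by \<open>t s\<close>, the sets \<open>M r\<close> and \<open>u ` M r\<close>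
become \<open>M a\<close> and \<open>M b\<close> with \<open>a \<union> b\<close> cofinite and \<open>a \<inter> b\<close> infinite, and
factor_through_two_halves applies.\<close>

theorem supported_cofinite_in_products: "\<exists>D. compact_open D \<and> supported (Y - D) \<subseteq> products 26"
proof -
  obtain l where l: "infinite l" "\<And>a b. a \<in> supported (M l) \<Longrightarrow> b \<in> supported (M l) \<Longrightarrow> a \<circ> b \<circ> invf a \<circ> invf b \<in> products 4"
    using commutators_in_products by blast
  obtain r where r: "r \<subseteq> l" "infinite r" "infinite (- r)"
    "\<And>g. g \<in> supported (M r) \<Longrightarrow> \<exists>a\<in>supported (M l). \<exists>b\<in>supported (M l). g = a \<circ> b \<circ> invf a \<circ> invf b"
    using commutator_swindle[OF l(1)] by blast
  have Kr: "supported (M r) \<subseteq> products 4" using l(2) r(4) by blast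
  obtain B :: "nat set \<Rightarrow> nat set" where B: "\<And>s. infinite (B s)" "\<And>s t. s \<noteq> t \<Longrightarrow> finite (B s \<inter> B t)"
    "\<And>s t. infinite (- (B s \<union> B t))" using almost_disjoint_family by blast
  have "\<exists>t\<in>supported Y. t ` M r = M (- B s)" for s
  proof -
    have inf: "infinite (- B s)" using B(3)[of s s] by simp
    obtain f where f: "end_iso (M r) (M (- B s)) f" using full_end_iso[OF full_M[OF r(2)] full_M[OF inf]] by blast
    have Y: "Y - M (- B s) = M (B s)" using M_Compl[of "- B s"] by simp
    have "\<exists>t\<in>supported Y. \<forall>p\<in>M r. t p = f p"
      by (rule extend_end_iso[OF clopen_Y_Y clopen_Y_M M_Y clopen_Y_M M_Y f])
        (use full_M r(3) B(1) in \<open>auto simp: Y M_Compl[symmetric]\<close>)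
    then show ?thesis using end_isoD(2)[OF f] by (metis image_cong)
  qed
  then obtain t where t: "\<And>s. t s \<in> supported Y" "\<And>s. t s ` M r = M (- B s)" by metis
  have "\<not> inj (\<lambda>s. c (t s))"
  proof
    assume "inj (\<lambda>s :: nat set. c (t s))"
    then obtain e :: "nat \<Rightarrow> nat set" where "\<forall>s. \<exists>n. e n = s" by (metis inv_f_f)
    then have "surj e" by (metis surj_def)
    then have "e ` UNIV = Pow UNIV" by simp
    then show False using Cantors_theorem[of "UNIV :: nat set"] by blast
  qed
  then obtain s s' where ss': "s \<noteq> s'" "c (t s) = c (t s')" by (auto simp: inj_def)
  define u where "u = invf (t s) \<circ> t s'"
  have u: "u \<in> W" unfolding u_def using same_colour supportedD(1) t(1) ss'(2) by blast
  define a b where "a = - B s" and "b = - B s'"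
  have bij: "bij (t s)" "bij (t s')" using supportedD(2)[OF t(1)] by auto
  have conj_a: "invf (t s) \<circ> k \<circ> t s \<in> products 4" if "k \<in> supported (M a)" for k
  proof -
    have "invf (t s) \<circ> k \<circ> invf (invf (t s)) \<in> supported (invf (t s) ` M a)" by (rule supported_conj[OF supported_inv[OF t(1)] that])
    moreover have "invf (t s) ` M a = M r" using t(2)[of s] bij(1) by (simp add: a_def image_inv_f_f bij_is_inj flip: t(2))
    ultimately show ?thesis using Kr bij by (auto simp: inv_inv_eq)
  qed
  have conj_b: "invf (t s) \<circ> k \<circ> t s \<in> products 6" if "k \<in> supported (M b)" for k
  proof -
    have "invf (t s') \<circ> k \<circ> invf (invf (t s')) \<in> supported (invf (t s') ` M b)" by (rule supported_conj[OF supported_inv[OF t(1)] that])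
    moreover have "invf (t s') ` M b = M r" using bij(2) by (simp add: b_def image_inv_f_f bij_is_inj flip: t(2))
    ultimately have "invf (t s') \<circ> k \<circ> t s' \<in> products 4" using Kr bij by (auto simp: inv_inv_eq)
    then have "u \<circ> (invf (t s') \<circ> k \<circ> t s') \<circ> invf u \<in> products (1 + 4 + 1)"
      by (intro products_comp products_1 u W_inv)
    moreover have "u \<circ> (invf (t s') \<circ> k \<circ> t s') \<circ> invf u = invf (t s) \<circ> k \<circ> t s"
    proof -
      have "invf u = invf (t s') \<circ> t s" unfolding u_def
        using bij by (simp add: o_inv_distrib bij_imp_bij_inv inv_inv_eq)
      then show ?thesis using bij by (simp add: u_def fun_eq_iff bij_inv_cancel)
    qed
    ultimately show ?thesis by simp
  qed
  define D where "D = invf (t s) ` M (- (a \<union> b))"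
  have "finite (- (a \<union> b))" using B(2)[OF ss'(1)] by (simp add: a_def b_def)
  then have D: "compact_open D" unfolding D_def by (intro supported_compact_open[OF supported_inv[OF t(1)] order_refl] compact_open_M)
  have ab: "infinite (a \<inter> b)" using B(3)[of s s'] by (simp add: a_def b_def)
  have tD: "t s ` (Y - D) = M (a \<union> b)"
  proof -
    have "t s ` (Y - D) = t s ` Y - t s ` D" using bij by (simp add: image_set_diff bij_is_inj)
    also have "\<dots> = Y - M (- (a \<union> b))" using supported_image[OF t(1) order_refl] bij
      by (simp add: D_def image_f_inv_f bij_is_surj)
    also have "\<dots> = M (a \<union> b)" using M_Compl[of "- (a \<union> b)"] by simp
    finally show ?thesis .
  qed
  have "g \<in> products 26" if g: "g \<in> supported (Y - D)" for g
  proof -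
    have "t s \<circ> g \<circ> invf (t s) \<in> supported (M (a \<union> b))" using supported_conj[OF t(1)[of s] g] tD by simp
    then obtain k1 k2 q m where k: "k1 \<in> supported (M b)" "k2 \<in> supported (M a)" "q \<in> supported (M b)" "m \<in> supported (M a)"
      "t s \<circ> g \<circ> invf (t s) = k1 \<circ> k2 \<circ> q \<circ> m \<circ> invf q"
      using factor_through_two_halves[OF ab] by metis
    let ?j = "\<lambda>k. invf (t s) \<circ> k \<circ> t s"
    have "g = ?j (t s \<circ> g \<circ> invf (t s))" using bij by (simp add: fun_eq_iff bij_inv_cancel)
    also have "\<dots> = ?j k1 \<circ> ?j k2 \<circ> ?j q \<circ> ?j m \<circ> ?j (invf q)"
      unfolding k(5) using bij by (simp add: fun_eq_iff bij_inv_cancel)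
    also have "\<dots> \<in> products (6 + 4 + 6 + 4 + 6)"
      by (intro products_comp conj_a conj_b k supported_inv)
    finally show ?thesis by simp
  qed
  then show ?thesis using D by blast
qed

end

section \<open>From the ends to the whole space\<close>

context clopen_algebra begin

lemma Aut_glue:
  assumes F: "finite F" and T: "\<And>x. x \<in> F \<Longrightarrow> T x \<in> C" "disjoint_family_on T F"
    and k: "\<And>x. x \<in> F \<Longrightarrow> k x \<in> Aut" "\<And>x. x \<in> F \<Longrightarrow> k x ` T x = T x"
  shows "\<exists>h\<in>Aut. (\<forall>x\<in>F. \<forall>p\<in>T x. h p = k x p) \<and> (\<forall>p. p \<notin> (\<Union>x\<in>F. T x) \<longrightarrow> h p = p)"
proof -
  have iso: "clopen_iso (T x) (T x) (k x)" if "x \<in> F" for x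
    using Aut_clopen_iso[OF k(1)[OF that], of "T x"] k(2)[OF that] by simp
  obtain h where h: "clopen_iso (\<Union>x\<in>F. T x) (\<Union>x\<in>F. T x) h" "\<forall>x\<in>F. \<forall>p\<in>T x. h p = k x p"
    using clopen_iso_glue[OF iso T(2,2) loc_fin_finite[OF F T(1)] loc_fin_finite[OF F T(1)]] by blast
  have "(\<Union>x\<in>F. T x) \<in> C" using F T(1) by (rule C_UN)
  then have "ext_id (\<Union>x\<in>F. T x) h \<in> Aut" using ext_id_Aut h(1) by blast
  then show ?thesis using h(2) by (intro bexI[of _ "ext_id (\<Union>x\<in>F. T x) h"]) (auto simp: ext_id_def)
qed

text \<open>Exchange a small neighbourhood of \<open>a\<close> with its image under \<open>e\<close>.\<close>

lemma transport_within:
  assumes T: "T \<in> C" "x \<in> T" and ab: "a \<in> T" "b \<in> T" "a \<noteq> x" "b \<noteq> x"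
    and e: "e \<in> Aut" "e ` T = T" "e a = b"
  shows "\<exists>k\<in>Aut. (\<forall>p. p \<notin> T \<or> p = x \<longrightarrow> k p = p) \<and> k a = b"
proof (cases "a = b")
  case True then show ?thesis using Aut_id by (intro bexI[of _ id]) auto
next
  case False
  have S: "a \<in> S" "b \<in> S" "x \<in> S" using T ab C_subset by blast+
  obtain A0 where A0: "A0 \<in> C" "a \<in> A0" "b \<notin> A0" using separation[OF S(1,2) False] by blast
  obtain A1 where A1: "A1 \<in> C" "a \<in> A1" "x \<notin> A1" using separation[OF S(1,3) ab(3)] by blast
  obtain A2 where A2: "A2 \<in> C" "b \<in> A2" "x \<notin> A2" using separation[OF S(2,3) ab(4)] by blast
  have be: "bij e" using AutD(1)[OF e(1)] .
  define A where "A = T \<inter> A0 \<inter> A1 \<inter> invf e ` (A2 - A0)"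
  have AC: "A \<in> C" unfolding A_def
    using T A0 A1 A2 AutD(3)[OF Aut_inv[OF e(1)]] by (intro C_Int) (auto intro: C_Diff)
  have eA: "e p \<in> A2 - A0" if "p \<in> A" for p
    using that be by (auto simp: A_def bij_inv_cancel)
  have "a \<in> A"
    using e(3) A0 A1 A2 ab be by (auto simp: A_def image_iff intro!: bexI[of _ b]) (metis bij_inv_cancel(2))
  have disj: "A \<inter> e ` A = {}" using eA by (auto simp: A_def)
  have sub: "A \<subseteq> T - {x}" "e ` A \<subseteq> T - {x}" using e(2) A1 A2 eA by (auto simp: A_def)
  have iso: "clopen_iso A (e ` A) e" using Aut_clopen_iso[OF e(1)] .
  have eAC: "e ` A \<in> C" using AutD(3)[OF e(1)] AC by simp
  have "clopen_iso (A \<union> e ` A) (A \<union> e ` A) (swap_map A (e ` A) e)"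
    by (rule clopen_iso_swap_map[OF iso disj]) (auto intro: C_Int AC eAC)
  then have "ext_id (A \<union> e ` A) (swap_map A (e ` A) e) \<in> Aut" using ext_id_Aut AC eAC C_Un by blast
  moreover have "ext_id (A \<union> e ` A) (swap_map A (e ` A) e) a = b"
    using \<open>a \<in> A\<close> e(3) by (simp add: swap_map_def)
  moreover have "ext_id (A \<union> e ` A) (swap_map A (e ` A) e) p = p" if "p \<notin> T \<or> p = x" for p
    using that sub by (intro ext_id_simps) blast
  ultimately show ?thesis by blast
qed

lemma Aut_preserves_support:
  assumes "k \<in> Aut" "\<And>p. p \<notin> T \<Longrightarrow> k p = p"
  shows "k ` T = T"
proof -
  have "k p \<in> T \<longleftrightarrow> p \<in> T" for p
    using assms(2) AutD(1)[OF assms(1)] by (metis bij_inv_cancel(2))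
  then show ?thesis using AutD(1)[OF assms(1)] by (auto simp: image_iff) (metis bij_inv_cancel(1))
qed

lemma Aut_image_iff: "g \<in> Aut \<Longrightarrow> g ` T = T \<Longrightarrow> g p \<in> T \<longleftrightarrow> p \<in> T"
  using AutD(1) by (metis bij_inv_cancel(2) image_iff)

end

locale coloured_ends = coloured_group S C W c + ends S C F V for S :: "'a set" and C W c F V
begin

lemma ends_supported_in_products: "\<exists>D. compact_open D \<and> supported (Y - D) \<subseteq> products 26"
proof -
  obtain E where E: "\<forall>i. compact_open (E i)" "disjoint_family E" "(\<Union>i :: nat. E i) = Y"
     "\<forall>B. compact_open B \<longrightarrow> finite {i. B \<inter> E i \<noteq> {}}"
     "\<forall>l. infinite l \<longrightarrow> (\<forall>B D. compact_open B \<longrightarrow> compact_open D \<longrightarrow> (\<exists>e. end_iso B (e ` B) e \<and> e ` B \<subseteq> (\<Union>i\<in>l. E i) - D))"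
    using ex_pieces by (elim exE conjE)
  interpret coloured_pieces S C W c F V E
    by unfold_locales (use E in simp_all)
  show ?thesis by (rule supported_cofinite_in_products)
qed

text \<open>A pointwise criterion; the sets \<open>V x - D\<close> are the neighbourhoods of the ends on which one has to check that
nothing is moved from one end to another.\<close>

lemma supported_cofinite_I:
  assumes "g \<in> Aut" "\<And>p. g p \<noteq> p \<Longrightarrow> \<exists>x\<in>F. p \<noteq> x \<and> p \<in> V x - D \<and> g p \<in> V x"
  shows "g \<in> supported (Y - D)"
  unfolding supported_def
proof (intro CollectI conjI allI impI ballI assms(1))
  fix p assume p: "p \<notin> Y - D"
  show "g p = p"
  proof (rule ccontr)
    assume "g p \<noteq> p"
    then obtain x where "x \<in> F" "p \<noteq> x" "p \<in> V x - D" using assms(2) by blast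
    then show False using p V_F by (auto simp: Y_def)
  qed
next
  fix p y assume y: "y \<in> F"
  show "g p \<in> V y \<longleftrightarrow> p \<in> V y"
  proof (cases "g p = p")
    case False
    then obtain x where "x \<in> F" "p \<in> V x" "g p \<in> V x" using assms(2) by blast
    then show ?thesis using V_disjoint[OF y] by blast
  qed simp
qed

end

text \<open>The sets \<open>V x\<close> are disjoint but need not cover, the sets \<open>U x\<close> cover but need not be disjoint. Density of
\<open>W\<close> near the identity is expressed through the finite set \<open>R\<close>.\<close>

locale dense_cover = coloured_ends S C W c F V for S :: "'a set" and C W c F V +
  fixes R :: "'a set set" and U :: "'a \<Rightarrow> 'a set"
  assumes approx_R: "h \<in> Aut \<Longrightarrow> \<forall>r\<in>R. h ` r = r \<Longrightarrow> finite R' \<Longrightarrow> R' \<subseteq> C \<Longrightarrow> \<exists>w\<in>W. \<forall>r\<in>R'. w ` r = h ` r"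
    and U_stable: "x \<in> F \<Longrightarrow> stable x (U x)"
    and V_U: "x \<in> F \<Longrightarrow> V x \<subseteq> U x"
    and U_cover: "(\<Union>x\<in>F. U x) = S"
    and U_R: "x \<in> F \<Longrightarrow> r \<in> R \<Longrightarrow> U x \<subseteq> r \<or> U x \<inter> r = {}"
begin

text \<open>Moving points only within the sets \<open>U x\<close> preserves the members of \<open>R\<close>, so density applies.\<close>

lemma approx:
  assumes h: "h \<in> Aut" "\<And>p. h p \<noteq> p \<Longrightarrow> \<exists>x\<in>F. p \<in> U x \<and> h p \<in> U x" and R': "finite R'" "R' \<subseteq> C"
  shows "\<exists>w\<in>W. \<forall>r\<in>R'. w ` r = h ` r"
proof (rule approx_R[OF h(1) _ R'], rule ballI)
  fix r assume r: "r \<in> R"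
  have iff: "h p \<in> r \<longleftrightarrow> p \<in> r" for p
  proof (cases "h p = p")
    case False
    then obtain x where "x \<in> F" "p \<in> U x" "h p \<in> U x" using h(2) by blast
    then show ?thesis using U_R[OF _ r, of x] by blast
  qed simp
  show "h ` r = r"
  proof
    show "h ` r \<subseteq> r" using iff by blast
    show "r \<subseteq> h ` r"
    proof
      fix q assume "q \<in> r"
      then have "invf h q \<in> r" using iff[of "invf h q"] AutD(1)[OF h(1)] by (simp add: bij_inv_cancel)
      then show "q \<in> h ` r" using AutD(1)[OF h(1)] by (metis bij_inv_cancel(1) imageI)
    qed
  qed
qed

text \<open>Let \<open>V' x = V x - D\<close>, where homeomorphisms supported in the complement of \<open>D\<close> in \<open>Y\<close> are products of
26 elements of \<open>W\<close>. Divide the rest \<open>O'\<close> of the space into sets \<open>T x\<close> contained in \<open>U x\<close>.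

A homeomorphism that preserves all \<open>T x\<close> and is supported in \<open>O'\<close> is a product of 28 elements, because
some \<open>w\<close> in \<open>W\<close> maps each \<open>T x\<close> into \<open>V' x - {x}\<close>. A homeomorphism \<open>g\<close> that preserves the sets \<open>T x\<close>,
\<open>V' x\<close> and fixes every \<open>x\<close> is therefore a product of \<open>28 + 26\<close> elements.

A general \<open>g\<close> is first corrected by a product \<open>t\<close> of 28 elements with \<open>t x = g x\<close>. To this end choose
\<open>v\<close> in \<open>W\<close> preserving the sets \<open>V' x\<close> and moving every \<open>x\<close> that some homeomorphism preserving \<open>V' x\<close>
moves. If \<open>g\<close> is so close to the identity that \<open>v (g x)\<close> is different from \<open>x\<close> whenever \<open>v\<close> moves \<open>x\<close>,
there is \<open>q\<close> fixing the points \<open>x\<close> with \<open>q (v x) = v (g x)\<close>, and \<open>t\<close> is the conjugate of \<open>q\<close> by the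
inverse of \<open>v\<close>. In total this makes \<open>28 + 28 + 26 = 82\<close> factors.\<close>

theorem neighbourhood_in_products:
  "\<exists>Q. finite Q \<and> Q \<subseteq> C \<and> (\<forall>g\<in>Aut. (\<forall>r\<in>Q. g ` r = r) \<longrightarrow> g \<in> products 82)"
proof -
  obtain D where D: "compact_open D" "supported (Y - D) \<subseteq> products 26" using ends_supported_in_products by blast
  define V' where "V' x = V x - D" for x
  have V'C: "V' x \<in> C" "x \<in> V' x" "V' x \<subseteq> U x" "V' x \<subseteq> V x" if "x \<in> F" for x
    using that D(1) V_C x_in_V V_U YD by (auto simp: V'_def compact_open_def intro: C_Diff)
  have V'_disj: "disjoint_family_on V' F" using V_disjoint by (fastforce simp: V'_def disjoint_family_on_def)
  have KI: "g \<in> products 26" if "g \<in> Aut" "\<And>p. g p \<noteq> p \<Longrightarrow> \<exists>x\<in>F. p \<noteq> x \<and> p \<in> V' x \<and> g p \<in> V' x" for g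
    using supported_cofinite_I[OF that(1), of D] that(2) D(2) unfolding V'_def by blast
  define P where "P = (\<Union>x\<in>F. V' x)"
  have PC: "P \<in> C" unfolding P_def using finite_F V'C by (intro C_UN) auto
  define O' where "O' = S - P"
  have OC: "O' \<in> C" using PC by (simp add: O'_def C_Compl)
  have UC: "U x \<in> C" if "x \<in> F" for x using U_stable[OF that] by (simp add: stable_def)
  have "O' \<subseteq> (\<Union>x\<in>F. U x)" using U_cover OC C_subset by simp
  with finite_F UC OC
  have "\<exists>T. (\<forall>x\<in>F. T x \<in> C \<and> T x \<subseteq> U x) \<and> disjoint_family_on T F \<and> (\<Union>x\<in>F. T x) = O'"
    by (rule finite_disjointification)
  then obtain T where T: "\<forall>x\<in>F. T x \<in> C \<and> T x \<subseteq> U x" "disjoint_family_on T F" "(\<Union>x\<in>F. T x) = O'"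
    by (elim exE conjE)
  \<comment> \<open>An element of \<open>W\<close> pushing the rest of the space into the neighbourhoods of the ends: approximate
    the involution that exchanges each \<open>T x\<close> with its image under a homeomorphism from \<open>U x\<close> to \<open>V' x\<close>.\<close>
  have "\<exists>w\<in>W. \<forall>x\<in>F. w ` T x \<subseteq> V' x - {x}"
  proof -
    have "\<exists>f. clopen_iso (U x) (V' x) f \<and> f x = x" if "x \<in> F" for x
      using U_stable[OF that] V'C[OF that] unfolding stable_def by blast
    then obtain f where f: "\<And>x. x \<in> F \<Longrightarrow> clopen_iso (U x) (V' x) (f x)" "\<And>x. x \<in> F \<Longrightarrow> f x x = x" by metis
    define T' where "T' x = f x ` T x" for x
    have xT: "x \<notin> T x" if "x \<in> F" for x using T(3) V'C(2) that by (auto simp: O'_def P_def)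
    have T': "T' x \<subseteq> V' x - {x}" if x: "x \<in> F" for x
    proof
      fix q assume "q \<in> T' x"
      then obtain p where p: "p \<in> T x" "q = f x p" by (auto simp: T'_def)
      have "x \<in> U x" "p \<in> U x" using x p T(1) V'C by blast+
      then have "q \<noteq> f x x" using clopen_isoD(3)[OF f(1)[OF x]] p xT[OF x] by (metis inj_onD)
      then show "q \<in> V' x - {x}" using f(2)[OF x] clopen_isoD(2)[OF f(1)[OF x]] p \<open>p \<in> U x\<close> by auto
    qed
    have iso: "clopen_iso (T x) (T' x) (f x)" if "x \<in> F" for x
      using clopen_iso_restrict[OF f(1)[OF that], of "T x"] T(1) that by (simp add: T'_def)
    have T'C: "T' x \<in> C" if "x \<in> F" for x
      using clopen_isoD(4)[OF f(1)[OF that], of "T x"] T(1) that by (simp add: T'_def)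
    have T'd: "disjoint_family_on T' F"
      using V'_disj T' unfolding disjoint_family_on_def by blast
    have "\<exists>\<theta>. clopen_iso (\<Union>x\<in>F. T x) (\<Union>x\<in>F. T' x) \<theta> \<and> (\<forall>x\<in>F. \<forall>p\<in>T x. \<theta> p = f x p)"
      by (rule clopen_iso_glue[OF iso T(2) T'd]) (use T T'C finite_F in \<open>auto intro!: loc_fin_finite\<close>)
    then obtain \<theta> where th: "clopen_iso O' (\<Union>x\<in>F. T' x) \<theta>" "\<And>x p. x \<in> F \<Longrightarrow> p \<in> T x \<Longrightarrow> \<theta> p = f x p"
      unfolding T(3) by blast
    let ?B = "\<Union>x\<in>F. T' x"
    have BC: "?B \<in> C" using finite_F T'C by (intro C_UN) auto
    have BP: "?B \<subseteq> P" using T' by (auto simp: P_def)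
    then have disj: "O' \<inter> ?B = {}" by (auto simp: O'_def)
    define h where "h = ext_id (O' \<union> ?B) (swap_map O' ?B \<theta>)"
    have "clopen_iso (O' \<union> ?B) (O' \<union> ?B) (swap_map O' ?B \<theta>)"
      by (rule clopen_iso_swap_map[OF th(1) disj]) (auto intro: C_Int OC BC)
    then have hA: "h \<in> Aut" unfolding h_def using ext_id_Aut OC BC C_Un by blast
    have hT: "h p = f x p" if "x \<in> F" "p \<in> T x" for x p
    proof -
      have "p \<in> O'" using that T(3) by blast
      then show ?thesis using th(2)[OF that] by (simp add: h_def swap_map_def)
    qed
    have hT': "h p \<in> T x" if x: "x \<in> F" and p: "p \<in> T' x" for x p
    proof -
      obtain q where q: "q \<in> T x" "p = f x q" using p by (auto simp: T'_def)
      have "q \<in> O'" using q x T(3) by blast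
      then have "inv_into O' \<theta> p = q" using q th(2)[OF x q(1)] clopen_isoD(3)[OF th(1)] by (metis inv_into_f_f)
      moreover have "p \<in> ?B" "p \<notin> O'" using x p disj by blast+
      ultimately show ?thesis using q by (simp add: h_def swap_map_def)
    qed
    have "\<exists>x\<in>F. p \<in> U x \<and> h p \<in> U x" if "h p \<noteq> p" for p
    proof -
      have "p \<in> O' \<union> ?B" using that by (auto simp: h_def ext_id_def split: if_splits)
      then consider x where "x \<in> F" "p \<in> T x" | x where "x \<in> F" "p \<in> T' x" using T(3) by blast
      then show ?thesis
      proof cases
        case 1
        then have "h p \<in> T' x" using hT by (simp add: T'_def)
        then show ?thesis using 1 T(1) T'[OF 1(1)] V'C(3)[OF 1(1)] by blast
      next
        case 2
        then show ?thesis using hT' T(1) T'[OF 2(1)] V'C(3)[OF 2(1)] by blast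
      qed
    qed
    then obtain w where w: "w \<in> W" "\<forall>r\<in>T ` F. w ` r = h ` r"
      using approx[OF hA, of "T ` F"] finite_F T(1) by blast
    have "w ` T x \<subseteq> V' x - {x}" if "x \<in> F" for x
    proof -
      have "w ` T x = h ` T x" using w(2) that by blast
      also have "\<dots> = T' x" unfolding T'_def using hT[OF that] by (intro image_cong) auto
      finally show ?thesis using T'[OF that] by simp
    qed
    then show ?thesis using w(1) by blast
  qed
  then obtain w where w: "w \<in> W" "\<And>x. x \<in> F \<Longrightarrow> w ` T x \<subseteq> V' x - {x}" by blast
  have outer: "g \<in> products 28" if g: "g \<in> Aut" "\<And>p. p \<notin> O' \<Longrightarrow> g p = p" "\<And>x. x \<in> F \<Longrightarrow> g ` T x = T x" for g
  proof -
    have wA: "w \<in> Aut" using w(1) W_Aut by blast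
    have bw: "bij w" using AutD(1)[OF wA] .
    have "w \<circ> g \<circ> invf w \<in> products 26"
    proof (rule KI)
      show "w \<circ> g \<circ> invf w \<in> Aut" by (intro Aut_comp Aut_inv wA g)
      fix p assume ne: "(w \<circ> g \<circ> invf w) p \<noteq> p"
      let ?q = "invf w p"
      have wq: "w ?q = p" using bw by (simp add: bij_inv_cancel)
      then have "g ?q \<noteq> ?q" using ne by auto
      then have "?q \<in> O'" using g(2) by blast
      then obtain x where x: "x \<in> F" "?q \<in> T x" using T(3) by blast
      then have "g ?q \<in> T x" using g(3) by blast
      then have "w ?q \<in> V' x - {x}" "w (g ?q) \<in> V' x - {x}" using w(2)[OF x(1)] x(2) by blast+
      then show "\<exists>x\<in>F. p \<noteq> x \<and> p \<in> V' x \<and> (w \<circ> g \<circ> invf w) p \<in> V' x" using x(1) wq by auto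
    qed
    then have "invf w \<circ> (w \<circ> g \<circ> invf w) \<circ> w \<in> products (1 + 26 + 1)"
      by (intro products_comp products_1 w W_inv)
    moreover have "invf w \<circ> (w \<circ> g \<circ> invf w) \<circ> w = g" using bw by (simp add: fun_eq_iff bij_inv_cancel)
    ultimately show ?thesis by simp
  qed
  \<comment> \<open>An element of \<open>W\<close> moving every end that can be moved. Since \<open>r x\<close> contains \<open>x\<close> and \<open>h ` r x\<close> does not,
    agreement with \<open>h\<close> on \<open>r x\<close> is enough to move \<open>x\<close>.\<close>
  have "\<exists>v\<in>W. \<forall>x\<in>F. v ` V' x = V' x \<and> (v x \<noteq> x \<or> (\<forall>k\<in>Aut. k ` V' x = V' x \<longrightarrow> k x = x))"
  proof -
    have "\<exists>f. f \<in> Aut \<and> f ` V' x = V' x \<and> (f x \<noteq> x \<or> (\<forall>k\<in>Aut. k ` V' x = V' x \<longrightarrow> k x = x))" for x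
    proof (cases "\<forall>k\<in>Aut. k ` V' x = V' x \<longrightarrow> k x = x")
      case True then show ?thesis using Aut_id by (intro exI[of _ id]) simp
    qed blast
    then obtain f where f: "\<And>x. f x \<in> Aut" "\<And>x. f x ` V' x = V' x"
      "\<And>x. f x x \<noteq> x \<or> (\<forall>k\<in>Aut. k ` V' x = V' x \<longrightarrow> k x = x)" by metis
    obtain h where h: "h \<in> Aut" "\<And>x p. x \<in> F \<Longrightarrow> p \<in> V' x \<Longrightarrow> h p = f x p" "\<And>p. p \<notin> P \<Longrightarrow> h p = p"
      using Aut_glue[OF finite_F V'C(1) V'_disj f(1,2)] unfolding P_def by metis
    have hV: "h ` V' x = V' x" if "x \<in> F" for x
    proof -
      have "h ` V' x = f x ` V' x" using h(2)[OF that] by (intro image_cong) auto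
      then show ?thesis using f(2) by simp
    qed
    have bh: "bij h" using AutD(1)[OF h(1)] .
    have "\<exists>r. r \<in> C \<and> x \<in> r \<and> (h x \<noteq> x \<longrightarrow> x \<notin> h ` r)" if x: "x \<in> F" for x
    proof (cases "h x = x")
      case True then show ?thesis using V'C[OF x] by blast
    next
      case False
      have xS: "x \<in> S" using V'C[OF x] C_subset by blast
      have "invf h x \<in> S" using Aut_S[OF Aut_inv[OF h(1)]] xS by simp
      moreover have "x \<noteq> invf h x" using False bh by (metis bij_inv_cancel(1))
      ultimately obtain r where "r \<in> C" "x \<in> r" "invf h x \<notin> r" using separation xS by blast
      then show ?thesis using bh by (intro exI[of _ r]) (auto simp: bij_inv_cancel)
    qed
    then obtain r where r: "\<And>x. x \<in> F \<Longrightarrow> r x \<in> C \<and> x \<in> r x \<and> (h x \<noteq> x \<longrightarrow> x \<notin> h ` r x)" by metis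
    have "\<exists>x\<in>F. p \<in> U x \<and> h p \<in> U x" if "h p \<noteq> p" for p
    proof -
      obtain x where x: "x \<in> F" "p \<in> V' x" using h(3) \<open>h p \<noteq> p\<close> by (auto simp: P_def)
      then have "h p \<in> V' x" using hV by blast
      then show ?thesis using x V'C(3) by blast
    qed
    then obtain v where v: "v \<in> W" "\<forall>q\<in>V' ` F \<union> r ` F. v ` q = h ` q"
      using approx[OF h(1), of "V' ` F \<union> r ` F"] finite_F V'C(1) r by blast
    have "v ` V' x = V' x \<and> (v x \<noteq> x \<or> (\<forall>k\<in>Aut. k ` V' x = V' x \<longrightarrow> k x = x))" if x: "x \<in> F" for x
    proof
      show "v ` V' x = V' x" using v(2) hV x by simp
      have "v x \<noteq> x" if "f x x \<noteq> x"
      proof -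
        have "h x \<noteq> x" using that h(2)[OF x] V'C(2)[OF x] by simp
        then have "x \<notin> h ` r x" "x \<in> r x" using r x by auto
        moreover have "v ` r x = h ` r x" using v(2) x by blast
        ultimately show ?thesis by (metis imageI)
      qed
      then show "v x \<noteq> x \<or> (\<forall>k\<in>Aut. k ` V' x = V' x \<longrightarrow> k x = x)" using f(3) by blast
    qed
    then show ?thesis using v(1) by blast
  qed
  then obtain v where v: "v \<in> W" "\<And>x. x \<in> F \<Longrightarrow> v ` V' x = V' x"
    "\<And>x. x \<in> F \<Longrightarrow> v x \<noteq> x \<or> (\<forall>k\<in>Aut. k ` V' x = V' x \<longrightarrow> k x = x)" by metis
  have vA: "v \<in> Aut" using v(1) W_Aut by blast
  have bv: "bij v" using AutD(1)[OF vA] .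
  \<comment> \<open>If \<open>g\<close> preserves \<open>Z x\<close> and \<open>v\<close> moves \<open>x\<close>, then \<open>v (g x)\<close> is different from \<open>x\<close>.\<close>
  have "\<exists>Z. Z \<in> C \<and> x \<in> Z \<and> (v x \<noteq> x \<longrightarrow> invf v x \<notin> Z)" if x: "x \<in> F" for x
  proof (cases "v x = x")
    case True then show ?thesis using V'C[OF x] by blast
  next
    case False
    have xS: "x \<in> S" using V'C[OF x] C_subset by blast
    have "invf v x \<in> S" using Aut_S[OF Aut_inv[OF vA]] xS by simp
    moreover have "x \<noteq> invf v x" using False bv by (metis bij_inv_cancel(1))
    ultimately show ?thesis using separation[OF xS] by blast
  qed
  then obtain Z where Z: "\<And>x. x \<in> F \<Longrightarrow> Z x \<in> C \<and> x \<in> Z x \<and> (v x \<noteq> x \<longrightarrow> invf v x \<notin> Z x)" by metis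
  define Q where "Q = T ` F \<union> V' ` F \<union> Z ` F"
  have "finite Q" "Q \<subseteq> C" unfolding Q_def using finite_F T(1) V'C(1) Z by auto
  moreover have "g \<in> products 82" if g: "g \<in> Aut" "\<forall>r\<in>Q. g ` r = r" for g
  proof -
    have gT: "g ` T x = T x" and gV: "g ` V' x = V' x" and gZ: "g ` Z x = Z x" if "x \<in> F" for x
      using g(2) that by (auto simp: Q_def)
    have "\<exists>k\<in>Aut. (\<forall>p. p \<notin> V' x \<or> p = x \<longrightarrow> k p = p) \<and> k (v x) = v (g x)" if x: "x \<in> F" for x
    proof (cases "v x = x")
      case True
      then have "g x = x" using v(3)[OF x] g(1) gV[OF x] by blast
      then show ?thesis using Aut_id by (intro bexI[of _ id]) auto
    next
      case False
      have x': "x \<in> V' x" using V'C[OF x] by simp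
      have "v x \<in> V' x" "v (g x) \<in> V' x" using x' v(2)[OF x] gV[OF x] by blast+
      moreover have "v (g x) \<noteq> x"
      proof
        assume "v (g x) = x"
        then have "invf v x = g x" using bv by (metis bij_inv_cancel(2))
        moreover have "g x \<in> Z x" using gZ[OF x] Z[OF x] by blast
        ultimately show False using Z[OF x] False by simp
      qed
      moreover have "v \<circ> g \<circ> invf v \<in> Aut" by (intro Aut_comp Aut_inv vA g(1))
      moreover have "(v \<circ> g \<circ> invf v) ` V' x = V' x"
      proof -
        have "invf v ` V' x = V' x" using v(2)[OF x] bv by (metis bij_is_inj image_inv_f_f)
        then show ?thesis using v(2)[OF x] gV[OF x] by (simp only: image_comp[symmetric])
      qed
      moreover have "(v \<circ> g \<circ> invf v) (v x) = v (g x)" using bv by (simp add: bij_inv_cancel)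
      ultimately show ?thesis using transport_within[OF V'C(1)[OF x] x'] False by blast
    qed
    then obtain k where k: "\<And>x. x \<in> F \<Longrightarrow> k x \<in> Aut"
      "\<And>x p. x \<in> F \<Longrightarrow> p \<notin> V' x \<or> p = x \<Longrightarrow> k x p = p" "\<And>x. x \<in> F \<Longrightarrow> k x (v x) = v (g x)" by metis
    have kV: "k x ` V' x = V' x" if "x \<in> F" for x
      using Aut_preserves_support[OF k(1)[OF that]] k(2)[OF that] by blast
    obtain q where q: "q \<in> Aut" "\<And>x p. x \<in> F \<Longrightarrow> p \<in> V' x \<Longrightarrow> q p = k x p" "\<And>p. p \<notin> P \<Longrightarrow> q p = p"
      using Aut_glue[OF finite_F V'C(1) V'_disj k(1) kV] unfolding P_def by metis
    have qV: "q ` V' x = V' x" if "x \<in> F" for x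
    proof -
      have "q ` V' x = k x ` V' x" using q(2)[OF that] by (intro image_cong) auto
      then show ?thesis using kV[OF that] by simp
    qed
    have "q \<in> products 26"
    proof (rule KI[OF q(1)])
      fix p assume ne: "q p \<noteq> p"
      then obtain x where x: "x \<in> F" "p \<in> V' x" using q(3) by (auto simp: P_def)
      moreover have "p \<noteq> x" using ne q(2)[OF x] k(2)[OF x(1)] by metis
      moreover have "q p \<in> V' x" using qV[OF x(1)] x(2) by blast
      ultimately show "\<exists>x\<in>F. p \<noteq> x \<and> p \<in> V' x \<and> q p \<in> V' x" by blast
    qed
    then have t28: "invf v \<circ> q \<circ> v \<in> products (1 + 26 + 1)" by (intro products_comp products_1 v W_inv)
    define t where "t = invf v \<circ> q \<circ> v"
    have tA: "t \<in> Aut" unfolding t_def by (intro Aut_comp Aut_inv vA q(1))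
    have bt: "bij t" using AutD(1)[OF tA] .
    have vP: "v p \<in> P \<longleftrightarrow> p \<in> P" for p
    proof -
      have "v p \<in> V' x \<longleftrightarrow> p \<in> V' x" if "x \<in> F" for x using Aut_image_iff[OF vA v(2)[OF that]] .
      then show ?thesis by (simp add: P_def)
    qed
    have tO: "t p = p" if "p \<notin> P" for p
      using that vP q(3) bv by (simp add: t_def bij_inv_cancel)
    have tV: "t ` V' x = V' x" if x: "x \<in> F" for x
    proof -
      have "invf v ` V' x = V' x" using v(2)[OF x] bv by (metis bij_is_inj image_inv_f_f)
      then show ?thesis unfolding t_def using v(2)[OF x] qV[OF x] by (simp only: image_comp[symmetric])
    qed
    have tx: "t x = g x" if x: "x \<in> F" for x
    proof -
      have "v x \<in> V' x" using V'C(2)[OF x] v(2)[OF x] by blast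
      then show ?thesis using q(2)[OF x] k(3)[OF x] bv by (simp add: t_def bij_inv_cancel)
    qed
    define g' where "g' = invf t \<circ> g"
    have g'A: "g' \<in> Aut" unfolding g'_def by (intro Aut_comp Aut_inv tA g(1))
    have g'x: "g' x = x" if "x \<in> F" for x using tx[OF that] bt by (metis bij_inv_cancel(2) comp_apply g'_def)
    have g'V: "g' ` V' x = V' x" if x: "x \<in> F" for x
    proof -
      have "invf t ` V' x = V' x" using tV[OF x] bt by (metis bij_is_inj image_inv_f_f)
      then show ?thesis unfolding g'_def using gV[OF x] by (simp only: image_comp[symmetric])
    qed
    have g'P: "g' ` P = P" unfolding P_def image_UN using g'V by simp
    have g'O: "g' ` O' = O'"
      unfolding O'_def using g'P Aut_image_S[OF g'A] AutD(1)[OF g'A] by (simp add: image_set_diff bij_is_inj)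
    have g'T: "g' ` T x = T x" if x: "x \<in> F" for x
    proof -
      have "g' p = g p" if "p \<in> T x" for p
      proof -
        have "g p \<in> T x" using gT[OF x] that by blast
        then have "g p \<notin> P" using T(3) x by (auto simp: O'_def)
        then have "t (g p) = g p" by (rule tO)
        then show ?thesis using bt by (metis bij_inv_cancel(2) comp_apply g'_def)
      qed
      then have "g' ` T x = g ` T x" by (intro image_cong) auto
      then show ?thesis using gT[OF x] by simp
    qed
    \<comment> \<open>After the correction the two parts of the space can be treated separately.\<close>
    define g1 g2 where "g1 = ext_id O' g'" and "g2 = ext_id P g'"
    have g1A: "g1 \<in> Aut" unfolding g1_def
      using ext_id_Aut[OF OC] Aut_clopen_iso[OF g'A, of O'] g'O by simp
    have g2A: "g2 \<in> Aut" unfolding g2_def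
      using ext_id_Aut[OF PC] Aut_clopen_iso[OF g'A, of P] g'P by simp
    have "g1 \<in> products 28"
    proof (rule outer[OF g1A])
      show "g1 p = p" if "p \<notin> O'" for p using that by (simp add: g1_def)
      show "g1 ` T x = T x" if x: "x \<in> F" for x
      proof -
        have "T x \<subseteq> O'" using T(3) x by blast
        then have "g1 ` T x = g' ` T x" by (intro image_cong) (auto simp: g1_def)
        then show ?thesis using g'T[OF x] by simp
      qed
    qed
    moreover have "g2 \<in> products 26"
    proof (rule KI[OF g2A])
      fix p assume ne: "g2 p \<noteq> p"
      then have "p \<in> P" "g2 p = g' p" by (auto simp: g2_def ext_id_def split: if_splits)
      then obtain x where x: "x \<in> F" "p \<in> V' x" by (auto simp: P_def)
      moreover have "p \<noteq> x" using ne \<open>g2 p = g' p\<close> g'x[OF x(1)] by metis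
      moreover have "g2 p \<in> V' x" using g'V[OF x(1)] x(2) \<open>g2 p = g' p\<close> by (metis imageI)
      ultimately show "\<exists>x\<in>F. p \<noteq> x \<and> p \<in> V' x \<and> g2 p \<in> V' x" by blast
    qed
    ultimately have "t \<circ> g1 \<circ> g2 \<in> products ((1 + 26 + 1) + 28 + 26)"
      using t28[folded t_def] by (intro products_comp)
    moreover have "t \<circ> g1 \<circ> g2 = g"
    proof
      fix p
      have "g1 (g2 p) = g' p"
      proof -
        consider "p \<in> O'" | "p \<in> P" | "p \<notin> S" by (auto simp: O'_def)
        then show ?thesis
        proof cases
          case 1
          then have "p \<notin> P" by (simp add: O'_def)
          then show ?thesis using 1 by (simp add: g1_def g2_def)
        next
          case 2
          then have "g' p \<in> P" using g'P by blast
          then have "g' p \<notin> O'" by (simp add: O'_def)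
          then show ?thesis using 2 by (simp add: g1_def g2_def)
        next
          case 3
          then have "p \<notin> P" "p \<notin> O'" using PC C_subset by (auto simp: O'_def)
          then show ?thesis using AutD(2)[OF g'A 3] by (simp add: g1_def g2_def)
        qed
      qed
      then show "(t \<circ> g1 \<circ> g2) p = g p" using bt by (simp add: g'_def bij_inv_cancel)
    qed
    ultimately show ?thesis by simp
  qed
  ultimately show ?thesis by blast
qed

end

context coloured_group begin

text \<open>A stable neighbourhood may be shrunk, so it can be taken on one side of each member of the finite set
\<open>R\<close>. Compactness gives finitely many such neighbourhoods covering the space, and their centres have
disjoint smaller ones.\<close>

theorem stable_imp_neighbourhood_in_products:
  assumes stable: "\<And>x. x \<in> S \<Longrightarrow> \<exists>U. stable x U"
  shows "\<exists>Q. finite Q \<and> Q \<subseteq> C \<and> (\<forall>g\<in>Aut. (\<forall>r\<in>Q. g ` r = r) \<longrightarrow> g \<in> products 82)"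
proof -
  obtain R where R: "finite R" "R \<subseteq> C" and
    dense: "\<forall>h\<in>Aut. (\<forall>r\<in>R. h ` r = r) \<longrightarrow> (\<forall>R'. finite R' \<and> R' \<subseteq> C \<longrightarrow> (\<exists>w\<in>W. \<forall>r\<in>R'. w ` r = h ` r))"
    using somewhere_dense by (elim exE conjE)
  have "\<exists>U. stable x U \<and> (\<forall>r\<in>R. U \<subseteq> r \<or> U \<inter> r = {})" if x: "x \<in> S" for x
  proof -
    obtain U where U: "stable x U" using stable[OF x] by blast
    \<comment> \<open>Cut the neighbourhood down to the atom of \<open>R\<close> that contains \<open>x\<close>.\<close>
    let ?U = "U \<inter> (\<Inter>r\<in>R. if x \<in> r then r else S - r)"
    have "?U \<in> C" using R U by (intro C_INT) (auto simp: stable_def intro: C_Compl)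
    moreover have "x \<in> ?U" using U x by (auto simp: stable_def)
    ultimately have "stable x ?U" using stable_subset[OF U] by blast
    moreover have "?U \<subseteq> r \<or> ?U \<inter> r = {}" if "r \<in> R" for r
    proof -
      have "?U \<subseteq> (if x \<in> r then r else S - r)" using that by blast
      then show ?thesis by (auto split: if_splits)
    qed
    ultimately show ?thesis by blast
  qed
  then obtain U where U: "\<And>x. x \<in> S \<Longrightarrow> stable x (U x)" "\<And>x r. x \<in> S \<Longrightarrow> r \<in> R \<Longrightarrow> U x \<subseteq> r \<or> U x \<inter> r = {}"
    by metis
  have UC: "U x \<in> C" "x \<in> U x" if "x \<in> S" for x using U(1)[OF that] by (auto simp: stable_def)
  have "U ` S \<subseteq> C" "\<Union>(U ` S) = S" using UC C_subset by blast+
  then obtain \<V> where "finite \<V>" "\<V> \<subseteq> U ` S" "\<Union>\<V> = S" using compactness by metis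
  then obtain F where F: "finite F" "F \<subseteq> S" "(\<Union>x\<in>F. U x) = S" using finite_subset_image by metis
  have "\<exists>A. A \<in> C \<and> x \<in> A \<and> y \<notin> A" if "x \<in> F" "y \<in> F" "x \<noteq> y" for x y
    using separation[of x y] that F by blast
  then obtain A where A: "\<And>x y. x \<in> F \<Longrightarrow> y \<in> F \<Longrightarrow> x \<noteq> y \<Longrightarrow> A x y \<in> C \<and> x \<in> A x y \<and> y \<notin> A x y" by metis
  \<comment> \<open>Subtracting \<open>A y x\<close> makes the neighbourhoods of different points disjoint.\<close>
  define V where "V x = U x \<inter> (\<Inter>y\<in>F - {x}. A x y - A y x)" for x
  have V: "stable x (V x)" if x: "x \<in> F" for x
  proof (rule stable_subset[OF U(1)])
    show "V x \<in> C" unfolding V_def using F UC A x by (intro C_INT) (auto intro!: C_Diff)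
    have "x \<in> A x y - A y x" if "y \<in> F - {x}" for y using A[of x y] A[of y x] x that by blast
    then show "x \<in> V x" unfolding V_def using UC(2) x F(2) by blast
  qed (use x F in \<open>auto simp: V_def\<close>)
  have Vd: "V x \<inter> V y = {}" if "x \<in> F" "y \<in> F" "x \<noteq> y" for x y
  proof -
    have "V x \<subseteq> A x y - A y x" "V y \<subseteq> A y x - A x y" using that by (auto simp: V_def)
    then show ?thesis by blast
  qed
  interpret dense_cover S C W c F V R U
  proof unfold_locales
    show "finite F" using F by simp
    show "V x \<inter> V y = {}" if "x \<in> F" "y \<in> F" "x \<noteq> y" for x y using Vd that .
    show "stable x (V x)" if "x \<in> F" for x using V that .
    show "\<exists>w\<in>W. \<forall>r\<in>R'. w ` r = h ` r"
      if "h \<in> Aut" "\<forall>r\<in>R. h ` r = r" "finite R'" "R' \<subseteq> C" for h R' using dense that by simp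
    show "stable x (U x)" if "x \<in> F" for x using U(1) F that by blast
    show "V x \<subseteq> U x" if "x \<in> F" for x by (auto simp: V_def)
    show "(\<Union>x\<in>F. U x) = S" using F by simp
    show "U x \<subseteq> r \<or> U x \<inter> r = {}" if "x \<in> F" "r \<in> R" for x r using U(2) F that by blast
  qed
  show ?thesis by (rule neighbourhood_in_products)
qed

end

section \<open>The homeomorphism group of a second countable Stone space\<close>

definition clopens :: "'a topology \<Rightarrow> 'a set set" where
  "clopens X = {A. openin X A \<and> closedin X A}"

lemma compact_metrizable_imp_countable_base:
  assumes "compact_space X" "metrizable_space X"
  shows "\<exists>\<B>. countable \<B> \<and> (\<forall>B\<in>\<B>. openin X B) \<and>
    (\<forall>W p. openin X W \<and> p \<in> W \<longrightarrow> (\<exists>B\<in>\<B>. p \<in> B \<and> B \<subseteq> W))"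
proof -
  obtain M d where "Metric_space M d" and X: "X = Metric_space.mtopology M d"
    using assms(2) by (auto simp: metrizable_space_def)
  then interpret Metric_space M d by simp
  have tb: "mtotally_bounded M"
    using assms(1) unfolding X compact_space_eq_mcomplete_mtotally_bounded by simp
  have "\<exists>L. finite L \<and> L \<subseteq> M \<and> M \<subseteq> (\<Union>x\<in>L. mball x (inverse (real (Suc n))))" for n
    using tb by (simp add: mtotally_bounded_def)
  then obtain L where L: "\<And>n. finite (L n)" "\<And>n. M \<subseteq> (\<Union>x\<in>L n. mball x (inverse (real (Suc n))))" by metis
  define \<B> where "\<B> = (\<Union>n. (\<lambda>x. mball x (inverse (real (Suc n)))) ` L n)"
  have "\<exists>B\<in>\<B>. p \<in> B \<and> B \<subseteq> W" if W: "openin X W" "p \<in> W" for W p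
  proof -
    obtain e where e: "e > 0" "mball p e \<subseteq> W" "p \<in> M" using W unfolding X openin_mtopology by blast
    obtain n where n: "inverse (real (Suc n)) < e / 2" using reals_Archimedean[of "e / 2"] e by auto
    obtain x where x: "x \<in> L n" "p \<in> mball x (inverse (real (Suc n)))" using L(2)[of n] e(3) by blast
    have "mball x (inverse (real (Suc n))) \<subseteq> mball p e"
    proof
      fix q assume q: "q \<in> mball x (inverse (real (Suc n)))"
      then have "d p q \<le> d p x + d x q" using x e by (intro triangle) auto
      also have "\<dots> < e" using x q n commute[of p x] by auto
      finally show "q \<in> mball p e" using q e by simp
    qed
    moreover have "mball x (inverse (real (Suc n))) \<in> \<B>" using x(1) by (auto simp: \<B>_def)
    ultimately show ?thesis using x(2) e(2) by blast
  qed
  moreover have "countable \<B>" unfolding \<B>_def using L(1) by (intro countable_UN countable_image) (auto intro: countable_finite)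
  moreover have "\<forall>B\<in>\<B>. openin X B" unfolding \<B>_def X by auto
  ultimately show ?thesis by blast
qed

text \<open>In a compact Hausdorff space every neighbourhood of a connected component contains a clopen one, and
here the components are points.\<close>

lemma Stone_clopen_base:
  assumes X: "second_countable_Stone_space X" and W: "openin X W" "p \<in> W"
  shows "\<exists>A\<in>clopens X. p \<in> A \<and> A \<subseteq> W"
proof -
  have hd: "Hausdorff_space X" and lc: "locally_compact_space X" and td: "totally_disconnected_space X"
    using X by (auto simp: second_countable_Stone_space_def metrizable_imp_Hausdorff_space
        intro: compact_imp_locally_compact_space)
  have pX: "p \<in> topspace X" using W openin_subset by blast
  have "connected_component_of_set X p = {p}"
    using td connectedin_connected_component_of[of X p] connected_component_of_refl[of X p] pX
    unfolding totally_disconnected_space_def by blast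
  then have "{p} \<in> connected_components_of X"
    using connected_component_in_connected_components_of[of X p] pX by simp
  moreover have "compactin X {p}" using pX by simp
  ultimately obtain U V where UV: "openin X U" "openin X V" "disjnt U V" "U \<union> V = topspace X" "{p} \<subseteq> U" "U \<subseteq> W"
    using wilder_locally_compact_component_thm[OF lc hd _ _ W(1), of "{p}"] W(2) by auto
  have "U = topspace X - V" using UV by (auto simp: disjnt_iff)
  then have "closedin X U" using UV(2) by auto
  then show ?thesis using UV by (auto simp: clopens_def)
qed

text \<open>A clopen set is compact, hence the union of finitely many members of a countable base; this bounds the
number of clopen sets.\<close>

lemma clopen_algebra_clopens:
  assumes X: "second_countable_Stone_space X"
  shows "clopen_algebra (topspace X) (clopens X)"
proof
  have comp: "compact_space X" and met: "metrizable_space X"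
    using X by (auto simp: second_countable_Stone_space_def)
  obtain \<B> where B: "countable \<B>" "\<forall>B\<in>\<B>. openin X B"
    "\<forall>W p. openin X W \<and> p \<in> W \<longrightarrow> (\<exists>B\<in>\<B>. p \<in> B \<and> B \<subseteq> W)"
    using compact_metrizable_imp_countable_base[OF comp met] by blast
  have "clopens X \<subseteq> Union ` {\<V>. \<V> \<subseteq> \<B> \<and> finite \<V>}"
  proof
    fix A assume A: "A \<in> clopens X"
    then have "compactin X A" using comp by (simp add: clopens_def closedin_compact_space)
    moreover have "A \<subseteq> \<Union>{B\<in>\<B>. B \<subseteq> A}" using A B(3) by (fastforce simp: clopens_def)
    ultimately obtain \<V> where V: "finite \<V>" "\<V> \<subseteq> {B\<in>\<B>. B \<subseteq> A}" "A \<subseteq> \<Union>\<V>"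
      using B(2) unfolding compactin_def by (metis (no_types, lifting) mem_Collect_eq)
    then have "A = \<Union>\<V>" by blast
    then show "A \<in> Union ` {\<V>. \<V> \<subseteq> \<B> \<and> finite \<V>}" using V by blast
  qed
  moreover have "countable {\<V>. \<V> \<subseteq> \<B> \<and> finite \<V>}"
    using countable_Collect_finite_subset[OF B(1)] by (simp add: conj_commute)
  ultimately show "countable (clopens X)" by (meson countable_image countable_subset)
  show "A \<subseteq> topspace X" if "A \<in> clopens X" for A using that by (auto simp: clopens_def closedin_subset)
  show "topspace X \<in> clopens X" by (simp add: clopens_def)
  show "A \<union> B \<in> clopens X" if "A \<in> clopens X" "B \<in> clopens X" for A B
    using that by (auto simp: clopens_def)
  show "topspace X - A \<in> clopens X" if "A \<in> clopens X" for A
    using that by (auto simp: clopens_def openin_diff closedin_diff)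
  show "\<exists>A\<in>clopens X. p \<in> A \<and> q \<notin> A" if "p \<in> topspace X" "q \<in> topspace X" "p \<noteq> q" for p q
  proof -
    have "closedin X {q}" using met that(2)
      by (meson metrizable_imp_Hausdorff_space closedin_Hausdorff_singleton)
    then have "openin X (topspace X - {q})" by (simp add: openin_diff)
    then show ?thesis using Stone_clopen_base[OF X, of "topspace X - {q}" p] that by blast
  qed
  show "\<exists>\<V>. finite \<V> \<and> \<V> \<subseteq> \<U> \<and> \<Union>\<V> = topspace X" if sub: "\<U> \<subseteq> clopens X" and cov: "\<Union>\<U> = topspace X" for \<U>
  proof -
    have "\<forall>U\<in>\<U>. openin X U" using sub by (auto simp: clopens_def)
    then obtain \<V> where V: "finite \<V>" "\<V> \<subseteq> \<U>" "topspace X \<subseteq> \<Union>\<V>"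
      using comp cov unfolding compact_space_def compactin_def by (metis order_refl)
    then have "\<Union>\<V> = topspace X" using cov by blast
    then show ?thesis using V by blast
  qed
qed

locale Stone = clopen_algebra "topspace X" "clopens X" for X :: "'a topology" +
  assumes Stone: "second_countable_Stone_space X"
begin

lemma clopen_between:
  assumes K: "compactin X K" and W: "openin X W" "K \<subseteq> W"
  shows "\<exists>A\<in>clopens X. K \<subseteq> A \<and> A \<subseteq> W"
proof -
  have "\<forall>p\<in>K. \<exists>A\<in>clopens X. p \<in> A \<and> A \<subseteq> W" using Stone_clopen_base[OF Stone W(1)] W(2) by blast
  then have "K \<subseteq> \<Union>{A\<in>clopens X. A \<subseteq> W}" by blast
  moreover have "\<forall>U\<in>{A\<in>clopens X. A \<subseteq> W}. openin X U" by (simp add: clopens_def)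
  ultimately obtain \<V> where V: "finite \<V>" "\<V> \<subseteq> {A\<in>clopens X. A \<subseteq> W}" "K \<subseteq> \<Union>\<V>"
    using K unfolding compactin_def by meson
  have "(\<Union>A\<in>\<V>. A) \<in> clopens X" using V by (intro C_UN) auto
  then show ?thesis using V by (intro bexI[of _ "\<Union>\<V>"]) auto
qed

lemma homeomorphic_map_clopen_iso:
  assumes U: "U \<in> clopens X" "U' \<in> clopens X"
    and f: "homeomorphic_map (subtopology X U) (subtopology X U') f"
  shows "clopen_iso U U' f"
proof -
  have top: "topspace (subtopology X U) = U" "topspace (subtopology X U') = U'"
    using U C_subset by (auto simp: topspace_subtopology)
  have rel: "T \<in> clopens X \<longleftrightarrow> openin (subtopology X B) T \<and> closedin (subtopology X B) T"
    if "B \<in> clopens X" "T \<subseteq> B" for B T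
    using that openin_open_subtopology[of X B T] closedin_closed_subtopology[of X B T]
    by (auto simp: clopens_def)
  have bij: "bij_betw f U U'"
    using homeomorphic_imp_injective_map[OF f, unfolded top]
      homeomorphic_imp_surjective_map[OF f, unfolded top] by (simp add: bij_betw_def)
  have "f ` T \<in> clopens X \<longleftrightarrow> T \<in> clopens X" if T: "T \<subseteq> U" for T
  proof -
    have "f ` T \<subseteq> U'" using T bij by (auto simp: bij_betw_def)
    then show ?thesis
      using rel[OF U(1) T] rel[OF U(2)] homeomorphic_map_openness[OF f, unfolded top, OF T]
        homeomorphic_map_closedness[OF f, unfolded top, OF T] by simp
  qed
  then show ?thesis using bij by (simp add: clopen_iso_def)
qed

lemma stable_nbhd_stable: "stable_nbhd X x U \<Longrightarrow> stable x U"
  unfolding stable_nbhd_def stable_def clopen_nbhd_def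
  using homeomorphic_map_clopen_iso by (fastforce simp: clopens_def)

lemma homeomorphic_map_Aut:
  assumes "homeomorphic_map X X f"
  shows "ext_id (topspace X) f \<in> Aut"
proof (rule ext_id_Aut[OF S_in_C])
  show "clopen_iso (topspace X) (topspace X) f"
    by (rule homeomorphic_map_clopen_iso) (use assms S_in_C in auto)
qed

lemma Aut_continuous: assumes "g \<in> Aut" shows "continuous_map X X g"
  unfolding continuous_map
proof (intro conjI allI impI)
  show "g ` topspace X \<subseteq> topspace X" using Aut_image_S[OF assms] by simp
  fix W assume W: "openin X W"
  show "openin X {p \<in> topspace X. g p \<in> W}"
  proof (subst openin_subopen, intro ballI)
    fix p assume p: "p \<in> {p \<in> topspace X. g p \<in> W}"
    then obtain A where A: "A \<in> clopens X" "g p \<in> A" "A \<subseteq> W" using Stone_clopen_base[OF Stone W] by blast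
    have "invf g ` A \<in> clopens X" using AutD(3)[OF Aut_inv[OF assms]] A by simp
    moreover have "p \<in> invf g ` A" using A(2) AutD(1)[OF assms] by (metis bij_inv_cancel(2) imageI)
    moreover have "invf g ` A \<subseteq> {p \<in> topspace X. g p \<in> W}"
      using A C_subset[OF calculation(1)] AutD(1)[OF assms] by (auto simp: bij_inv_cancel)
    ultimately show "\<exists>T. openin X T \<and> p \<in> T \<and> T \<subseteq> {p \<in> topspace X. g p \<in> W}"
      by (auto simp: clopens_def)
  qed
qed

lemma Aut_homeomorphic_map: assumes "g \<in> Aut" shows "homeomorphic_map X X g"
proof -
  have "homeomorphic_maps X X g (invf g)"
    unfolding homeomorphic_maps_def
    using Aut_continuous[OF assms] Aut_continuous[OF Aut_inv[OF assms]] AutD(1)[OF assms]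
    by (auto simp: bij_inv_cancel)
  then show ?thesis by (rule homeomorphic_maps_imp_map)
qed

text \<open>The two representations of a homeomorphism, as a bijection of the type and as an extensional function
on the space, determine each other.\<close>

definition to_Homeo :: "('a \<Rightarrow> 'a) \<Rightarrow> 'a \<Rightarrow> 'a" where
  "to_Homeo g = restrict g (topspace X)"

lemma to_Homeo_simps:
  "p \<in> topspace X \<Longrightarrow> to_Homeo g p = g p"
  "A \<subseteq> topspace X \<Longrightarrow> to_Homeo g ` A = g ` A"
  by (auto simp: to_Homeo_def image_iff subset_iff)

lemma carrier_Homeo: "carrier (Homeo X) = to_Homeo ` Aut"
proof
  show "to_Homeo ` Aut \<subseteq> carrier (Homeo X)"
  proof
    fix f assume "f \<in> to_Homeo ` Aut"
    then obtain g where g: "g \<in> Aut" "f = to_Homeo g" by blast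
    have "homeomorphic_map X X f"
      using Aut_homeomorphic_map[OF g(1)] homeomorphic_map_eq[of X X g f] g(2) to_Homeo_simps(1) by metis
    then show "f \<in> carrier (Homeo X)" using g by (simp add: Homeo_def to_Homeo_def)
  qed
  show "carrier (Homeo X) \<subseteq> to_Homeo ` Aut"
  proof
    fix f assume "f \<in> carrier (Homeo X)"
    then have f: "f \<in> extensional (topspace X)" "homeomorphic_map X X f" by (auto simp: Homeo_def)
    have "f = to_Homeo (ext_id (topspace X) f)"
      using f(1) by (auto simp: to_Homeo_def fun_eq_iff extensional_def)
    then show "f \<in> to_Homeo ` Aut" using homeomorphic_map_Aut[OF f(2)] by blast
  qed
qed

lemma to_Homeo_Bij: "g \<in> Aut \<Longrightarrow> to_Homeo g \<in> Bij (topspace X)"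
  using Aut_image_S[of g] AutD(1)[of g]
  by (auto simp: Bij_def bij_betw_def to_Homeo_def inj_on_def bij_def)

lemma to_Homeo_eq_iff: assumes "g \<in> Aut" "h \<in> Aut" shows "to_Homeo g = to_Homeo h \<longleftrightarrow> g = h"
proof
  assume eq: "to_Homeo g = to_Homeo h"
  show "g = h"
  proof
    fix p show "g p = h p"
      using fun_cong[OF eq, of p] AutD(2)[OF assms(1)] AutD(2)[OF assms(2)]
      by (cases "p \<in> topspace X") (auto simp: to_Homeo_def)
  qed
qed simp

lemma mult_Homeo:
  assumes "g \<in> Aut" "h \<in> Aut"
  shows "to_Homeo g \<otimes>\<^bsub>Homeo X\<^esub> to_Homeo h = to_Homeo (g \<circ> h)"
  using to_Homeo_Bij[OF assms(1)] to_Homeo_Bij[OF assms(2)] Aut_S[OF assms(2)]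
  by (auto simp: Homeo_def BijGroup_def compose_def to_Homeo_def fun_eq_iff)

lemma one_Homeo: "\<one>\<^bsub>Homeo X\<^esub> = to_Homeo id"
  by (auto simp: Homeo_def BijGroup_def to_Homeo_def fun_eq_iff)

lemma group_Homeo: "group (Homeo X)"
proof (rule groupI)
  fix f assume "f \<in> carrier (Homeo X)"
  then obtain g where g: "g \<in> Aut" "f = to_Homeo g" by (auto simp: carrier_Homeo)
  show "\<one>\<^bsub>Homeo X\<^esub> \<otimes>\<^bsub>Homeo X\<^esub> f = f" using g by (simp add: one_Homeo mult_Homeo Aut_id)
  have "invf g \<circ> g = id" using AutD(1)[OF g(1)] by (simp add: fun_eq_iff bij_inv_cancel)
  then show "\<exists>h\<in>carrier (Homeo X). h \<otimes>\<^bsub>Homeo X\<^esub> f = \<one>\<^bsub>Homeo X\<^esub>"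
    using g Aut_inv[OF g(1)] mult_Homeo[OF Aut_inv[OF g(1)] g(1)]
    by (intro bexI[of _ "to_Homeo (invf g)"]) (auto simp: carrier_Homeo one_Homeo)
qed (auto simp: carrier_Homeo one_Homeo mult_Homeo Aut_comp Aut_id comp_assoc)

lemma inv_Homeo: assumes "g \<in> Aut" shows "inv\<^bsub>Homeo X\<^esub> (to_Homeo g) = to_Homeo (invf g)"
proof (rule group.inv_equality[OF group_Homeo])
  have "invf g \<circ> g = id" using AutD(1)[OF assms] by (simp add: fun_eq_iff bij_inv_cancel)
  then show "to_Homeo (invf g) \<otimes>\<^bsub>Homeo X\<^esub> to_Homeo g = \<one>\<^bsub>Homeo X\<^esub>"
    using mult_Homeo[OF Aut_inv[OF assms] assms] by (simp add: one_Homeo)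
qed (use assms Aut_inv in \<open>auto simp: carrier_Homeo\<close>)

lemma to_Homeo_continuous: assumes "g \<in> Aut" shows "continuous_map X X (to_Homeo g)"
  using continuous_map_eq[OF Aut_continuous[OF assms], of "to_Homeo g"] to_Homeo_simps(1) by metis

text \<open>The basic neighbourhoods in the topology of \<open>Homeo X\<close>.\<close>

definition nbhd :: "('a \<Rightarrow> 'a) \<Rightarrow> 'a set set \<Rightarrow> ('a \<Rightarrow> 'a) set" where
  "nbhd f R = to_Homeo ` {g \<in> Aut. \<forall>r\<in>R. g ` r = f ` r}"

lemma nbhdD:
  assumes "h \<in> nbhd f R"
  shows "\<exists>g. g \<in> Aut \<and> h = to_Homeo g \<and> (\<forall>r\<in>R. g ` r = f ` r)"
  using assms unfolding nbhd_def by (elim imageE CollectE conjE) (intro exI conjI)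

lemma nbhd_iff: assumes "g \<in> Aut" shows "to_Homeo g \<in> nbhd f R \<longleftrightarrow> (\<forall>r\<in>R. g ` r = f ` r)"
proof
  assume "to_Homeo g \<in> nbhd f R"
  from nbhdD[OF this] obtain h where "h \<in> Aut" "to_Homeo g = to_Homeo h" "\<forall>r\<in>R. h ` r = f ` r"
    by (elim exE conjE)
  then show "\<forall>r\<in>R. g ` r = f ` r" using to_Homeo_eq_iff[OF assms] by simp
next
  assume "\<forall>r\<in>R. g ` r = f ` r"
  then show "to_Homeo g \<in> nbhd f R" unfolding nbhd_def using assms by (intro imageI CollectI conjI)
qed

lemma nbhd_self: "f \<in> Aut \<Longrightarrow> to_Homeo f \<in> nbhd f R"
  by (simp add: nbhd_iff)

text \<open>The condition \<open>g ` r = f ` r\<close> is an intersection of two subbasic conditions, \<open>g ` r \<subseteq> f ` r\<close> and the same for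
the complements.\<close>

lemma openin_nbhd:
  assumes f: "f \<in> Aut" and R: "finite R" "R \<subseteq> clopens X"
  shows "openin (Homeo_topology X) (nbhd f R)"
proof -
  define sub where "sub K U = {h \<in> extensional (topspace X). continuous_map X X h \<and> h ` K \<subseteq> U}" for K U
  have sub: "openin (compact_open_topology X X) (sub K U)" if "compactin X K" "openin X U" for K U
    unfolding compact_open_topology_def sub_def using that by (intro topology_generated_by_Basis) blast
  have comp: "compact_space X" using Stone by (simp add: second_countable_Stone_space_def)
  have cl: "compactin X r" "openin X r" if "r \<in> clopens X" for r
    using that comp by (auto simp: clopens_def closedin_compact_space)
  define N where "N r = sub r (f ` r) \<inter> sub (topspace X - r) (topspace X - f ` r)" for r
  have N: "openin (compact_open_topology X X) (N r)" if "r \<in> R" for r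
  proof -
    have "r \<in> clopens X" "f ` r \<in> clopens X" using that R(2) AutD(3)[OF f] by auto
    then show ?thesis unfolding N_def by (intro openin_Int sub cl C_Compl)
  qed
  have top: "openin (compact_open_topology X X) (sub {} (topspace X))" by (rule sub) auto
  have "openin (compact_open_topology X X) (sub {} (topspace X) \<inter> (\<Inter>r\<in>R. N r))"
  proof (cases "R = {}")
    case True then show ?thesis using top by simp
  next
    case False
    then have "openin (compact_open_topology X X) (\<Inter>(N ` R))"
      using R(1) N by (intro openin_Inter) auto
    then show ?thesis using top by (rule openin_Int[rotated])
  qed
  then have op: "openin (subtopology (compact_open_topology X X) (carrier (Homeo X)))
      ((sub {} (topspace X) \<inter> (\<Inter>r\<in>R. N r)) \<inter> carrier (Homeo X))" by (rule openin_subtopology_Int)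
  have "nbhd f R = (sub {} (topspace X) \<inter> (\<Inter>r\<in>R. N r)) \<inter> carrier (Homeo X)" (is "?L = ?R")
  proof
    show "?L \<subseteq> ?R"
    proof
      fix h assume "h \<in> ?L"
      from nbhdD[OF this] obtain g where g: "g \<in> Aut" "h = to_Homeo g" "\<forall>r\<in>R. g ` r = f ` r"
        by (elim exE conjE)
      have h: "h \<in> extensional (topspace X)" "continuous_map X X h"
        using g(2) to_Homeo_continuous[OF g(1)] by (auto simp: to_Homeo_def)
      have "h \<in> N r" if r: "r \<in> R" for r
      proof -
        have rX: "r \<subseteq> topspace X" using r R(2) C_subset by blast
        have "h ` r = f ` r" using g r to_Homeo_simps(2)[OF rX] by simp
        moreover have "h ` (topspace X - r) = topspace X - f ` r"
          using g r to_Homeo_simps(2)[of "topspace X - r" g] AutD(1)[OF g(1)] Aut_image_S[OF g(1)]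
          by (simp add: image_set_diff bij_is_inj)
        ultimately show ?thesis using h by (simp add: N_def sub_def)
      qed
      then show "h \<in> ?R" using h g by (auto simp: carrier_Homeo sub_def)
    qed
    show "?R \<subseteq> ?L"
    proof
      fix h assume h: "h \<in> ?R"
      then obtain g where g: "g \<in> Aut" "h = to_Homeo g" by (auto simp: carrier_Homeo)
      have "g ` r = f ` r" if r: "r \<in> R" for r
      proof -
        have rX: "r \<subseteq> topspace X" using r R(2) C_subset by blast
        have "h \<in> N r" using h r by blast
        then have "g ` r \<subseteq> f ` r" "g ` (topspace X - r) \<subseteq> topspace X - f ` r"
          using to_Homeo_simps(2)[OF rX, of g] to_Homeo_simps(2)[of "topspace X - r" g] g(2)
          by (auto simp: N_def sub_def)
        moreover have "q \<in> g ` r" if q: "q \<in> f ` r" for q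
        proof -
          have "q \<in> topspace X" using q rX Aut_S[OF f] by blast
          then have "q \<in> g ` topspace X" using Aut_image_S[OF g(1)] by simp
          then obtain p where "p \<in> topspace X" "q = g p" by blast
          then show ?thesis using calculation(2) q by blast
        qed
        ultimately show ?thesis by (intro equalityI subsetI) auto
      qed
      then show "h \<in> ?L" using g nbhd_iff by simp
    qed
  qed
  then show ?thesis using op by (simp only: Homeo_topology_def)
qed

text \<open>A subbasic condition \<open>h ` K \<subseteq> U\<close> satisfied by \<open>f\<close> follows from a condition on one clopen set lying
between \<open>K\<close> and the preimage of \<open>U\<close> under \<open>f\<close>.\<close>

lemma openin_Homeo_topology:
  "openin (Homeo_topology X) T \<longleftrightarrow> T \<subseteq> to_Homeo ` Aut \<and>
     (\<forall>f\<in>Aut. to_Homeo f \<in> T \<longrightarrow> (\<exists>R. finite R \<and> R \<subseteq> clopens X \<and> nbhd f R \<subseteq> T))" (is "?L \<longleftrightarrow> ?R")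
proof
  assume ?L
  then obtain T' where T': "openin (compact_open_topology X X) T'" "T = T' \<inter> to_Homeo ` Aut"
    unfolding Homeo_topology_def openin_subtopology carrier_Homeo by blast
  have "\<exists>R. finite R \<and> R \<subseteq> clopens X \<and> nbhd f R \<subseteq> T'" if "f \<in> Aut" "to_Homeo f \<in> T'" for f
    using T'(1) that(2) unfolding compact_open_topology_def openin_topology_generated_by_iff
  proof (induction rule: generate_topology_on.induct)
    case (Int a b)
    then obtain R R' where "finite R" "R \<subseteq> clopens X" "nbhd f R \<subseteq> a"
      "finite R'" "R' \<subseteq> clopens X" "nbhd f R' \<subseteq> b" by blast
    moreover have "nbhd f (R \<union> R') \<subseteq> nbhd f R \<inter> nbhd f R'" by (auto simp: nbhd_def)
    ultimately show ?case by (intro exI[of _ "R \<union> R'"]) auto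
  next
    case (UN \<K>)
    then obtain k where k: "k \<in> \<K>" "to_Homeo f \<in> k" by blast
    then show ?case using UN.IH[of k] by blast
  next
    case (Basis s)
    then obtain K U where KU: "compactin X K" "openin X U"
      "s = {h \<in> extensional (topspace X). continuous_map X X h \<and> h ` K \<subseteq> U}" by auto
    have KX: "K \<subseteq> topspace X" using KU(1) by (rule compactin_subset_topspace)
    have W: "openin X {p \<in> topspace X. f p \<in> U}"
      using Aut_continuous[OF \<open>f \<in> Aut\<close>] KU(2) by (simp add: continuous_map)
    have "f ` K \<subseteq> U" using Basis.prems KU(3) to_Homeo_simps(2)[OF KX] by simp
    then have "K \<subseteq> {p \<in> topspace X. f p \<in> U}" using KX by blast
    then obtain r where r: "r \<in> clopens X" "K \<subseteq> r" "r \<subseteq> {p \<in> topspace X. f p \<in> U}"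
      using clopen_between[OF KU(1) W] by blast
    have "nbhd f {r} \<subseteq> s"
    proof
      fix h assume "h \<in> nbhd f {r}"
      from nbhdD[OF this] obtain g where g: "g \<in> Aut" "h = to_Homeo g" "\<forall>q\<in>{r}. g ` q = f ` q"
        by (elim exE conjE)
      have "g ` K \<subseteq> g ` r" by (rule image_mono[OF r(2)])
      also have "\<dots> = f ` r" using g(3) by simp
      also have "\<dots> \<subseteq> U" using r(3) by auto
      finally have "g ` K \<subseteq> U" .
      then have "h ` K \<subseteq> U" using to_Homeo_simps(2)[OF KX] g(2) by simp
      then show "h \<in> s" using to_Homeo_continuous[OF g(1)] g(2) by (simp add: KU(3) to_Homeo_def)
    qed
    then show ?case using r(1) by (intro exI[of _ "{r}"]) simp
  qed simp
  moreover have "nbhd f R \<subseteq> to_Homeo ` Aut" for f R by (auto simp: nbhd_def)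
  ultimately show ?R using T'(2) by (metis IntD1 Int_lower2 le_inf_iff)
next
  assume R: ?R
  show ?L
  proof (subst openin_subopen, intro ballI)
    fix h assume h: "h \<in> T"
    then obtain f where f: "f \<in> Aut" "h = to_Homeo f" using R by blast
    then obtain R where R': "finite R" "R \<subseteq> clopens X" "nbhd f R \<subseteq> T" using R h by blast
    show "\<exists>U. openin (Homeo_topology X) U \<and> h \<in> U \<and> U \<subseteq> T"
      using openin_nbhd[OF f(1) R'(1,2)] nbhd_self[OF f(1)] f(2) R'(3) by blast
  qed
qed

lemma openin_HomeoE:
  assumes "openin (Homeo_topology X) T" "f \<in> Aut" "to_Homeo f \<in> T"
  obtains R where "finite R" "R \<subseteq> clopens X" "nbhd f R \<subseteq> T"
  using assms unfolding openin_Homeo_topology by blast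

lemma openin_HomeoI:
  assumes "T \<subseteq> to_Homeo ` Aut"
    "\<And>f. f \<in> Aut \<Longrightarrow> to_Homeo f \<in> T \<Longrightarrow> \<exists>R. finite R \<and> R \<subseteq> clopens X \<and> nbhd f R \<subseteq> T"
  shows "openin (Homeo_topology X) T"
  using assms unfolding openin_Homeo_topology by blast

lemma topspace_Homeo: "topspace (Homeo_topology X) = to_Homeo ` Aut"
proof
  show "topspace (Homeo_topology X) \<subseteq> to_Homeo ` Aut"
    unfolding Homeo_topology_def topspace_subtopology carrier_Homeo by blast
  have "openin (Homeo_topology X) (to_Homeo ` Aut)"
    by (rule openin_HomeoI) (auto intro!: exI[of _ "{}"] simp: nbhd_def)
  then show "to_Homeo ` Aut \<subseteq> topspace (Homeo_topology X)" by (rule openin_subset)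
qed

text \<open>For the basic neighbourhoods continuity is explicit: \<open>g\<close> agrees with \<open>f\<close> on the inverse images of the members
of \<open>R\<close> if and only if the inverses agree on \<open>R\<close>, and \<open>a o b\<close> agrees with \<open>f o h\<close> on \<open>R\<close> if \<open>b\<close> agrees with \<open>h\<close>
on \<open>R\<close> and \<open>a\<close> agrees with \<open>f\<close> on the images of the members of \<open>R\<close> under \<open>h\<close>.\<close>

lemma topological_group_Homeo: "topological_group (Homeo X) (Homeo_topology X)"
  unfolding topological_group_def
proof (intro conjI group_Homeo)
  show "topspace (Homeo_topology X) = carrier (Homeo X)" by (simp add: topspace_Homeo carrier_Homeo)
  show "continuous_map (Homeo_topology X) (Homeo_topology X) (m_inv (Homeo X))"
    unfolding continuous_map topspace_Homeo
  proof (intro conjI allI impI)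
    show "m_inv (Homeo X) ` to_Homeo ` Aut \<subseteq> to_Homeo ` Aut" using inv_Homeo Aut_inv by auto
    fix T assume T: "openin (Homeo_topology X) T"
    let ?P = "{f \<in> to_Homeo ` Aut. inv\<^bsub>Homeo X\<^esub> f \<in> T}"
    show "openin (Homeo_topology X) ?P"
    proof (rule openin_HomeoI)
      fix f assume f: "f \<in> Aut" "to_Homeo f \<in> ?P"
      then have "to_Homeo (invf f) \<in> T" by (simp add: inv_Homeo)
      then obtain R where R: "finite R" "R \<subseteq> clopens X" "nbhd (invf f) R \<subseteq> T"
        using openin_HomeoE[OF T Aut_inv[OF f(1)]] by blast
      have "nbhd f (image (invf f) ` R) \<subseteq> ?P"
      proof
        fix h assume "h \<in> nbhd f (image (invf f) ` R)"
        from nbhdD[OF this] obtain g where g: "g \<in> Aut" "h = to_Homeo g"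
          "\<forall>r\<in>image (invf f) ` R. g ` r = f ` r" by (elim exE conjE)
        have "invf g ` r = invf f ` r" if "r \<in> R" for r
        proof -
          have "g ` invf f ` r = f ` invf f ` r" using g(3) that by blast
          then have "g ` invf f ` r = r" using AutD(1)[OF f(1)] by (simp add: image_f_inv_f bij_is_surj)
          then show ?thesis using AutD(1)[OF g(1)] by (metis bij_is_inj image_inv_f_f)
        qed
        then have "to_Homeo (invf g) \<in> nbhd (invf f) R" using nbhd_iff Aut_inv[OF g(1)] by simp
        then show "h \<in> ?P" using R(3) g inv_Homeo[OF g(1)] by auto
      qed
      moreover have "image (invf f) ` R \<subseteq> clopens X" using R(2) AutD(3)[OF Aut_inv[OF f(1)]] by auto
      ultimately show "\<exists>R. finite R \<and> R \<subseteq> clopens X \<and> nbhd f R \<subseteq> ?P" using R(1) by blast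
    qed blast
  qed
  show "continuous_map (prod_topology (Homeo_topology X) (Homeo_topology X)) (Homeo_topology X)
      (\<lambda>(x, y). x \<otimes>\<^bsub>Homeo X\<^esub> y)"
    unfolding continuous_map topspace_prod_topology topspace_Homeo
  proof (intro conjI allI impI)
    show "(\<lambda>(x, y). x \<otimes>\<^bsub>Homeo X\<^esub> y) ` (to_Homeo ` Aut \<times> to_Homeo ` Aut) \<subseteq> to_Homeo ` Aut"
      using mult_Homeo Aut_comp by auto
    fix T assume T: "openin (Homeo_topology X) T"
    let ?P = "{z \<in> to_Homeo ` Aut \<times> to_Homeo ` Aut. (case z of (x, y) \<Rightarrow> x \<otimes>\<^bsub>Homeo X\<^esub> y) \<in> T}"
    show "openin (prod_topology (Homeo_topology X) (Homeo_topology X)) ?P"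
      unfolding openin_prod_topology_alt
    proof (intro allI impI)
      fix x y assume "(x, y) \<in> ?P"
      then obtain f h where fh: "f \<in> Aut" "h \<in> Aut" "x = to_Homeo f" "y = to_Homeo h"
        "to_Homeo (f \<circ> h) \<in> T" by (auto simp: mult_Homeo)
      then obtain R where R: "finite R" "R \<subseteq> clopens X" "nbhd (f \<circ> h) R \<subseteq> T"
        using openin_HomeoE[OF T Aut_comp[OF fh(1,2)]] by blast
      let ?U = "nbhd f (image h ` R)" and ?V = "nbhd h R"
      have "openin (Homeo_topology X) ?U"
        by (rule openin_nbhd[OF fh(1)]) (use R AutD(3)[OF fh(2)] in auto)
      moreover have "openin (Homeo_topology X) ?V" by (rule openin_nbhd[OF fh(2) R(1,2)])
      moreover have "x \<in> ?U" "y \<in> ?V" using fh nbhd_self by auto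
      moreover have "?U \<times> ?V \<subseteq> ?P"
      proof
        fix z assume z: "z \<in> ?U \<times> ?V"
        obtain u v where uv: "z = (u, v)" "u \<in> ?U" "v \<in> ?V" using z by blast
        from nbhdD[OF uv(2)] obtain a where a: "a \<in> Aut" "u = to_Homeo a"
          "\<forall>r\<in>image h ` R. a ` r = f ` r" by (elim exE conjE)
        from nbhdD[OF uv(3)] obtain b where b: "b \<in> Aut" "v = to_Homeo b" "\<forall>r\<in>R. b ` r = h ` r"
          by (elim exE conjE)
        have "(a \<circ> b) ` r = (f \<circ> h) ` r" if "r \<in> R" for r
        proof -
          have "a ` b ` r = f ` h ` r" using a(3) b(3) that by auto
          then show ?thesis by (simp only: image_comp)
        qed
        then have "to_Homeo (a \<circ> b) \<in> nbhd (f \<circ> h) R"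
          unfolding nbhd_iff[OF Aut_comp[OF a(1) b(1)]] by (rule ballI)
        then have "to_Homeo (a \<circ> b) \<in> T" using R(3) by (rule subsetD[rotated])
        then show "z \<in> ?P" using uv(1) a(1,2) b(1,2) by (simp add: mult_Homeo)
      qed
      ultimately show "\<exists>U V. openin (Homeo_topology X) U \<and> openin (Homeo_topology X) V \<and> x \<in> U \<and> y \<in> V \<and> U \<times> V \<subseteq> ?P"
        by blast
    qed
  qed
qed

end

section \<open>Automatic continuity\<close>

primrec set_products :: "'g monoid \<Rightarrow> 'g set \<Rightarrow> nat \<Rightarrow> 'g set" where
  "set_products G P 0 = {\<one>\<^bsub>G\<^esub>}"
| "set_products G P (Suc n) = {a \<otimes>\<^bsub>G\<^esub> b | a b. a \<in> P \<and> b \<in> set_products G P n}"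

lemma set_products_mono: "P \<subseteq> Q \<Longrightarrow> set_products G P n \<subseteq> set_products G Q n"
proof (induction n)
  case (Suc n) then show ?case by fastforce
qed simp

lemma topological_group_mult_nbhd:
  assumes G: "topological_group G S" and B: "openin S B"
    and xy: "x \<in> carrier G" "y \<in> carrier G" "x \<otimes>\<^bsub>G\<^esub> y \<in> B"
  obtains U V where "openin S U" "openin S V" "x \<in> U" "y \<in> V"
    "\<And>u v. u \<in> U \<Longrightarrow> v \<in> V \<Longrightarrow> u \<otimes>\<^bsub>G\<^esub> v \<in> B"
proof -
  let ?P = "{z \<in> topspace (prod_topology S S). (case z of (u, v) \<Rightarrow> u \<otimes>\<^bsub>G\<^esub> v) \<in> B}"
  have top: "topspace S = carrier G" using G by (simp add: topological_group_def)
  have "continuous_map (prod_topology S S) S (\<lambda>(u, v). u \<otimes>\<^bsub>G\<^esub> v)"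
    using G by (simp add: topological_group_def)
  then have "openin (prod_topology S S) ?P" using B by (rule openin_continuous_map_preimage)
  moreover have "(x, y) \<in> ?P" using xy by (simp add: top)
  ultimately have "\<exists>U V. openin S U \<and> openin S V \<and> x \<in> U \<and> y \<in> V \<and> U \<times> V \<subseteq> ?P"
    unfolding openin_prod_topology_alt by simp
  then obtain U V where UV: "openin S U" "openin S V" "x \<in> U" "y \<in> V" "U \<times> V \<subseteq> ?P"
    by (elim exE conjE)
  have "u \<otimes>\<^bsub>G\<^esub> v \<in> B" if "u \<in> U" "v \<in> V" for u v
  proof -
    have "(u, v) \<in> ?P" using UV(5) that by (intro subsetD[OF UV(5)] SigmaI)
    then show ?thesis by simp
  qed
  with UV(1-4) show thesis by (rule that)
qed

lemma topological_group_inv_open: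
  assumes G: "topological_group G S" and B: "openin S B"
  shows "openin S {x \<in> carrier G. inv\<^bsub>G\<^esub> x \<in> B}"
  using openin_continuous_map_preimage[of S S "m_inv G" B] G B by (auto simp: topological_group_def)

lemma topological_group_translate_open:
  assumes G: "topological_group G S" and B: "openin S B" and a: "a \<in> carrier G"
  shows "openin S {x \<in> carrier G. a \<otimes>\<^bsub>G\<^esub> x \<in> B}"
proof (subst openin_subopen, intro ballI)
  fix x assume x: "x \<in> {x \<in> carrier G. a \<otimes>\<^bsub>G\<^esub> x \<in> B}"
  then obtain U V where "openin S U" "openin S V" "a \<in> U" "x \<in> V"
    "\<And>u v. u \<in> U \<Longrightarrow> v \<in> V \<Longrightarrow> u \<otimes>\<^bsub>G\<^esub> v \<in> B"
    using topological_group_mult_nbhd[OF G B a] by blast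
  then show "\<exists>T. openin S T \<and> x \<in> T \<and> T \<subseteq> {x \<in> carrier G. a \<otimes>\<^bsub>G\<^esub> x \<in> B}"
    using G openin_subset[of S V] by (intro exI[of _ V]) (auto simp: topological_group_def)
qed

lemma topological_group_small_products:
  assumes G: "topological_group G S" and B: "openin S B" "\<one>\<^bsub>G\<^esub> \<in> B"
  shows "\<exists>P. openin S P \<and> \<one>\<^bsub>G\<^esub> \<in> P \<and> set_products G P n \<subseteq> B"
  using B
proof (induction n arbitrary: B)
  case 0 then show ?case by auto
next
  case (Suc n)
  have grp: "group G" using G by (simp add: topological_group_def)
  then have one: "\<one>\<^bsub>G\<^esub> \<in> carrier G" "\<one>\<^bsub>G\<^esub> \<otimes>\<^bsub>G\<^esub> \<one>\<^bsub>G\<^esub> = \<one>\<^bsub>G\<^esub>"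
    by (auto simp: group.is_monoid monoid.l_one)
  then obtain U V where UV: "openin S U" "openin S V" "\<one>\<^bsub>G\<^esub> \<in> U" "\<one>\<^bsub>G\<^esub> \<in> V"
    "\<And>u v. u \<in> U \<Longrightarrow> v \<in> V \<Longrightarrow> u \<otimes>\<^bsub>G\<^esub> v \<in> B"
    using topological_group_mult_nbhd[OF G Suc.prems(1) one(1,1)] Suc.prems(2) by metis
  obtain P where P: "openin S P" "\<one>\<^bsub>G\<^esub> \<in> P" "set_products G P n \<subseteq> V" using Suc.IH[OF UV(2,4)] by blast
  have "set_products G (P \<inter> U) n \<subseteq> V" using set_products_mono[of "P \<inter> U" P G n] P(3) by blast
  then have "set_products G (P \<inter> U) (Suc n) \<subseteq> B" using UV(5) by auto
  then show ?case using P UV by (intro exI[of _ "P \<inter> U"]) auto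
qed

text \<open>Colour \<open>x\<close> by a member \<open>d x\<close> of a countable dense set that lies in \<open>x Q\<close> for a small neighbourhood \<open>Q\<close> of the
identity. If \<open>d x = d y\<close>, the quotient of \<open>x\<close> and \<open>y\<close> lies in the product of \<open>Q\<close> and its inverse.\<close>

lemma topological_group_countable_translates:
  assumes G: "topological_group G S" and sep: "separable_space S" and P: "openin S P" "\<one>\<^bsub>G\<^esub> \<in> P"
  shows "\<exists>c :: 'g \<Rightarrow> nat. \<forall>x\<in>carrier G. \<forall>y\<in>carrier G. c x = c y \<longrightarrow> inv\<^bsub>G\<^esub> x \<otimes>\<^bsub>G\<^esub> y \<in> P"
proof -
  have grp: "group G" and top: "topspace S = carrier G" using G by (auto simp: topological_group_def)
  interpret group G by (rule grp)
  obtain U V where UV: "openin S U" "openin S V" "\<one>\<^bsub>G\<^esub> \<in> U" "\<one>\<^bsub>G\<^esub> \<in> V"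
    "\<And>u v. u \<in> U \<Longrightarrow> v \<in> V \<Longrightarrow> u \<otimes>\<^bsub>G\<^esub> v \<in> P"
    using topological_group_mult_nbhd[OF G P(1) one_closed one_closed] P(2) by auto
  define Q where "Q = U \<inter> {x \<in> carrier G. inv\<^bsub>G\<^esub> x \<in> V}"
  have Q: "openin S Q" "\<one>\<^bsub>G\<^esub> \<in> Q"
    unfolding Q_def using UV topological_group_inv_open[OF G UV(2)] by auto
  obtain D where D: "countable D" "D \<subseteq> carrier G" "S closure_of D = carrier G"
    using sep by (auto simp: separable_space_def top)
  have "\<exists>d\<in>D. inv\<^bsub>G\<^esub> x \<otimes>\<^bsub>G\<^esub> d \<in> Q" if x: "x \<in> carrier G" for x
  proof -
    have "openin S {y \<in> carrier G. inv\<^bsub>G\<^esub> x \<otimes>\<^bsub>G\<^esub> y \<in> Q}"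
      using topological_group_translate_open[OF G Q(1)] x by simp
    moreover have "x \<in> {y \<in> carrier G. inv\<^bsub>G\<^esub> x \<otimes>\<^bsub>G\<^esub> y \<in> Q}" using x Q(2) by simp
    moreover have "\<forall>N. x \<in> N \<and> openin S N \<longrightarrow> (\<exists>d. d \<in> D \<and> d \<in> N)"
      using D(3) x in_closure_of[of x S D] by blast
    ultimately have "\<exists>d. d \<in> D \<and> d \<in> {y \<in> carrier G. inv\<^bsub>G\<^esub> x \<otimes>\<^bsub>G\<^esub> y \<in> Q}"
      by (elim allE impE) (intro conjI)
    then show ?thesis by auto
  qed
  then have "\<forall>x\<in>carrier G. \<exists>d. d \<in> D \<and> inv\<^bsub>G\<^esub> x \<otimes>\<^bsub>G\<^esub> d \<in> Q" by blast
  from bchoice[OF this] obtain d where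
    d': "\<forall>x\<in>carrier G. d x \<in> D \<and> inv\<^bsub>G\<^esub> x \<otimes>\<^bsub>G\<^esub> d x \<in> Q" by (elim exE)
  then have d: "d x \<in> D \<and> inv\<^bsub>G\<^esub> x \<otimes>\<^bsub>G\<^esub> d x \<in> Q" if "x \<in> carrier G" for x using that by simp
  have "inv\<^bsub>G\<^esub> x \<otimes>\<^bsub>G\<^esub> y \<in> P"
    if x: "x \<in> carrier G" and y: "y \<in> carrier G" and eq: "to_nat_on D (d x) = to_nat_on D (d y)" for x y
  proof -
    have dxy: "d x = d y" using eq d[OF x] d[OF y] D(1) by (metis to_nat_on_inj)
    have dc: "d x \<in> carrier G" using d[OF x] D(2) by blast
    have "inv\<^bsub>G\<^esub> (inv\<^bsub>G\<^esub> y \<otimes>\<^bsub>G\<^esub> d x) \<in> V" "inv\<^bsub>G\<^esub> x \<otimes>\<^bsub>G\<^esub> d x \<in> U"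
      using d[OF x] d[OF y] dxy by (auto simp: Q_def)
    then have "inv\<^bsub>G\<^esub> x \<otimes>\<^bsub>G\<^esub> d x \<otimes>\<^bsub>G\<^esub> inv\<^bsub>G\<^esub> (inv\<^bsub>G\<^esub> y \<otimes>\<^bsub>G\<^esub> d x) \<in> P" using UV(5) by blast
    moreover have "inv\<^bsub>G\<^esub> x \<otimes>\<^bsub>G\<^esub> d x \<otimes>\<^bsub>G\<^esub> inv\<^bsub>G\<^esub> (inv\<^bsub>G\<^esub> y \<otimes>\<^bsub>G\<^esub> d x) = inv\<^bsub>G\<^esub> x \<otimes>\<^bsub>G\<^esub> y"
    proof -
      have "inv\<^bsub>G\<^esub> (inv\<^bsub>G\<^esub> y \<otimes>\<^bsub>G\<^esub> d x) = inv\<^bsub>G\<^esub> d x \<otimes>\<^bsub>G\<^esub> y" using y dc by (simp add: inv_mult_group)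
      moreover have "d x \<otimes>\<^bsub>G\<^esub> (inv\<^bsub>G\<^esub> d x \<otimes>\<^bsub>G\<^esub> y) = y" using y dc by (simp flip: m_assoc)
      ultimately show ?thesis using x y dc by (simp add: m_assoc)
    qed
    ultimately show ?thesis by simp
  qed
  then show ?thesis by (intro exI[of _ "\<lambda>x. to_nat_on D (d x)"]) blast
qed

context Stone begin

text \<open>By translation it suffices to be continuous at the identity. The colouring of \<open>H\<close>, pulled back to the
homeomorphism group, makes the preimage \<open>W\<close> of a small symmetric neighbourhood an instance of
coloured_group.\<close>

theorem Homeo_hom_continuous:
  fixes H :: "'h monoid"
  assumes stable: "stable_space X" and H: "topological_group H T" "separable_space T"
    and \<phi>: "\<phi> \<in> hom (Homeo X) H"
  shows "continuous_map (Homeo_topology X) T \<phi>"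
proof -
  define \<psi> where "\<psi> g = \<phi> (to_Homeo g)" for g
  have grpH: "group H" and topH: "topspace T = carrier H" using H(1) by (auto simp: topological_group_def)
  interpret H: group H by (rule grpH)
  interpret \<phi>: group_hom "Homeo X" H \<phi>
    by (rule group_hom.intro) (simp_all add: group_Homeo grpH group_hom_axioms_def \<phi>)
  have car: "to_Homeo g \<in> carrier (Homeo X)" if "g \<in> Aut" for g using that by (simp add: carrier_Homeo)
  have \<psi>: "\<psi> g \<in> carrier H" if "g \<in> Aut" for g using car[OF that] by (simp add: \<psi>_def)
  have \<psi>_mult: "\<psi> (g \<circ> h) = \<psi> g \<otimes>\<^bsub>H\<^esub> \<psi> h" if "g \<in> Aut" "h \<in> Aut" for g h
    using mult_Homeo[OF that] \<phi>.hom_mult[OF car[OF that(1)] car[OF that(2)]] by (simp add: \<psi>_def)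
  have \<psi>_inv: "\<psi> (invf g) = inv\<^bsub>H\<^esub> \<psi> g" if "g \<in> Aut" for g
    using inv_Homeo[OF that] \<phi>.hom_inv[OF car[OF that]] by (simp add: \<psi>_def)
  have \<psi>_id: "\<psi> id = \<one>\<^bsub>H\<^esub>" using \<phi>.hom_one by (simp add: \<psi>_def one_Homeo)
  have small: "\<exists>Q. finite Q \<and> Q \<subseteq> clopens X \<and> (\<forall>g\<in>Aut. (\<forall>r\<in>Q. g ` r = r) \<longrightarrow> \<psi> g \<in> B)"
    if B: "openin T B" "\<one>\<^bsub>H\<^esub> \<in> B" for B
  proof -
    obtain P where P: "openin T P" "\<one>\<^bsub>H\<^esub> \<in> P" "set_products H P 82 \<subseteq> B"
      using topological_group_small_products[OF H(1) B] by blast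
    define P' where "P' = P \<inter> {x \<in> carrier H. inv\<^bsub>H\<^esub> x \<in> P}"
    have P': "openin T P'" "\<one>\<^bsub>H\<^esub> \<in> P'"
      unfolding P'_def using P topological_group_inv_open[OF H(1) P(1)] by auto
    obtain c :: "'h \<Rightarrow> nat" where c: "\<forall>x\<in>carrier H. \<forall>y\<in>carrier H. c x = c y \<longrightarrow> inv\<^bsub>H\<^esub> x \<otimes>\<^bsub>H\<^esub> y \<in> P'"
      using topological_group_countable_translates[OF H P'] by blast
    define W where "W = {g \<in> Aut. \<psi> g \<in> P'}"
    interpret coloured_group "topspace X" "clopens X" W "\<lambda>g. c (\<psi> g)"
    proof
      show "W \<subseteq> Aut" by (auto simp: W_def)
      show "invf w \<in> W" if "w \<in> W" for w
        using that Aut_inv \<psi>_inv by (auto simp: W_def P'_def)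
      show "invf g \<circ> h \<in> W" if "g \<in> Aut" "h \<in> Aut" "c (\<psi> g) = c (\<psi> h)" for g h
      proof -
        have "\<psi> (invf g \<circ> h) = inv\<^bsub>H\<^esub> \<psi> g \<otimes>\<^bsub>H\<^esub> \<psi> h"
          using that Aut_inv \<psi>_mult \<psi>_inv by simp
        moreover have "invf g \<circ> h \<in> Aut" using that by (intro Aut_comp Aut_inv)
        ultimately show ?thesis using c that \<psi> by (simp add: W_def)
      qed
    qed
    have prods: "\<psi> g \<in> set_products H P n" if "g \<in> products n" for g n
      using that
    proof (induction n arbitrary: g)
      case 0
      then have "g = id" by (simp only: products.simps singleton_iff)
      then show ?case by (simp only: \<psi>_id set_products.simps singleton_iff)
    next
      case (Suc n)
      then obtain w v where wv: "g = w \<circ> v" "w \<in> W" "v \<in> products n" by auto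
      then have "\<psi> g = \<psi> w \<otimes>\<^bsub>H\<^esub> \<psi> v" using \<psi>_mult products_Aut by (auto simp: W_def)
      moreover have "\<psi> w \<in> P" using wv(2) by (simp add: W_def P'_def)
      ultimately show ?case using Suc.IH[OF wv(3)] by auto
    qed
    have "\<exists>U. stable x U" if "x \<in> topspace X" for x
      using stable stable_nbhd_stable that unfolding stable_space_def by blast
    then obtain Q where Q: "finite Q" "Q \<subseteq> clopens X" "\<forall>g\<in>Aut. (\<forall>r\<in>Q. g ` r = r) \<longrightarrow> g \<in> products 82"
      using stable_imp_neighbourhood_in_products by metis
    have "\<psi> g \<in> B" if "g \<in> Aut" "\<forall>r\<in>Q. g ` r = r" for g
      using Q(3) that prods[of g 82] P(3) by blast
    then show ?thesis using Q(1,2) by (intro exI[of _ Q]) simp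
  qed
  show ?thesis
    unfolding continuous_map topspace_Homeo
  proof (intro conjI allI impI)
    show "\<phi> ` to_Homeo ` Aut \<subseteq> topspace T" using \<psi> by (auto simp: topH \<psi>_def)
    fix B assume B: "openin T B"
    show "openin (Homeo_topology X) {f \<in> to_Homeo ` Aut. \<phi> f \<in> B}"
    proof (rule openin_HomeoI)
      fix f assume f: "f \<in> Aut" "to_Homeo f \<in> {f \<in> to_Homeo ` Aut. \<phi> f \<in> B}"
      then have fB: "\<psi> f \<in> B" by (simp add: \<psi>_def)
      have "openin T {x \<in> carrier H. \<psi> f \<otimes>\<^bsub>H\<^esub> x \<in> B}"
        using topological_group_translate_open[OF H(1) B \<psi>[OF f(1)]] .
      moreover have "\<one>\<^bsub>H\<^esub> \<in> {x \<in> carrier H. \<psi> f \<otimes>\<^bsub>H\<^esub> x \<in> B}" using fB \<psi>[OF f(1)] by simp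
      ultimately obtain Q where Q: "finite Q" "Q \<subseteq> clopens X"
        "\<forall>g\<in>Aut. (\<forall>r\<in>Q. g ` r = r) \<longrightarrow> \<psi> g \<in> {x \<in> carrier H. \<psi> f \<otimes>\<^bsub>H\<^esub> x \<in> B}"
        using small by meson
      have "nbhd f Q \<subseteq> {f \<in> to_Homeo ` Aut. \<phi> f \<in> B}"
      proof
        fix h assume "h \<in> nbhd f Q"
        from nbhdD[OF this] obtain g where g: "g \<in> Aut" "h = to_Homeo g" "\<forall>r\<in>Q. g ` r = f ` r"
          by (elim exE conjE)
        let ?k = "invf f \<circ> g"
        have k: "?k \<in> Aut" using f(1) g(1) by (intro Aut_comp Aut_inv)
        have "?k ` r = r" if "r \<in> Q" for r
        proof -
          have "?k ` r = invf f ` g ` r" by (simp only: image_comp)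
          also have "g ` r = f ` r" using g(3) that by blast
          also have "invf f ` f ` r = r" using AutD(1)[OF f(1)] by (simp add: bij_is_inj image_inv_f_f)
          finally show ?thesis .
        qed
        then have "\<psi> f \<otimes>\<^bsub>H\<^esub> \<psi> ?k \<in> B" using Q(3) k by simp
        moreover have "f \<circ> ?k = g" using AutD(1)[OF f(1)] by (simp add: fun_eq_iff bij_inv_cancel)
        ultimately have "\<psi> g \<in> B" using \<psi>_mult[OF f(1) k] by simp
        then show "h \<in> {f \<in> to_Homeo ` Aut. \<phi> f \<in> B}" using g by (simp add: \<psi>_def)
      qed
      then show "\<exists>R. finite R \<and> R \<subseteq> clopens X \<and> nbhd f R \<subseteq> {f \<in> to_Homeo ` Aut. \<phi> f \<in> B}"
        using Q(1,2) by (intro exI[of _ Q] conjI)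
    qed blast
  qed
qed

end

theorem theoremB:
  fixes X :: "'a topology"
  assumes "second_countable_Stone_space X"
    and "stable_space X"
  shows "automatic_continuity TYPE('h) (Homeo X) (Homeo_topology X)"
proof -
  interpret Stone X
    by (intro Stone.intro Stone_axioms.intro clopen_algebra_clopens assms)
  show ?thesis
    unfolding automatic_continuity_def
    using topological_group_Homeo Homeo_hom_continuous[OF assms(2)] by blast
qed

end
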